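(* Let $d=3$. Assume that for almost every $\omega\in\Omega$ each inclusion $\omega^k$ belongs to a finite set of shapes, up to rigid translations and rotations, and that $\mathsf C_0$ is isotropic, i.e. $\mathsf C_0\xi=c_1(\operatorname{tr}\xi)I+c_2\operatorname{sym}\xi$ for some $c_1,c_2\in\mathbb R$, where $\operatorname{sym}\xi=(\xi+\xi^T)/2$. Let $\lambda\in[0,+\infty)\setminus\sigma(\mathcal A_0)$. (a) If $P(\omega^0\in\mathfrak H)=P(\omega^0\in S_j\mathfrak H)$ for all $\mathfrak H\in\mathcal H$ and all $j\in\{1,2,3\}$, then the matrix $\boldsymbol\beta(\lambda)$ is diagonal. (b) If $P(\omega^0\in\mathfrak H)=P(\omega^0\in R_j^{\pi/2}\mathfrak H)$ for all $\mathfrak H\in\mathcal H$ and all $j\in\{1,2,3\}$, then the matrix $\boldsymbol\beta(\lambda)$ is scalar, i.e. proportional to the identity matrix.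
   Context: **Geometry.** $\Omega$ is a set, invariant under all translations of $\mathbb R^d$ (here $d=3$), whose elements $\omega$ are subsets of $\mathbb R^d$ with the following properties. (1) For all $\omega\in\Omega$, $\mathbb R^d\setminus\omega$ is connected and $\omega=\bigsqcup_{k\in\mathbb N}\omega^k$ (disjoint union), where each $\omega^k$ (an "inclusion") is open and connected, $\operatorname{diam}\omega^k<\frac12$, and there is $\tau>0$, uniform in $\omega$, with $\operatorname{dist}(\omega^k,\omega^j)>\tau$ for all $j\ne k$. (2) There exist $N\in\mathbb N$, pairs $(P_1^j,P_2^j)$, $j=1,\dots,N$, of open Lipschitz domains in $\mathbb R^d$ with $\overline{P_1^j}\subset P_2^j$, and universal constants $c,C,\tilde C>0$ such that for every $\omega\in\Omega$ and $k\in\mathbb N$ there are $j=j(k)$, a bounded open neighbourhood $\widetilde{\mathcal B_\omega^k}\supset\omega^k$ and a $C^2$ diffeomorphism $\varphi_k:P_2^j\to\widetilde{\mathcal B_\omega^k}$ with $\varphi_k(\overline{P_1^j})=\overline{\omega^k}$, $c|x-y|\le|\varphi_k(x)-\varphi_k(y)|\le C|x-y|$ and $\|\varphi_k\|_{C^2(P_2^j)}\le\tilde C$. **Probability.** $\mathcal F$ is the $\sigma$-algebra on $\Omega$ generated by the maps $\omega\mapsto\mathbb 1_\omega(q)$, $q\in\mathbb Q^d$. For $y\in\mathbb R^d$, $T_y\omega:=\{z-y\,|\,z\in\omega\}$. $P$ is a probability measure on $(\Omega,\mathcal F)$, invariant under and ergodic with respect to $(T_y)_{y\in\mathbb R^d}$.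 $\mathbb E$ is the expectation. For a random variable $\overline{\mathbf f}$ on $\Omega$ (marked with an overline), its stationary extension is $\mathbf f(y,\omega):=\overline{\mathbf f}(T_y\omega)$; $\mathbb E[\mathbf f]:=\mathbb E[\overline{\mathbf f}]$. **The inclusion at the origin and symmetries.** $\omega^0$ denotes the connected component of $\omega$ containing the origin of $\mathbb R^3$, and $\omega^0:=\emptyset$ if $0\notin\omega$. The map $\omega\mapsto\omega^0$ is measurable when its target space (of subsets of $[-2,2]^3$) is endowed with the $\sigma$-algebra $\mathcal H$ generated by the topology induced by the Hausdorff distance. $S_j$ is the reflection of $\mathbb R^3$ across the plane $\{x_j=0\}$, and $R_j^{\pi/2}$ is the counterclockwise rotation by $\pi/2$ about the $x_j$ coordinate axis. $S_j\mathfrak H$ and $R_j^{\pi/2}\mathfrak H$ are obtained by applying the symmetry to each element of $\mathfrak H$. **Function spaces and operators.** Bold letters denote spaces of $\mathbb R^d$-valued functions. $\mathbf H^1(\Omega):=\{\overline{\mathbf f}\in\mathbf L^2(\Omega)\,|\,\mathbf f\in H^1_{\mathrm{loc}}(\mathbb R^d;\mathbf L^2(\Omega))\}$ (derivatives in $y$ are stationary extensions of elements of $\mathbf L^2(\Omega)$). $\mathbf L^2_0(\Omega)$ (resp. $\mathbf H^1_0(\Omega)$) is the set of $\overline{\mathbf f}\in\mathbf L^2(\Omega)$ (resp. $\mathbf H^1(\Omega)$) with $\mathbf f(\cdot,\omega)|_{\mathbb R^d\setminus\omega}=0$ for a.e. $\omega$. $\mathsf C_0\in\mathbb R^{d^4}$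 is a constant tensor with $(\mathsf C_0)_{\alpha\beta\mu\nu}=(\mathsf C_0)_{\mu\nu\alpha\beta}=(\mathsf C_0)_{\alpha\beta\nu\mu}$ and $(\mathsf C_0)_{\alpha\beta\mu\nu}\xi_{\alpha\beta}\xi_{\mu\nu}\ge c|\xi|^2$ for all symmetric $\xi$, with some $c>0$. Convention: $\mathsf C\nabla\mathbf u\cdot\nabla\mathbf v=\mathsf C_{\alpha\beta\mu\nu}\,\partial_\mu\mathbf u_\nu\,\partial_\alpha\mathbf v_\beta$. $\mathcal A_0$ is the self-adjoint operator in $\mathbf L^2_0(\Omega)$ associated with the form $\mathbb E[\mathsf C_0\nabla_y\mathbf u\cdot\nabla_y\boldsymbol\varphi]$, $\overline{\mathbf u},\overline{\boldsymbol\varphi}\in\mathbf H^1_0(\Omega)$. **The $\beta$-matrix.** For $\lambda\notin\sigma(\mathcal A_0)$ and $i=1,\dots,d$, $\overline{\mathbf b_\lambda^{(i)}}\in\mathbf H^1_0(\Omega)$ is the unique solution of $\mathcal A_0\overline{\mathbf b_\lambda^{(i)}}=\lambda\overline{\mathbf b_\lambda^{(i)}}+\mathbf e_i$, i.e. $\mathbb E[\mathsf C_0\nabla_y\mathbf b_\lambda^{(i)}\cdot\nabla_y\boldsymbol\varphi]=\mathbb E[(\lambda\overline{\mathbf b_\lambda^{(i)}}+\mathbf e_i)\cdot\overline{\boldsymbol\varphi}]$ for all $\overline{\boldsymbol\varphi}\in\mathbf H^1_0(\Omega)$, with $(\mathbf e_i)_j=\delta_{ij}$. $\overline{\mathbf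 b_\lambda}$ is the $d\times d$ matrix with columns $\overline{\mathbf b_\lambda^{(1)}},\dots,\overline{\mathbf b_\lambda^{(d)}}$, and $\boldsymbol\beta(\lambda):=\mathbb E[\lambda I+\lambda^2\,\overline{\mathbf b_\lambda}]$ for $\lambda\in[0,+\infty)\setminus\sigma(\mathcal A_0)$, $I$ being the identity matrix.
   Formalization: In geometry condition (2), φ_k also maps P_1^j onto ω^k (not only closure onto closure), without which the Hausdorff law does not determine ω^0 and the claim fails; and the C^2 bound on φ_k is taken up to an additive constant, since the literal bound leaves no admissible ω. *)

theory Defs
  imports "HOL-Probability.Probability"
begin

type_synonym vec3 = "real^3"
type_synonym mat3 = "real^3^3"
type_synonym tensor4 = "real^3^3^3^3"

section \<open>Smooth functions and Lipschitz domains\<close>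

definition partial_deriv :: "3 \<Rightarrow> (vec3 \<Rightarrow> 'b::real_normed_vector) \<Rightarrow> vec3 \<Rightarrow> 'b" where
  "partial_deriv i f x = frechet_derivative f (at x) (axis i 1)"

(* f is of class C^k on U; meant for open U. *)
primrec cont_diff_on :: "nat \<Rightarrow> vec3 set \<Rightarrow> (vec3 \<Rightarrow> 'b::real_normed_vector) \<Rightarrow> bool" where
  "cont_diff_on 0 U f \<longleftrightarrow> continuous_on U f"
| "cont_diff_on (Suc k) U f \<longleftrightarrow>
     (\<forall>x\<in>U. f differentiable (at x)) \<and> (\<forall>i. cont_diff_on k U (partial_deriv i f))"

definition test_function :: "(vec3 \<Rightarrow> real) \<Rightarrow> bool" where
  "test_function \<psi> \<longleftrightarrow> (\<forall>k. cont_diff_on k UNIV \<psi>) \<and> compact (closure {x. \<psi> x \<noteq> 0})"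

definition C2_diffeomorphism :: "vec3 set \<Rightarrow> vec3 set \<Rightarrow> (vec3 \<Rightarrow> vec3) \<Rightarrow> bool" where
  "C2_diffeomorphism U V \<phi> \<longleftrightarrow>
     bij_betw \<phi> U V \<and> cont_diff_on 2 U \<phi> \<and> cont_diff_on 2 V (the_inv_into U \<phi>)"

definition C2_norm_le :: "vec3 set \<Rightarrow> (vec3 \<Rightarrow> vec3) \<Rightarrow> real \<Rightarrow> bool" where
  "C2_norm_le U \<phi> K \<longleftrightarrow>
     (\<forall>x\<in>U. norm (\<phi> x) \<le> K \<and>
            (\<forall>i. norm (partial_deriv i \<phi> x) \<le> K) \<and>
            (\<forall>i j. norm (partial_deriv j (partial_deriv i \<phi>) x) \<le> K))"

(* Near each boundary point x the domain is the strict epigraph, in the direction of a unit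
   vector e, of a Lipschitz function g defined on the plane orthogonal to e.  No uniformity in x
   is imposed: it is automatic for bounded domains, the only ones to which this is applied. *)
definition lipschitz_domain :: "vec3 set \<Rightarrow> bool" where
  "lipschitz_domain U \<longleftrightarrow>
     open U \<and> connected U \<and> U \<noteq> {} \<and>
     (\<forall>x\<in>frontier U. \<exists>r>0. \<exists>e L g.
        norm e = 1 \<and> L-lipschitz_on {w. e \<bullet> w = 0} (g :: vec3 \<Rightarrow> real) \<and>
        (\<forall>z\<in>ball x r. z \<in> U \<longleftrightarrow> e \<bullet> (z - x) > g ((z - x) - (e \<bullet> (z - x)) *\<^sub>R e)))"

section \<open>Geometry\<close>

definition shift :: "vec3 \<Rightarrow> vec3 set \<Rightarrow> vec3 set" where
  "shift y \<omega> = (\<lambda>z. z - y) ` \<omega>"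

(* incl w k is the k-th inclusion of the configuration w. *)
definition inclusion_decomposition ::
  "vec3 set set \<Rightarrow> (vec3 set \<Rightarrow> nat \<Rightarrow> vec3 set) \<Rightarrow> bool" where
  "inclusion_decomposition \<Omega> incl \<longleftrightarrow>
     (\<forall>\<omega>\<in>\<Omega>. connected (- \<omega>) \<and> \<omega> = (\<Union>k. incl \<omega> k) \<and> disjoint_family (incl \<omega>) \<and>
        (\<forall>k. incl \<omega> k \<noteq> {} \<and> open (incl \<omega> k) \<and> connected (incl \<omega> k) \<and>
             bounded (incl \<omega> k) \<and> diameter (incl \<omega> k) < 1/2)) \<and>
     (\<exists>\<tau>>0. \<forall>\<omega>\<in>\<Omega>. \<forall>j k. j \<noteq> k \<longrightarrow> setdist (incl \<omega> k) (incl \<omega> j) > \<tau>)"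

(* Two points on the reading of the regularity condition.
   - The C^2 bound is imposed on phi up to an additive constant a.  A uniform bound on phi itself
     would confine all inclusions of all configurations to one fixed ball, which is impossible in
     a translation-invariant family.
   - In addition to phi(closure P1) = closure(inclusion), the inclusion itself is phi(P1).  The
     equality of closures alone would admit, e.g., a ball minus a closed nowhere dense set of
     positive measure attached to the sphere, i.e. an inclusion that is not a Lipschitz domain and
     is not determined by its closure, while the Hausdorff distance used below only sees
     closures. *)
definition inclusion_regularity ::
  "vec3 set set \<Rightarrow> (vec3 set \<Rightarrow> nat \<Rightarrow> vec3 set) \<Rightarrow> bool" where
  "inclusion_regularity \<Omega> incl \<longleftrightarrow>
     (\<exists>(N::nat) (P1 :: nat \<Rightarrow> vec3 set) (P2 :: nat \<Rightarrow> vec3 set).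
      \<exists>c>0. \<exists>C>0. \<exists>C'>0.
        (\<forall>j\<in>{1..N}. lipschitz_domain (P1 j) \<and> lipschitz_domain (P2 j) \<and> closure (P1 j) \<subseteq> P2 j) \<and>
        (\<forall>\<omega>\<in>\<Omega>. \<forall>k. \<exists>j\<in>{1..N}. \<exists>B \<phi>.
           open B \<and> bounded B \<and> incl \<omega> k \<subseteq> B \<and>
           C2_diffeomorphism (P2 j) B \<phi> \<and>
           \<phi> ` closure (P1 j) = closure (incl \<omega> k) \<and>
           \<phi> ` P1 j = incl \<omega> k \<and>
           (\<forall>x\<in>P2 j. \<forall>y\<in>P2 j. c * norm (x - y) \<le> norm (\<phi> x - \<phi> y) \<and>
                                norm (\<phi> x - \<phi> y) \<le> C * norm (x - y)) \<and>
           (\<exists>a. C2_norm_le (P2 j) (\<lambda>x. \<phi> x - a) C')))"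

definition admissible_geometry ::
  "vec3 set set \<Rightarrow> (vec3 set \<Rightarrow> nat \<Rightarrow> vec3 set) \<Rightarrow> bool" where
  "admissible_geometry \<Omega> incl \<longleftrightarrow>
     (\<forall>\<omega>\<in>\<Omega>. \<forall>y. shift y \<omega> \<in> \<Omega>) \<and>
     inclusion_decomposition \<Omega> incl \<and> inclusion_regularity \<Omega> incl"

section \<open>Probability\<close>

definition inclusion_sigma :: "vec3 set set \<Rightarrow> vec3 set set set" where
  "inclusion_sigma \<Omega> =
     sigma_sets \<Omega> {(\<lambda>\<omega>. indicator \<omega> q :: real) -` A \<inter> \<Omega> | q A. (\<forall>i. q $ i \<in> \<rat>) \<and> A \<in> sets borel}"

definition shift_invariant :: "vec3 set measure \<Rightarrow> bool" where
  "shift_invariant P \<longleftrightarrow> (\<forall>y. shift y \<in> P \<rightarrow>\<^sub>M P \<and> distr P P (shift y) = P)"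

definition shift_ergodic :: "vec3 set measure \<Rightarrow> bool" where
  "shift_ergodic P \<longleftrightarrow>
     (\<forall>A\<in>sets P. (\<forall>y. shift y -` A \<inter> space P = A) \<longrightarrow> measure P A = 0 \<or> measure P A = 1)"

definition stationary_ergodic_law :: "vec3 set set \<Rightarrow> vec3 set measure \<Rightarrow> bool" where
  "stationary_ergodic_law \<Omega> P \<longleftrightarrow>
     prob_space P \<and> space P = \<Omega> \<and> sets P = inclusion_sigma \<Omega> \<and>
     shift_invariant P \<and> shift_ergodic P"

definition finitely_many_shapes ::
  "(vec3 set \<Rightarrow> nat \<Rightarrow> vec3 set) \<Rightarrow> vec3 set measure \<Rightarrow> bool" where
  "finitely_many_shapes incl P \<longleftrightarrow>
     (\<exists>\<S>. finite \<S> \<and>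
        (AE \<omega> in P. \<forall>k. \<exists>S\<in>\<S>. \<exists>(R::mat3) a.
           rotation_matrix R \<and> incl \<omega> k = (\<lambda>x. a + R *v x) ` S))"

section \<open>The inclusion at the origin and its symmetries\<close>

(* connected_component_set w 0 is empty when 0 is not in w. *)
definition origin_inclusion :: "vec3 set \<Rightarrow> vec3 set" where
  "origin_inclusion \<omega> = connected_component_set \<omega> 0"

(* Since Sup {} = 0 and Inf {} = \<top> in ennreal, the empty set is at infinite distance from
   every nonempty set. *)
definition hausdorff_dist :: "vec3 set \<Rightarrow> vec3 set \<Rightarrow> ennreal" where
  "hausdorff_dist A B =
     max (SUP x\<in>A. INF y\<in>B. ennreal (dist x y)) (SUP y\<in>B. INF x\<in>A. ennreal (dist x y))"

definition cube :: "vec3 set" where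
  "cube = {x. \<forall>i. x $ i \<in> {-2..2}}"

definition hausdorff_open :: "vec3 set set \<Rightarrow> bool" where
  "hausdorff_open U \<longleftrightarrow> U \<subseteq> Pow cube \<and>
     (\<forall>A\<in>U. \<exists>\<epsilon>>0. \<forall>B\<in>Pow cube. hausdorff_dist A B < \<epsilon> \<longrightarrow> B \<in> U)"

definition hausdorff_borel :: "vec3 set measure" where
  "hausdorff_borel = sigma (Pow cube) {U. hausdorff_open U}"

definition reflection :: "3 \<Rightarrow> vec3 \<Rightarrow> vec3" where
  "reflection j x = (\<chi> i. if i = j then - x $ i else x $ i)"

(* Rodrigues' formula with angle pi/2 about the unit vector axis j 1; e.g.
   quarter_turn 3 maps (x1, x2, x3) to (-x2, x1, x3). *)
definition quarter_turn :: "3 \<Rightarrow> vec3 \<Rightarrow> vec3" where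
  "quarter_turn j x = cross3 (axis j 1) x + (axis j 1 \<bullet> x) *\<^sub>R axis j 1"

definition origin_law_invariant :: "vec3 set measure \<Rightarrow> (vec3 \<Rightarrow> vec3) \<Rightarrow> bool" where
  "origin_law_invariant P g \<longleftrightarrow>
     (\<forall>H\<in>sets hausdorff_borel.
        measure P {\<omega>\<in>space P. origin_inclusion \<omega> \<in> H} =
        measure P {\<omega>\<in>space P. origin_inclusion \<omega> \<in> (\<lambda>A. g ` A) ` H})"

section \<open>Function spaces on the probability space\<close>

(* Elements of L^2 are represented by functions; identification almost everywhere is made
   explicit where it matters. *)
definition L2 :: "'a measure \<Rightarrow> ('a \<Rightarrow> 'b::euclidean_space) set" where
  "L2 P = {f \<in> borel_measurable P. integrable P (\<lambda>\<omega>. (norm (f \<omega>))\<^sup>2)}"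

definition L2norm :: "'a measure \<Rightarrow> ('a \<Rightarrow> 'b::euclidean_space) \<Rightarrow> real" where
  "L2norm P f = sqrt (\<integral>\<omega>. (norm (f \<omega>))\<^sup>2 \<partial>P)"

(* G $ mu is the weak derivative in the direction y_mu of the L^2-valued map y |-> u o shift y,
   and y |-> (G $ mu) o shift y is its stationary extension, so G $ mu $ nu is the partial
   derivative number mu of the component number nu of u.  The identity
     int (u o shift y) d_mu psi dy = - int (G $ mu o shift y) psi dy
   between L^2-valued integrals is expressed by testing with all h in L^2. *)
definition stationary_gradient ::
  "vec3 set measure \<Rightarrow> (vec3 set \<Rightarrow> vec3) \<Rightarrow> (vec3 set \<Rightarrow> mat3) \<Rightarrow> bool" where
  "stationary_gradient P u G \<longleftrightarrow> G \<in> L2 P \<and>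
     (\<forall>\<mu>. \<forall>h\<in>L2 P. \<forall>\<psi>. test_function \<psi> \<longrightarrow>
        (\<integral>y. (\<integral>\<omega>. u (shift y \<omega>) \<bullet> h \<omega> \<partial>P) * partial_deriv \<mu> \<psi> y \<partial>lborel) =
        - (\<integral>y. (\<integral>\<omega>. (G (shift y \<omega>) $ \<mu>) \<bullet> h \<omega> \<partial>P) * \<psi> y \<partial>lborel))"

definition H1 :: "vec3 set measure \<Rightarrow> (vec3 set \<Rightarrow> vec3) set" where
  "H1 P = {u \<in> L2 P. \<exists>G. stationary_gradient P u G}"

definition stat_grad :: "vec3 set measure \<Rightarrow> (vec3 set \<Rightarrow> vec3) \<Rightarrow> vec3 set \<Rightarrow> mat3" where
  "stat_grad P u = (SOME G. stationary_gradient P u G)"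

definition vanishes_outside :: "vec3 set measure \<Rightarrow> (vec3 set \<Rightarrow> vec3) \<Rightarrow> bool" where
  "vanishes_outside P u \<longleftrightarrow>
     (AE \<omega> in P. AE y in lborel. y \<notin> \<omega> \<longrightarrow> u (shift y \<omega>) = 0)"

definition L2_0 :: "vec3 set measure \<Rightarrow> (vec3 set \<Rightarrow> vec3) set" where
  "L2_0 P = {u \<in> L2 P. vanishes_outside P u}"

definition H1_0 :: "vec3 set measure \<Rightarrow> (vec3 set \<Rightarrow> vec3) set" where
  "H1_0 P = {u \<in> H1 P. vanishes_outside P u}"

section \<open>Elasticity tensor, operator and spectrum\<close>

definition tensor_apply :: "tensor4 \<Rightarrow> mat3 \<Rightarrow> mat3" where
  "tensor_apply C \<xi> = (\<chi> \<alpha> \<beta>. \<Sum>\<mu>\<in>UNIV. \<Sum>\<nu>\<in>UNIV. C $ \<alpha> $ \<beta> $ \<mu> $ \<nu> * \<xi> $ \<mu> $ \<nu>)"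

definition elasticity_tensor :: "tensor4 \<Rightarrow> bool" where
  "elasticity_tensor C \<longleftrightarrow>
     (\<forall>\<alpha> \<beta> \<mu> \<nu>. C $ \<alpha> $ \<beta> $ \<mu> $ \<nu> = C $ \<mu> $ \<nu> $ \<alpha> $ \<beta> \<and>
                 C $ \<alpha> $ \<beta> $ \<mu> $ \<nu> = C $ \<alpha> $ \<beta> $ \<nu> $ \<mu>) \<and>
     (\<exists>c>0. \<forall>\<xi>. transpose \<xi> = \<xi> \<longrightarrow> tensor_apply C \<xi> \<bullet> \<xi> \<ge> c * (norm \<xi>)\<^sup>2)"

definition isotropic :: "tensor4 \<Rightarrow> bool" where
  "isotropic C \<longleftrightarrow>
     (\<exists>c1 c2. \<forall>\<xi>. tensor_apply C \<xi> =
        (c1 * trace \<xi>) *\<^sub>R mat 1 + c2 *\<^sub>R ((1/2) *\<^sub>R (\<xi> + transpose \<xi>)))"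

definition elastic_form ::
  "vec3 set measure \<Rightarrow> tensor4 \<Rightarrow> (vec3 set \<Rightarrow> vec3) \<Rightarrow> (vec3 set \<Rightarrow> vec3) \<Rightarrow> real" where
  "elastic_form P C u v = (\<integral>\<omega>. tensor_apply C (stat_grad P u \<omega>) \<bullet> stat_grad P v \<omega> \<partial>P)"

(* The graph of the operator in L2_0 associated with the form on H1_0. *)
definition A0 ::
  "vec3 set measure \<Rightarrow> tensor4 \<Rightarrow> ((vec3 set \<Rightarrow> vec3) \<times> (vec3 set \<Rightarrow> vec3)) set" where
  "A0 P C = {(u, f). u \<in> H1_0 P \<and> f \<in> L2_0 P \<and>
     (\<forall>\<phi>\<in>H1_0 P. elastic_form P C u \<phi> = (\<integral>\<omega>. f \<omega> \<bullet> \<phi> \<omega> \<partial>P))}"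

(* For an operator A in L2_0 given by its graph: A - l is onto L2_0 and injective with bounded
   inverse (the estimate contains injectivity).  Real l suffice, since the operator of interest
   is self-adjoint. *)
definition resolvent_set ::
  "vec3 set measure \<Rightarrow> ((vec3 set \<Rightarrow> vec3) \<times> (vec3 set \<Rightarrow> vec3)) set \<Rightarrow> real set" where
  "resolvent_set P A = {l.
     (\<forall>g\<in>L2_0 P. \<exists>(u, f)\<in>A. AE \<omega> in P. f \<omega> - l *\<^sub>R u \<omega> = g \<omega>) \<and>
     (\<exists>K. \<forall>(u, f)\<in>A. L2norm P u \<le> K * L2norm P (\<lambda>\<omega>. f \<omega> - l *\<^sub>R u \<omega>))}"

definition op_spectrum ::
  "vec3 set measure \<Rightarrow> ((vec3 set \<Rightarrow> vec3) \<times> (vec3 set \<Rightarrow> vec3)) set \<Rightarrow> real set" where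
  "op_spectrum P A = - resolvent_set P A"

section \<open>The beta-matrix\<close>

definition b_solution ::
  "vec3 set measure \<Rightarrow> tensor4 \<Rightarrow> real \<Rightarrow> 3 \<Rightarrow> (vec3 set \<Rightarrow> vec3) \<Rightarrow> bool" where
  "b_solution P C l i b \<longleftrightarrow> b \<in> H1_0 P \<and>
     (\<forall>\<phi>\<in>H1_0 P. elastic_form P C b \<phi> = (\<integral>\<omega>. (l *\<^sub>R b \<omega> + axis i 1) \<bullet> \<phi> \<omega> \<partial>P))"

(* The solution is unique up to equality almost everywhere. *)
definition b_field :: "vec3 set measure \<Rightarrow> tensor4 \<Rightarrow> real \<Rightarrow> 3 \<Rightarrow> vec3 set \<Rightarrow> vec3" where
  "b_field P C l i = (SOME b. b_solution P C l i b)"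

definition b_matrix :: "vec3 set measure \<Rightarrow> tensor4 \<Rightarrow> real \<Rightarrow> vec3 set \<Rightarrow> mat3" where
  "b_matrix P C l \<omega> = (\<chi> r i. b_field P C l i \<omega> $ r)"

definition beta :: "vec3 set measure \<Rightarrow> tensor4 \<Rightarrow> real \<Rightarrow> mat3" where
  "beta P C l = (\<integral>\<omega>. l *\<^sub>R mat 1 + l\<^sup>2 *\<^sub>R b_matrix P C l \<omega> \<partial>P)"

end

theory Submission
  imports Defs
begin

text \<open>
Both parts follow from one covariance relation. Let \<open>M\<close> be the matrix of the means of the fields
\<open>b\<close>, so that \<open>\<beta> = l I + l\<^sup>2 M\<close>. If the law of the inclusion at the origin is invariant under an
orthogonal map \<open>g\<close>, then \<open>M\<close> commutes with \<open>g\<close>. Commuting with the three reflections forces \<open>M\<close> to be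
diagonal, and commuting with the three quarter turns forces it to be scalar.

The relation would be plain if the solution with load \<open>\<xi>\<close> were a function of the inclusion \<open>X \<omega>\<close> at the
origin alone, say \<open>F (X \<omega>)\<close>: then \<open>g (F (g\<inverse> (X \<omega>)))\<close> would solve the equation with load \<open>g \<xi>\<close>, by
isotropy, and its mean would be \<open>g\<close> applied to the old mean, by invariance of the law. That it is such
a function can be seen by solving an elliptic boundary value problem in each inclusion. The proof below
stays on the probability space instead. It takes the conditional expectation given \<open>X\<close> of a solution
and of its gradient, and shows that this averaged field is again a solution (\<open>condexp_solution\<close>); as
solutions are unique off the spectrum, nothing has changed by averaging.

For this, averaging has to commute with the gradient (\<open>condexp_stationary_gradient\<close>), although the
inclusion at the origin changes abruptly when the origin crosses the boundary of an inclusion. The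
gradient is first described by difference quotients: it is the strong limit of increments under
translations of the configuration (\<open>strong_gradient_of_stationary_gradient\<close> and its converse), a
consequence of the strong continuity of translations (\<open>shift_continuous_L2\<close>). The increment of a field
that vanishes outside the inclusions then splits into two orthogonal parts
(\<open>difference_remainder_decomposition\<close>). The first lives on configurations with the origin in an
inclusion; as long as the translation stays in the inclusion, the inclusions before and after determine each
other, so this part commutes with averaging. The second is the part of the field that is carried out of
the inclusions. It is a restriction of the field to an event that depends on \<open>X\<close> only, and averaging
can only decrease its norm. Both parts use that inclusions keep a uniform distance, so that a short
translation cannot lead from one inclusion into another.

For a field of the form \<open>F (X \<omega>)\<close> the same splitting expresses the size of the increments through the law
of \<open>X\<close> alone (\<open>remainder_energy\<close>), so that gradients may be transported along any symmetry of this law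
(\<open>transformed_gradient\<close>).

The assumed invariance concerns events for the Hausdorff distance, which does not separate sets with
the same closure. Lipschitz regularity enters here: inclusions are the interiors of their closures, so the
Hausdorff events contain all events of the form \<open>q \<in> X \<omega>\<close> (\<open>measurable_interior_closure\<close>).
\<close>

section \<open>Square-integrable functions\<close>

lemma L2_I: "f \<in> borel_measurable M \<Longrightarrow> integrable M (\<lambda>x. (norm (f x))\<^sup>2) \<Longrightarrow> f \<in> L2 M"
  by (simp add: L2_def)

lemma L2_measurable: "f \<in> L2 M \<Longrightarrow> f \<in> borel_measurable M"
  and L2_integrable_square: "f \<in> L2 M \<Longrightarrow> integrable M (\<lambda>x. (norm (f x))\<^sup>2)"
  by (simp_all add: L2_def)

lemma L2_dominated:
  assumes "g \<in> L2 M" "f \<in> borel_measurable M" "AE x in M. norm (f x) \<le> c * norm (g x)"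
  shows "f \<in> L2 M"
proof (rule L2_I)
  show "integrable M (\<lambda>x. (norm (f x))\<^sup>2)"
  proof (rule Bochner_Integration.integrable_bound)
    show "integrable M (\<lambda>x. c\<^sup>2 * (norm (g x))\<^sup>2)"
      using L2_integrable_square[OF assms(1)] by simp
    show "AE x in M. norm ((norm (f x))\<^sup>2) \<le> norm (c\<^sup>2 * (norm (g x))\<^sup>2)"
      using assms(3)
    proof eventually_elim
      case (elim x)
      then have "(norm (f x))\<^sup>2 \<le> (c * norm (g x))\<^sup>2"
        by (intro power_mono) auto
      then show ?case by (simp add: power_mult_distrib)
    qed
  qed (use assms(2) in measurable)
qed (fact assms(2))

lemma L2_linear_image:
  assumes "linear A" "f \<in> L2 M" shows "(\<lambda>x. A (f x)) \<in> L2 M"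
proof -
  have "bounded_linear A" using assms(1) by (simp add: linear_conv_bounded_linear)
  then obtain K where K: "\<And>x. norm (A x) \<le> K * norm x"
    using bounded_linear.bounded by (metis mult.commute)
  have [measurable]: "f \<in> borel_measurable M" by (rule L2_measurable[OF assms(2)])
  have "A \<in> borel_measurable borel"
    using \<open>bounded_linear A\<close> by (intro borel_measurable_continuous_onI linear_continuous_on)
  then have "(\<lambda>x. A (f x)) \<in> borel_measurable M" by measurable
  then show ?thesis using K by (intro L2_dominated[OF assms(2)]) auto
qed

lemma L2_scaleR: "f \<in> L2 M \<Longrightarrow> (\<lambda>x. c *\<^sub>R f x) \<in> L2 M"
  by (rule L2_linear_image) (auto intro: linearI simp: algebra_simps)

lemma L2_add:
  assumes "f \<in> L2 M" "g \<in> L2 M" shows "(\<lambda>x. f x + g x) \<in> L2 M"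
proof (rule L2_I)
  note [measurable] = L2_measurable[OF assms(1)] L2_measurable[OF assms(2)]
  show "(\<lambda>x. f x + g x) \<in> borel_measurable M" by measurable
  show "integrable M (\<lambda>x. (norm (f x + g x))\<^sup>2)"
  proof (rule Bochner_Integration.integrable_bound)
    show "integrable M (\<lambda>x. 2 * (norm (f x))\<^sup>2 + 2 * (norm (g x))\<^sup>2)"
      using assms by (auto intro!: L2_integrable_square)
    have "(norm (f x + g x))\<^sup>2 \<le> 2 * (norm (f x))\<^sup>2 + 2 * (norm (g x))\<^sup>2" for x
    proof -
      have "(norm (f x + g x))\<^sup>2 \<le> (norm (f x) + norm (g x))\<^sup>2"
        by (intro power_mono norm_triangle_ineq) auto
      also have "\<dots> \<le> 2 * (norm (f x))\<^sup>2 + 2 * (norm (g x))\<^sup>2"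
        using sum_squares_bound[of "norm (f x)" "norm (g x)"] by (simp add: power2_sum)
      finally show ?thesis .
    qed
    then show "AE x in M. norm ((norm (f x + g x))\<^sup>2) \<le> norm (2 * (norm (f x))\<^sup>2 + 2 * (norm (g x))\<^sup>2)"
      by auto
  qed measurable
qed

lemma L2_uminus: "f \<in> L2 M \<Longrightarrow> (\<lambda>x. - f x) \<in> L2 M"
  using L2_scaleR[of f M "-1"] by simp

lemma L2_diff: "f \<in> L2 M \<Longrightarrow> g \<in> L2 M \<Longrightarrow> (\<lambda>x. f x - g x) \<in> L2 M"
  using L2_add[of f M "\<lambda>x. - g x"] L2_uminus[of g M] by simp

lemma L2_restrict:
  assumes "f \<in> L2 M" "Measurable.pred M Q" shows "(\<lambda>x. if Q x then f x else 0) \<in> L2 M"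
proof -
  note [measurable] = L2_measurable[OF assms(1)] assms(2)
  show ?thesis by (rule L2_dominated[OF assms(1), where c=1]) auto
qed

lemma L2_vec_nth: "f \<in> L2 M \<Longrightarrow> (\<lambda>x. f x $ i) \<in> L2 M"
  for f :: "'a \<Rightarrow> ('b::euclidean_space)^'n"
  by (rule L2_linear_image) (auto intro: linearI)

lemma L2_const: "finite_measure M \<Longrightarrow> (\<lambda>x. c) \<in> L2 M"
  by (rule L2_I) (auto intro: finite_measure.integrable_const)

lemma L2_integrable:
  assumes "finite_measure M" "f \<in> L2 M" shows "integrable M f"
proof (rule Bochner_Integration.integrable_bound)
  show "integrable M (\<lambda>x. 1 + (norm (f x))\<^sup>2)"
    using assms by (auto intro!: L2_integrable_square finite_measure.integrable_const)
  show "f \<in> borel_measurable M" by (rule L2_measurable[OF assms(2)])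
  have "norm (f x) \<le> 1 + (norm (f x))\<^sup>2" for x
  proof -
    have "0 \<le> (norm (f x) - 1/2)\<^sup>2" by simp
    then show ?thesis by (simp add: power2_diff power_divide)
  qed
  then show "AE x in M. norm (f x) \<le> norm (1 + (norm (f x))\<^sup>2)" by auto
qed

lemma L2_integrable_inner:
  assumes "f \<in> L2 M" "g \<in> L2 M" shows "integrable M (\<lambda>x. f x \<bullet> g x)"
proof (rule Bochner_Integration.integrable_bound)
  note [measurable] = L2_measurable[OF assms(1)] L2_measurable[OF assms(2)]
  show "integrable M (\<lambda>x. (norm (f x))\<^sup>2 + (norm (g x))\<^sup>2)"
    using assms by (auto intro!: L2_integrable_square)
  have "\<bar>f x \<bullet> g x\<bar> \<le> (norm (f x))\<^sup>2 + (norm (g x))\<^sup>2" for x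
  proof -
    have "\<bar>f x \<bullet> g x\<bar> \<le> norm (f x) * norm (g x)" by (rule Cauchy_Schwarz_ineq2)
    also have "\<dots> \<le> (norm (f x))\<^sup>2 + (norm (g x))\<^sup>2"
      using sum_squares_bound[of "norm (f x)" "norm (g x)"]
        mult_nonneg_nonneg[OF norm_ge_zero[of "f x"] norm_ge_zero[of "g x"]] by linarith
    finally show ?thesis .
  qed
  then show "AE x in M. norm (f x \<bullet> g x) \<le> norm ((norm (f x))\<^sup>2 + (norm (g x))\<^sup>2)"
    by auto
qed (use assms in \<open>auto intro!: borel_measurable_inner dest: L2_measurable\<close>)

lemma L2norm_nonneg: "0 \<le> L2norm M f"
  by (simp add: L2norm_def)

lemma L2norm_square: "(L2norm M f)\<^sup>2 = (\<integral>x. (norm (f x))\<^sup>2 \<partial>M)"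
  by (simp add: L2norm_def)

lemma L2norm_square_inner: "(L2norm M f)\<^sup>2 = (\<integral>x. f x \<bullet> f x \<partial>M)"
  by (simp add: L2norm_square dot_square_norm)

lemma L2norm_Cauchy_Schwarz:
  assumes "f \<in> L2 M" "g \<in> L2 M"
  shows "\<bar>\<integral>x. f x \<bullet> g x \<partial>M\<bar> \<le> L2norm M f * L2norm M g"
proof -
  define a b c where "a = (\<integral>x. f x \<bullet> f x \<partial>M)" "b = (\<integral>x. f x \<bullet> g x \<partial>M)" "c = (\<integral>x. g x \<bullet> g x \<partial>M)"
  note I = L2_integrable_inner[OF assms(1) assms(1)] L2_integrable_inner[OF assms(1) assms(2)]
    L2_integrable_inner[OF assms(2) assms(2)]
  have *: "0 \<le> s\<^sup>2 * a - 2 * s * t * b + t\<^sup>2 * c" for s t :: real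
  proof -
    have "0 \<le> (\<integral>x. (s *\<^sub>R f x - t *\<^sub>R g x) \<bullet> (s *\<^sub>R f x - t *\<^sub>R g x) \<partial>M)" by simp
    also have "\<dots> = (\<integral>x. s\<^sup>2 * (f x \<bullet> f x) - 2 * s * t * (f x \<bullet> g x) + t\<^sup>2 * (g x \<bullet> g x) \<partial>M)"
      by (simp add: inner_diff_left inner_diff_right inner_commute[of "g _" "f _"] algebra_simps power2_eq_square)
    also have "\<dots> = s\<^sup>2 * a - 2 * s * t * b + t\<^sup>2 * c"
      using I by (simp add: a_b_c_def)
    finally show ?thesis .
  qed
  have a0: "0 \<le> a" and c0: "0 \<le> c" unfolding a_b_c_def by simp_all
  have "b\<^sup>2 \<le> a * c"
  proof (cases "c = 0")
    case True
    have "b = 0"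
    proof (rule ccontr)
      assume "b \<noteq> 0"
      then show False using *[of 1 "(a + 1) / (2 * b)"] True by simp
    qed
    then show ?thesis using True by simp
  next
    case False
    have "0 \<le> c * (a * c - b\<^sup>2)"
      using *[of c b] by (simp add: power2_eq_square algebra_simps)
    then show ?thesis using False c0 by (simp add: zero_le_mult_iff)
  qed
  then have "\<bar>b\<bar> \<le> sqrt (a * c)" by (simp add: real_le_rsqrt)
  then show ?thesis by (simp add: a_b_c_def real_sqrt_mult L2norm_def dot_square_norm)
qed

lemma L2norm_triangle:
  assumes "f \<in> L2 M" "g \<in> L2 M"
  shows "L2norm M (\<lambda>x. f x + g x) \<le> L2norm M f + L2norm M g"
proof (rule power2_le_imp_le)
  note I = L2_integrable_inner[OF assms(1) assms(1)] L2_integrable_inner[OF assms(1) assms(2)]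
    L2_integrable_inner[OF assms(2) assms(2)]
  have "(L2norm M (\<lambda>x. f x + g x))\<^sup>2 = (\<integral>x. f x \<bullet> f x + 2 * (f x \<bullet> g x) + g x \<bullet> g x \<partial>M)"
    by (simp add: L2norm_square_inner inner_add_left inner_add_right inner_commute[of "g _" "f _"] algebra_simps)
  also have "\<dots> = (L2norm M f)\<^sup>2 + 2 * (\<integral>x. f x \<bullet> g x \<partial>M) + (L2norm M g)\<^sup>2"
    using I by (simp add: L2norm_square_inner)
  also have "\<dots> \<le> (L2norm M f + L2norm M g)\<^sup>2"
    using L2norm_Cauchy_Schwarz[OF assms] by (simp add: power2_sum)
  finally show "(L2norm M (\<lambda>x. f x + g x))\<^sup>2 \<le> (L2norm M f + L2norm M g)\<^sup>2" .
qed (simp add: L2norm_nonneg)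

lemma L2norm_mono:
  assumes "g \<in> L2 M" "f \<in> borel_measurable M" "AE x in M. norm (f x) \<le> norm (g x)"
  shows "L2norm M f \<le> L2norm M g"
proof -
  have "f \<in> L2 M" using L2_dominated[OF assms(1,2), of 1] assms(3) by simp
  then show ?thesis
    unfolding L2norm_def using assms
    by (auto intro!: integral_mono_AE L2_integrable_square elim!: eventually_mono power_mono)
qed

lemma L2norm_cong_AE:
  assumes "f \<in> borel_measurable M" "g \<in> borel_measurable M" "AE x in M. f x = g x"
  shows "L2norm M f = L2norm M g"
  unfolding L2norm_def using assms
  by (intro arg_cong[where f=sqrt] integral_cong_AE) (auto elim: eventually_mono)

lemma L2norm_scaleR: "L2norm M (\<lambda>x. c *\<^sub>R f x) = \<bar>c\<bar> * L2norm M f"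
  by (simp add: L2norm_def power_mult_distrib real_sqrt_mult)

lemma L2norm_uminus: "L2norm M (\<lambda>x. - f x) = L2norm M f"
  by (simp add: L2norm_def)

lemma L2norm_eq_0:
  assumes "f \<in> L2 M" "L2norm M f = 0" shows "AE x in M. f x = 0"
proof -
  have "(\<integral>x. (norm (f x))\<^sup>2 \<partial>M) = 0" using assms(2) by (simp add: L2norm_def)
  then have "AE x in M. (norm (f x))\<^sup>2 = 0"
    using integral_nonneg_eq_0_iff_AE[OF L2_integrable_square[OF assms(1)]] by simp
  then show ?thesis by simp
qed

lemma L2norm_split:
  assumes "f \<in> L2 M" "Measurable.pred M Q"
  shows "(L2norm M f)\<^sup>2 = (L2norm M (\<lambda>x. if Q x then f x else 0))\<^sup>2
      + (L2norm M (\<lambda>x. if Q x then 0 else f x))\<^sup>2"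
proof -
  have "Measurable.pred M (\<lambda>x. \<not> Q x)" using assms(2) by measurable
  from L2_restrict[OF assms(1) this] have "(\<lambda>x. if Q x then 0 else f x) \<in> L2 M" by (rule back_subst[of "\<lambda>h. h \<in> L2 M"]) auto
  moreover have "(\<lambda>x. if Q x then f x else 0) \<in> L2 M" by (rule L2_restrict[OF assms])
  ultimately show ?thesis unfolding L2norm_square
    by (subst Bochner_Integration.integral_add[symmetric])
      (auto intro!: L2_integrable_square Bochner_Integration.integral_cong)
qed

section \<open>Smooth bumps and directional derivatives in the sense of distributions\<close>

text \<open>The function \<open>exp (- 1/x)\<close> extended by zero to the left, divided by a power. The powers are
carried along because differentiation produces them: the span of the family is closed under
differentiation.\<close>

definition flat :: "nat \<Rightarrow> real \<Rightarrow> real" where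
  "flat k x = (if x \<le> 0 then 0 else exp (- (1/x)) / x ^ k)"

lemma flat_nonneg: "0 \<le> flat k x"
  by (simp add: flat_def)

lemma flat_tendsto_0: "(flat k \<longlongrightarrow> 0) (at 0)"
proof (rule filterlim_split_at)
  show "(flat k \<longlongrightarrow> 0) (at_left 0)"
    by (rule tendsto_eventually) (auto simp: flat_def eventually_at_filter)
  have "((\<lambda>x::real. (inverse x) ^ k / exp (inverse x)) \<longlongrightarrow> 0) (at_right 0)"
    by (rule filterlim_compose[OF tendsto_power_div_exp_0 filterlim_inverse_at_top_right])
  then show "(flat k \<longlongrightarrow> 0) (at_right 0)"
    by (rule Lim_transform_eventually)
      (auto simp: flat_def eventually_at_filter exp_minus field_simps)
qed

lemma flat_has_derivative:
  "(flat k has_real_derivative (flat (k + 2) x - of_nat k * flat (k + 1) x)) (at x)"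
proof -
  consider "x < 0" | "x = 0" | "x > 0" by linarith
  then show ?thesis
  proof cases
    case 1
    have "((\<lambda>_. 0) has_real_derivative 0) (at x)" by simp
    then have "(flat k has_real_derivative 0) (at x)"
      by (rule has_field_derivative_transform_within_open[where S="{..<0}"]) (use 1 in \<open>auto simp: flat_def\<close>)
    then show ?thesis using 1 by (simp add: flat_def)
  next
    case 2
    have "((\<lambda>h. (flat k (0 + h) - flat k 0) / h) \<longlongrightarrow> 0) (at 0)"
      by (rule Lim_transform_eventually[OF flat_tendsto_0[of "Suc k"]])
        (auto simp: flat_def eventually_at_filter)
    then show ?thesis using 2 by (simp add: DERIV_def flat_def)
  next
    case 3
    have "((\<lambda>x. exp (- (1/x)) / x ^ k) has_real_derivative
        (exp (- (1/x)) / x ^ (k + 2) - of_nat k * (exp (- (1/x)) / x ^ (k + 1)))) (at x)"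
    proof -
      have "((\<lambda>x. exp (- (1/x))) has_real_derivative exp (- (1/x)) / x\<^sup>2) (at x)"
        using 3 by (auto intro!: derivative_eq_intros simp: power2_eq_square)
      from DERIV_divide[OF this DERIV_pow[of k]] 3
      have "((\<lambda>x. exp (- (1/x)) / x ^ k) has_real_derivative
          (exp (- (1/x)) / x\<^sup>2 * x ^ k - exp (- (1/x)) * (of_nat k * x ^ (k - Suc 0))) / (x ^ k * x ^ k)) (at x)"
        by simp
      moreover have "(exp (- (1/x)) / x\<^sup>2 * x ^ k - exp (- (1/x)) * (of_nat k * x ^ (k - Suc 0))) / (x ^ k * x ^ k)
          = exp (- (1/x)) / x ^ (k + 2) - of_nat k * (exp (- (1/x)) / x ^ (k + 1))"
        using 3 by (cases k) (simp_all add: diff_divide_distrib power2_eq_square)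
      ultimately show ?thesis by simp
    qed
    then have "(flat k has_real_derivative
        (exp (- (1/x)) / x ^ (k + 2) - of_nat k * (exp (- (1/x)) / x ^ (k + 1)))) (at x)"
      by (rule has_field_derivative_transform_within_open[where S="{0<..}"]) (use 3 in \<open>auto simp: flat_def\<close>)
    then show ?thesis using 3 by (simp add: flat_def)
  qed
qed

text \<open>Membership in a set of differentiable functions that contains the partial derivatives of its
members forces smoothness of all orders. This one is spanned by the radial functions of radius \<open>r\<close>
around \<open>a\<close> built from the family above, with polynomials as coefficients.\<close>

inductive_set flat_span :: "real \<Rightarrow> vec3 \<Rightarrow> (vec3 \<Rightarrow> real) set" for r a where
  base: "(\<lambda>y. flat k (r\<^sup>2 - (norm (y - a))\<^sup>2)) \<in> flat_span r a"
| add: "f \<in> flat_span r a \<Longrightarrow> g \<in> flat_span r a \<Longrightarrow> (\<lambda>y. f y + g y) \<in> flat_span r a"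
| cmult: "f \<in> flat_span r a \<Longrightarrow> (\<lambda>y. c * f y) \<in> flat_span r a"
| coord: "f \<in> flat_span r a \<Longrightarrow> (\<lambda>y. (y - a) $ i * f y) \<in> flat_span r a"

lemma flat_span_derivative:
  "f \<in> flat_span r a \<Longrightarrow>
    \<exists>f'. (\<forall>y. (f has_derivative f' y) (at y)) \<and> (\<forall>i. (\<lambda>y. f' y (axis i 1)) \<in> flat_span r a)"
proof (induction rule: flat_span.induct)
  case (base k)
  define D where "D y = flat (k + 2) (r\<^sup>2 - (norm (y - a))\<^sup>2)
      + (- of_nat k) * flat (k + 1) (r\<^sup>2 - (norm (y - a))\<^sup>2)" for y
  have "D \<in> flat_span r a"
    unfolding D_def by (intro flat_span.intros)
  have "((\<lambda>y. flat k (r\<^sup>2 - (norm (y - a))\<^sup>2)) has_derivative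
      (\<lambda>h. (-2) * ((y - a) \<bullet> h * D y))) (at y)" for y
  proof -
    have "((\<lambda>y. r\<^sup>2 - (norm (y - a))\<^sup>2) has_derivative (\<lambda>h. (-2) * ((y - a) \<bullet> h))) (at y)"
      unfolding power2_norm_eq_inner
      by (auto intro!: derivative_eq_intros simp: inner_commute fun_eq_iff)
    moreover have "(flat k has_derivative (*) (D y)) (at (r\<^sup>2 - (norm (y - a))\<^sup>2))"
      using flat_has_derivative[of k "r\<^sup>2 - (norm (y - a))\<^sup>2"]
      unfolding has_field_derivative_def D_def by simp
    ultimately have "((\<lambda>y. flat k (r\<^sup>2 - (norm (y - a))\<^sup>2)) has_derivative
        (\<lambda>h. D y * ((-2) * ((y - a) \<bullet> h)))) (at y)"
      by (rule has_derivative_compose)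
    then show ?thesis by (simp only: mult.commute mult.left_commute)
  qed
  moreover have "(\<lambda>y. (-2) * ((y - a) \<bullet> axis i 1 * D y)) \<in> flat_span r a" for i
    unfolding inner_axis inner_real_def mult_1_right
    by (intro flat_span.intros \<open>D \<in> flat_span r a\<close>)
  ultimately show ?case
    by (intro exI[of _ "\<lambda>y h. (-2) * ((y - a) \<bullet> h * D y)"]) blast
next
  case (add f g)
  then obtain f' g' where "\<And>y. (f has_derivative f' y) (at y)" "\<And>i. (\<lambda>y. f' y (axis i 1)) \<in> flat_span r a"
    "\<And>y. (g has_derivative g' y) (at y)" "\<And>i. (\<lambda>y. g' y (axis i 1)) \<in> flat_span r a" by blast
  then show ?case
    by (intro exI[of _ "\<lambda>y h. f' y h + g' y h"]) (auto intro: has_derivative_add flat_span.add)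
next
  case (cmult f c)
  then obtain f' where "\<And>y. (f has_derivative f' y) (at y)" "\<And>i. (\<lambda>y. f' y (axis i 1)) \<in> flat_span r a" by blast
  then show ?case
    by (intro exI[of _ "\<lambda>y h. c * f' y h"]) (auto intro: has_derivative_mult_right flat_span.cmult)
next
  case (coord f j)
  then obtain f' where f': "\<And>y. (f has_derivative f' y) (at y)" "\<And>i. (\<lambda>y. f' y (axis i 1)) \<in> flat_span r a" by blast
  have "((\<lambda>y. (y - a) $ j) has_derivative (\<lambda>h. h $ j)) (at y)" for y
    using has_derivative_diff[OF bounded_linear_imp_has_derivative[OF bounded_linear_vec_nth[of j]] has_derivative_const[of "a $ j"]]
    by simp
  then have "((\<lambda>y. (y - a) $ j * f y) has_derivative (\<lambda>h. (y - a) $ j * f' y h + h $ j * f y)) (at y)" for y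
    by (rule has_derivative_mult) (rule f')
  moreover have "(\<lambda>y. (y - a) $ j * f' y (axis i 1) + axis i 1 $ j * f y) \<in> flat_span r a" for i
    using f' coord by (intro flat_span.intros)
  ultimately show ?case
    by (intro exI[of _ "\<lambda>y h. (y - a) $ j * f' y h + h $ j * f y"]) blast
qed

lemma flat_span_smooth: "f \<in> flat_span r a \<Longrightarrow> cont_diff_on k UNIV f"
proof (induction k arbitrary: f)
  case 0
  then obtain f' where "\<And>y. (f has_derivative f' y) (at y)" using flat_span_derivative by blast
  then show ?case by (auto intro!: continuous_at_imp_continuous_on has_derivative_continuous)
next
  case (Suc k)
  then obtain f' where f': "\<And>y. (f has_derivative f' y) (at y)" "\<And>i. (\<lambda>y. f' y (axis i 1)) \<in> flat_span r a"
    using flat_span_derivative by blast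
  have "partial_deriv i f = (\<lambda>y. f' y (axis i 1))" for i
    unfolding partial_deriv_def using frechet_derivative_at[OF f'(1)] by metis
  then show ?case using f' Suc.IH by (auto simp: differentiable_def)
qed

definition bump :: "real \<Rightarrow> vec3 \<Rightarrow> vec3 \<Rightarrow> real" where
  "bump r a y = flat 0 (r\<^sup>2 - (norm (y - a))\<^sup>2)"

lemma bump_translate: "bump r (a + z) y = bump r a (y - z)"
  by (simp add: bump_def algebra_simps)

lemma bump_nonneg: "0 \<le> bump r a y"
  by (simp add: bump_def flat_nonneg)

lemma bump_pos_iff: "0 < r \<Longrightarrow> 0 < bump r a y \<longleftrightarrow> dist y a < r"
  by (auto simp: bump_def flat_def dist_norm not_le power2_less_imp_less intro: power_strict_mono)

lemma test_function_bump:
  assumes "0 < r" shows "test_function (bump r a)"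
proof -
  have "{y. bump r a y \<noteq> 0} \<subseteq> cball a r"
    using bump_pos_iff[OF assms, of a] bump_nonneg[of r a] by (force simp: dist_commute less_le)
  then have "compact (closure {y. bump r a y \<noteq> 0})"
    by (meson bounded_cball bounded_subset compact_closure)
  moreover have "bump r a \<in> flat_span r a"
    unfolding bump_def by (rule flat_span.base)
  ultimately show ?thesis by (auto simp: test_function_def intro: flat_span_smooth)
qed

lemma test_function_props:
  assumes "test_function \<psi>"
  shows "\<psi> differentiable (at y)" "continuous_on UNIV \<psi>" "continuous_on UNIV (partial_deriv i \<psi>)"
    "\<exists>R>0. \<forall>y. R < norm y \<longrightarrow> \<psi> y = 0 \<and> partial_deriv i \<psi> y = 0"
proof -
  have "cont_diff_on 0 UNIV \<psi>" "cont_diff_on (Suc 0) UNIV \<psi>"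
    using assms unfolding test_function_def by blast+
  then show d: "\<psi> differentiable (at y)" "continuous_on UNIV \<psi>" "continuous_on UNIV (partial_deriv i \<psi>)" for y
    by auto
  have "bounded {y. \<psi> y \<noteq> 0}"
    using assms unfolding test_function_def
    by (meson bounded_subset closure_subset compact_imp_bounded)
  then obtain R where R: "R > 0" "\<And>y. \<psi> y \<noteq> 0 \<Longrightarrow> norm y \<le> R"
    unfolding bounded_pos by auto
  have "partial_deriv i \<psi> y = 0" if "R < norm y" for y
  proof -
    have "((\<lambda>_. 0) has_derivative (\<lambda>_. 0)) (at y)" by simp
    then have "(\<psi> has_derivative (\<lambda>_. 0)) (at y)"
    proof (rule has_derivative_transform_within_open[where s="- cball 0 R"])
      show "open (- cball 0 R)" by (simp add: closed_cball open_Compl)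
    qed (use that R(2) in force)+
    then have "(\<lambda>_. 0) = frechet_derivative \<psi> (at y)" by (rule frechet_derivative_at)
    then show ?thesis by (metis partial_deriv_def)
  qed
  then show "\<exists>R>0. \<forall>y. R < norm y \<longrightarrow> \<psi> y = 0 \<and> partial_deriv i \<psi> y = 0"
    using R by (intro exI[of _ R]) force
qed

lemma test_function_integrable:
  assumes "test_function \<psi>" "continuous_on UNIV a"
  shows "integrable lborel (\<lambda>y. a y * \<psi> y)" "integrable lborel (\<lambda>y. a y * partial_deriv i \<psi> y)"
proof -
  obtain R where R: "R > 0" "\<And>y. R < norm y \<Longrightarrow> \<psi> y = 0 \<and> partial_deriv i \<psi> y = 0"
    using test_function_props(4)[OF assms(1)] by meson
  have gen: "integrable lborel (\<lambda>y. a y * f y)"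
    if "continuous_on UNIV f" "\<And>y. R < norm y \<Longrightarrow> f y = 0" for f :: "vec3 \<Rightarrow> real"
  proof -
    have "continuous_on UNIV (\<lambda>y. a y * f y)" using assms(2) that(1) by (intro continuous_intros)
    then have "integrable lborel (\<lambda>y. indicator (cball 0 R) y *\<^sub>R (a y * f y))"
      using borel_integrable_compact[OF compact_cball] continuous_on_subset
      by (metis subset_UNIV)
    moreover have "(\<lambda>y. indicator (cball 0 R) y *\<^sub>R (a y * f y)) = (\<lambda>y. a y * f y)"
      using that(2) by (force simp: indicator_def fun_eq_iff)
    ultimately show ?thesis by (simp only:)
  qed
  show "integrable lborel (\<lambda>y. a y * \<psi> y)" "integrable lborel (\<lambda>y. a y * partial_deriv i \<psi> y)"
    using R(2) test_function_props[OF assms(1)] by (auto intro!: gen)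
qed

lemma integrable_lborel_translate:
  fixes f :: "vec3 \<Rightarrow> real"
  assumes "integrable lborel f" shows "integrable lborel (\<lambda>y. f (y + z))"
proof -
  have "f \<in> borel_measurable borel" using assms by (simp add: borel_measurable_integrable)
  then have "integrable (distr lborel borel ((+) z)) f = integrable lborel (\<lambda>y. f (z + y))"
    by (intro integrable_distr_eq) auto
  then show ?thesis using assms by (simp add: lborel_distr_plus add.commute)
qed

lemma integral_lborel_translate:
  fixes f :: "vec3 \<Rightarrow> real"
  assumes "f \<in> borel_measurable borel"
  shows "(\<integral>y. f (y + z) \<partial>lborel) = (\<integral>y. f y \<partial>lborel)"
proof -
  have "integral\<^sup>L (distr lborel borel ((+) z)) f = (\<integral>y. f (z + y) \<partial>lborel)"
    using assms by (intro integral_distr) auto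
  then show ?thesis by (simp add: lborel_distr_plus add.commute)
qed

lemma test_function_has_derivative_line:
  assumes "test_function \<psi>"
  shows "((\<lambda>s. \<psi> (y - s *\<^sub>R axis i 1)) has_real_derivative - partial_deriv i \<psi> (y - s *\<^sub>R axis i 1)) (at s)"
proof -
  let ?z = "y - s *\<^sub>R axis i 1"
  have D: "(\<psi> has_derivative frechet_derivative \<psi> (at ?z)) (at ?z)"
    using test_function_props(1)[OF assms] unfolding frechet_derivative_works .
  have "((\<lambda>s. y - s *\<^sub>R axis i 1) has_derivative (\<lambda>h. - (h *\<^sub>R axis i 1))) (at s)"
    by (auto intro!: derivative_eq_intros)
  from has_derivative_compose[OF this D]
  have *: "((\<lambda>s. \<psi> (y - s *\<^sub>R axis i 1)) has_derivative (\<lambda>h. frechet_derivative \<psi> (at ?z) (- (h *\<^sub>R axis i 1)))) (at s)" .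
  have L: "linear (frechet_derivative \<psi> (at ?z))" by (rule has_derivative_linear[OF D])
  have "frechet_derivative \<psi> (at ?z) (- (h *\<^sub>R axis i 1)) = - partial_deriv i \<psi> ?z * h" for h
    using linear_neg[OF L] linear_scale[OF L] by (simp add: partial_deriv_def)
  then have "(\<lambda>h. frechet_derivative \<psi> (at ?z) (- (h *\<^sub>R axis i 1))) = (*) (- partial_deriv i \<psi> ?z)"
    by (rule ext)
  with * show ?thesis unfolding has_field_derivative_def by (simp only:)
qed

text \<open>Translating a test function by \<open>s\<close> and differentiating at \<open>s = 0\<close> produces minus its partial
derivative, by dominated convergence: the difference quotients are bounded by a Lipschitz constant and, for
\<open>\<bar>s\<bar> < 1\<close>, live on one ball. This is the link between derivatives in the sense of distributions and
increments, and it is used in both directions below.\<close>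

lemma derivative_of_translated_integral:
  fixes a :: "vec3 \<Rightarrow> real"
  assumes "test_function \<psi>" "continuous_on UNIV a" "\<And>y. \<bar>a y\<bar> \<le> B"
  shows "((\<lambda>s. \<integral>y. a y * \<psi> (y - s *\<^sub>R axis i 1) \<partial>lborel) has_real_derivative
      - (\<integral>y. a y * partial_deriv i \<psi> y \<partial>lborel)) (at 0)"
proof -
  let ?I = "\<lambda>s. \<integral>y. a y * \<psi> (y - s *\<^sub>R axis i 1) \<partial>lborel"
  obtain R where R: "R > 0" "\<And>y. R < norm y \<Longrightarrow> \<psi> y = 0 \<and> partial_deriv i \<psi> y = 0"
    using test_function_props(4)[OF assms(1)] by meson
  have "bounded (partial_deriv i \<psi> ` cball 0 (R + 2))"
    by (intro compact_imp_bounded compact_continuous_image compact_cball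
        continuous_on_subset[OF test_function_props(3)[OF assms(1)]]) simp
  then obtain L where L: "L > 0" "\<And>y. norm y \<le> R + 2 \<Longrightarrow> \<bar>partial_deriv i \<psi> y\<bar> \<le> L"
    unfolding bounded_pos by auto
  have L': "\<bar>partial_deriv i \<psi> y\<bar> \<le> L" for y
    using L R(2)[of y] by (cases "norm y \<le> R + 2") auto
  have lip: "\<bar>\<psi> (y - s *\<^sub>R axis i 1) - \<psi> y\<bar> \<le> L * \<bar>s\<bar>" for y s
  proof -
    have "norm (\<psi> (y - s *\<^sub>R axis i 1) - \<psi> (y - 0 *\<^sub>R axis i 1)) \<le> L * norm (s - 0)"
      by (rule field_differentiable_bound[where S=UNIV and f="\<lambda>s. \<psi> (y - s *\<^sub>R axis i 1)"])
        (auto intro: has_field_derivative_at_within[OF test_function_has_derivative_line[OF assms(1)]] L')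
    then show ?thesis by simp
  qed
  have meas: "a \<in> borel_measurable borel" "\<psi> \<in> borel_measurable borel" "partial_deriv i \<psi> \<in> borel_measurable borel"
    using assms(2) test_function_props(2,3)[OF assms(1)] by (auto intro: borel_measurable_continuous_onI)
  note [measurable] = meas
  have int: "integrable lborel (\<lambda>y. a y * \<psi> (y - z))" for z
  proof -
    have "continuous_on UNIV (\<lambda>y. a (y + z))"
      by (rule continuous_on_compose2[OF assms(2)]) (auto intro: continuous_intros)
    from test_function_integrable(1)[OF assms(1) this]
    have "integrable lborel (\<lambda>y. a (y + z) * \<psi> y)" .
    from integrable_lborel_translate[OF this, of "- z"] show ?thesis by simp
  qed
  have "((\<lambda>s. (?I (0 + s) - ?I 0) / s) \<longlongrightarrow> - (\<integral>y. a y * partial_deriv i \<psi> y \<partial>lborel)) (at 0 within {-1<..<1})"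
    unfolding tendsto_at_iff_sequentially
  proof (intro allI impI)
    fix X :: "nat \<Rightarrow> real"
    assume X: "\<forall>n. X n \<in> {-1<..<1} - {0}" "X \<longlonglongrightarrow> 0"
    let ?q = "\<lambda>n y. a y * ((\<psi> (y - X n *\<^sub>R axis i 1) - \<psi> y) / X n)"
    have "(\<lambda>n. \<integral>y. ?q n y \<partial>lborel) \<longlonglongrightarrow> (\<integral>y. a y * (- partial_deriv i \<psi> y) \<partial>lborel)"
    proof (rule integral_dominated_convergence[where w="\<lambda>y. indicator (cball 0 (R + 1)) y * (B * L)"])
      show "integrable lborel (\<lambda>y. indicator (cball 0 (R + 1)) y * (B * L) :: real)"
        by (intro integrable_mult_left integrable_real_indicator) (use emeasure_bounded_finite[OF bounded_cball[of 0 "R + 1"]] in auto)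
      show "AE y in lborel. (\<lambda>n. ?q n y) \<longlonglongrightarrow> a y * (- partial_deriv i \<psi> y)"
      proof (rule AE_I2, rule tendsto_mult[OF tendsto_const])
        fix y
        have "((\<lambda>s. (\<psi> (y - (0 + s) *\<^sub>R axis i 1) - \<psi> (y - 0 *\<^sub>R axis i 1)) / s) \<longlongrightarrow> - partial_deriv i \<psi> (y - 0 *\<^sub>R axis i 1)) (at 0)"
          using test_function_has_derivative_line[OF assms(1), of y i 0] unfolding DERIV_def .
        then have "((\<lambda>s. (\<psi> (y - s *\<^sub>R axis i 1) - \<psi> y) / s) \<longlongrightarrow> - partial_deriv i \<psi> y) (at 0)" by simp
        moreover have "filterlim X (at 0) sequentially"
          using X by (auto simp: filterlim_at)
        ultimately show "(\<lambda>n. (\<psi> (y - X n *\<^sub>R axis i 1) - \<psi> y) / X n) \<longlonglongrightarrow> - partial_deriv i \<psi> y"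
          by (rule filterlim_compose)
      qed
      show "AE y in lborel. norm (?q n y) \<le> indicator (cball 0 (R + 1)) y * (B * L)" for n
      proof (rule AE_I2)
        fix y
        have Xn: "\<bar>X n\<bar> < 1" "X n \<noteq> 0" using X(1) by (auto simp: abs_less_iff dest: spec[of _ n])
        show "norm (?q n y) \<le> indicator (cball 0 (R + 1)) y * (B * L)"
        proof (cases "norm y \<le> R + 1")
          case True
          have "\<bar>\<psi> (y - X n *\<^sub>R axis i 1) - \<psi> y\<bar> / \<bar>X n\<bar> \<le> L"
            using lip[of y "X n"] Xn by (simp add: divide_le_eq)
          then have "\<bar>a y\<bar> * (\<bar>\<psi> (y - X n *\<^sub>R axis i 1) - \<psi> y\<bar> / \<bar>X n\<bar>) \<le> B * L"
            using assms(3)[of y] by (intro mult_mono) (auto intro: order_trans[OF abs_ge_zero assms(3)])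
          then show ?thesis using True by (simp add: abs_mult)
        next
          case False
          have "norm y \<le> norm (y - X n *\<^sub>R axis i 1) + norm (X n *\<^sub>R axis i (1::real) :: vec3)"
            using norm_triangle_sub[of y "y - X n *\<^sub>R axis i 1"] by simp
          then have "R < norm (y - X n *\<^sub>R axis i 1)" using False Xn by (simp add: norm_axis_1)
          then show ?thesis using False R(2)[of y] R(2)[of "y - X n *\<^sub>R axis i 1"] by simp
        qed
      qed
    qed measurable
    moreover have "(\<integral>y. ?q n y \<partial>lborel) = (?I (X n) - ?I 0) / X n" for n
    proof -
      have "(\<integral>y. ?q n y \<partial>lborel) = (\<integral>y. (a y * \<psi> (y - X n *\<^sub>R axis i 1) - a y * \<psi> (y - 0)) / X n \<partial>lborel)"
        by (simp add: algebra_simps diff_divide_distrib)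
      also have "\<dots> = (?I (X n) - ?I 0) / X n"
        using int[of "X n *\<^sub>R axis i 1"] int[of 0] by simp
      finally show ?thesis .
    qed
    ultimately show "((\<lambda>s. (?I (0 + s) - ?I 0) / s) \<circ> X) \<longlonglongrightarrow> - (\<integral>y. a y * partial_deriv i \<psi> y \<partial>lborel)"
      by (simp only: comp_def add_0_left mult_minus_right Bochner_Integration.integral_minus)
  qed
  moreover have "at (0::real) within {-1<..<1} = at 0"
    by (rule at_within_open) auto
  ultimately show ?thesis by (simp add: DERIV_def)
qed



lemma translated_integral_swap:
  fixes a :: "vec3 \<Rightarrow> real"
  assumes "test_function \<psi>" "continuous_on UNIV a"
  shows "(\<integral>y. a y * \<psi> (y - z) \<partial>lborel) = (\<integral>y. a (y + z) * \<psi> y \<partial>lborel)"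
proof -
  have [measurable]: "a \<in> borel_measurable borel" "\<psi> \<in> borel_measurable borel"
    using assms(2) test_function_props(2)[OF assms(1)] by (auto intro: borel_measurable_continuous_onI)
  show ?thesis
    by (subst integral_lborel_translate[symmetric, where z=z]) simp_all
qed

text \<open>A first-order Taylor estimate for a function known only through its distributional derivative.
Averaged against a bump, the function is differentiable along the axis and its derivative is the
average of \<open>c\<close>, so that the mean value theorem gives the averaged estimate; letting the bump
shrink to the origin gives the estimate itself, by continuity.\<close>

lemma weak_derivative_Taylor_bound:
  fixes a c :: "vec3 \<Rightarrow> real"
  assumes a: "continuous_on UNIV a" "\<And>y. \<bar>a y\<bar> \<le> B" and c: "continuous_on UNIV c"
    and weak: "\<And>\<psi>. test_function \<psi> \<Longrightarrow>
      (\<integral>y. a y * partial_deriv i \<psi> y \<partial>lborel) = - (\<integral>y. c y * \<psi> y \<partial>lborel)"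
    and M: "\<And>y s. \<bar>s\<bar> \<le> \<bar>t\<bar> \<Longrightarrow> \<bar>c (y + s *\<^sub>R axis i 1) - c y\<bar> \<le> M"
  shows "\<bar>a (t *\<^sub>R axis i 1) - a 0 - t * c 0\<bar> \<le> \<bar>t\<bar> * M"
proof -
  let ?e = "axis i 1 :: vec3"
  define k where "k y = a (y + t *\<^sub>R ?e) - a y - t * c y" for y
  have trans: "continuous_on UNIV (\<lambda>y. f (y + z))" if "continuous_on UNIV f" for f :: "vec3 \<Rightarrow> real" and z
    by (rule continuous_on_compose2[OF that]) (auto intro: continuous_intros)
  have k_cont: "continuous_on UNIV k"
    unfolding k_def using a(1) c by (intro continuous_intros trans)
  have avg: "\<bar>\<integral>y. k y * bump r 0 y \<partial>lborel\<bar> \<le> \<bar>t\<bar> * M * (\<integral>y. bump r 0 y \<partial>lborel)" if "0 < r" for r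
  proof -
    have tf: "test_function (bump r z)" for z by (rule test_function_bump[OF that])
    define I where "I s = (\<integral>y. a y * bump r (s *\<^sub>R ?e) y \<partial>lborel)" for s
    define J where "J s = (\<integral>y. c y * bump r (s *\<^sub>R ?e) y \<partial>lborel)" for s
    have IJ: "(I has_real_derivative J s) (at s)" for s
    proof -
      have "((\<lambda>h. \<integral>y. a y * bump r (s *\<^sub>R ?e) (y - h *\<^sub>R ?e) \<partial>lborel) has_real_derivative J s) (at 0)"
        using derivative_of_translated_integral[OF tf a, of "s *\<^sub>R ?e" i] weak[OF tf]
        by (simp add: J_def)
      then have "((\<lambda>h. I (s + h)) has_real_derivative J s) (at 0)"
        by (simp add: I_def scaleR_add_left bump_translate)
      then show ?thesis
        using DERIV_at_within_shift[of I "J s" s 0 UNIV] by (simp add: add.commute)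
    qed
    have shift: "(\<integral>y. f y * bump r (s *\<^sub>R ?e) y \<partial>lborel) = (\<integral>y. f (y + s *\<^sub>R ?e) * bump r 0 y \<partial>lborel)"
      if "continuous_on UNIV f" for f s
      using translated_integral_swap[OF tf that, of 0 "s *\<^sub>R ?e"] bump_translate[of r 0]
      by simp
    note int = test_function_integrable(1)[OF tf]
    have J_bound: "\<bar>J s - J 0\<bar> \<le> M * (\<integral>y. bump r 0 y \<partial>lborel)" if "\<bar>s\<bar> \<le> \<bar>t\<bar>" for s
    proof -
      have "J s - J 0 = (\<integral>y. (c (y + s *\<^sub>R ?e) - c y) * bump r 0 y \<partial>lborel)"
        using int[OF trans[OF c, of "s *\<^sub>R ?e"], of 0] int[OF c, of 0]
        by (simp add: J_def shift[OF c] left_diff_distrib)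
      also have "\<bar>\<dots>\<bar> \<le> (\<integral>y. M * bump r 0 y \<partial>lborel)"
        unfolding real_norm_def[symmetric]
      proof (rule Bochner_Integration.integral_norm_bound_integral)
        show "integrable lborel (\<lambda>y. (c (y + s *\<^sub>R ?e) - c y) * bump r 0 y)"
          by (rule int) (intro continuous_intros trans c)
        show "integrable lborel (\<lambda>y. M * bump r 0 y)" by (rule int) simp
        show "norm ((c (y + s *\<^sub>R ?e) - c y) * bump r 0 y) \<le> M * bump r 0 y" for y
          using mult_right_mono[OF M[OF that, of y] bump_nonneg[of r 0 y]] bump_nonneg[of r 0 y]
          by (simp add: abs_mult)
      qed
      finally show ?thesis by simp
    qed
    obtain s where s: "\<bar>s\<bar> \<le> \<bar>t\<bar>" "I t - I 0 = t * J s"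
    proof -
      consider "t = 0" | "t > 0" | "t < 0" by linarith
      then show ?thesis
      proof cases
        case 1 then show ?thesis by (intro that[of 0]) auto
      next
        case 2
        from MVT2[OF this, of I J] IJ obtain z where "0 < z" "z < t" "I t - I 0 = (t - 0) * J z" by blast
        then show ?thesis by (intro that[of z]) auto
      next
        case 3
        from MVT2[OF this, of I J] IJ obtain z where "t < z" "z < 0" "I 0 - I t = (0 - t) * J z" by blast
        then show ?thesis by (intro that[of z]) auto
      qed
    qed
    have "(\<integral>y. k y * bump r 0 y \<partial>lborel) = I t - I 0 - t * J 0"
    proof -
      have "(\<integral>y. k y * bump r 0 y \<partial>lborel)
          = (\<integral>y. a (y + t *\<^sub>R ?e) * bump r 0 y - a y * bump r 0 y - t * (c y * bump r 0 y) \<partial>lborel)"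
        by (simp add: k_def algebra_simps)
      also have "\<dots> = I t - I 0 - t * J 0"
        using int[OF trans[OF a(1), of "t *\<^sub>R ?e"], of 0] int[OF a(1), of 0] int[OF c, of 0]
        by (simp add: I_def J_def shift[OF a(1)])
      finally show ?thesis .
    qed
    also have "\<dots> = t * (J s - J 0)" using s(2) by (simp add: algebra_simps)
    also have "\<bar>\<dots>\<bar> \<le> \<bar>t\<bar> * (M * (\<integral>y. bump r 0 y \<partial>lborel))"
      unfolding abs_mult by (intro mult_left_mono J_bound s) simp
    finally show ?thesis by (simp add: mult.assoc)
  qed
  have "\<bar>k 0\<bar> \<le> \<bar>t\<bar> * M"
  proof (rule ccontr)
    assume "\<not> \<bar>k 0\<bar> \<le> \<bar>t\<bar> * M"
    then have pos: "\<bar>t\<bar> * M < \<bar>k 0\<bar>" by simp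
    define e where "e = (\<bar>k 0\<bar> - \<bar>t\<bar> * M) / 2"
    have "e > 0" using pos by (simp add: e_def)
    moreover have "isCont k 0" using k_cont by (simp add: continuous_on_eq_continuous_at)
    ultimately obtain r where r: "r > 0" "\<And>y. dist y 0 < r \<Longrightarrow> \<bar>k y - k 0\<bar> < e"
      unfolding continuous_at_eps_delta dist_real_def by blast
    note tf = test_function_bump[OF r(1), of 0]
    note int = test_function_integrable(1)[OF tf]
    let ?S = "\<integral>y. bump r 0 y \<partial>lborel"
    have S_int: "integrable lborel (bump r 0)" using int[of "\<lambda>_. 1"] by simp
    have S_pos: "?S > 0"
    proof (rule ccontr)
      assume "\<not> ?S > 0"
      moreover have "?S \<ge> 0" by (simp add: bump_nonneg)
      ultimately have "?S = 0" by simp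
      then have "AE y in lborel. bump r 0 y = 0"
        using integral_nonneg_eq_0_iff_AE[OF S_int] bump_nonneg by simp
      then have "AE y in lborel. y \<notin> ball (0::vec3) r"
      proof eventually_elim
        case (elim y)
        then show ?case using bump_pos_iff[OF r(1), of 0 y] by simp
      qed
      then have "ball (0::vec3) r \<in> null_sets lborel" by (simp add: AE_iff_null_sets)
      then show False using r(1) content_ball_pos[of r "0::vec3"]
        by (simp add: null_sets_def measure_def)
    qed
    have "\<bar>(\<integral>y. k y * bump r 0 y \<partial>lborel) - k 0 * ?S\<bar> = \<bar>\<integral>y. (k y - k 0) * bump r 0 y \<partial>lborel\<bar>"
      using int[OF k_cont] S_int by (simp add: left_diff_distrib)
    also have "\<dots> \<le> (\<integral>y. e * bump r 0 y \<partial>lborel)"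
      unfolding real_norm_def[symmetric]
    proof (rule Bochner_Integration.integral_norm_bound_integral)
      show "integrable lborel (\<lambda>y. (k y - k 0) * bump r 0 y)"
        by (rule int) (intro continuous_intros k_cont)
      show "integrable lborel (\<lambda>y. e * bump r 0 y)" using S_int by simp
      show "norm ((k y - k 0) * bump r 0 y) \<le> e * bump r 0 y" for y
        using r(2)[of y] bump_pos_iff[OF r(1), of 0 y] bump_nonneg[of r 0 y]
        by (cases "dist y 0 < r") (auto simp: abs_mult intro!: mult_right_mono)
    qed
    finally have 1: "\<bar>(\<integral>y. k y * bump r 0 y \<partial>lborel) - k 0 * ?S\<bar> \<le> e * ?S" by simp
    have "\<bar>k 0\<bar> * ?S = \<bar>k 0 * ?S\<bar>" using S_pos by (simp add: abs_mult)
    also have "\<dots> \<le> \<bar>t\<bar> * M * ?S + e * ?S" using 1 avg[OF r(1)] by linarith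
    finally have "(\<bar>k 0\<bar> - \<bar>t\<bar> * M - e) * ?S \<le> 0" by (simp add: algebra_simps)
    then have "\<bar>k 0\<bar> - \<bar>t\<bar> * M - e \<le> 0" using S_pos by (simp add: mult_le_0_iff)
    then show False using pos unfolding e_def by (simp add: field_simps)
  qed
  then show ?thesis by (simp add: k_def)
qed

text \<open>Conversely, if the difference quotients converge uniformly in the base point, the translation
can be moved from the test function to \<open>a\<close>, and the two ways of differentiating the same integral
have to agree.\<close>

lemma weak_derivative_of_uniform_derivative:
  fixes a c :: "vec3 \<Rightarrow> real"
  assumes a: "continuous_on UNIV a" "\<And>y. \<bar>a y\<bar> \<le> B" and c: "continuous_on UNIV c"
    and unif: "\<And>e. e > 0 \<Longrightarrow> \<exists>d>0. \<forall>s y. 0 < \<bar>s\<bar> \<and> \<bar>s\<bar> < d \<longrightarrow>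
      \<bar>a (y + s *\<^sub>R axis i 1) - a y - s * c y\<bar> \<le> e * \<bar>s\<bar>"
    and \<psi>: "test_function \<psi>"
  shows "(\<integral>y. a y * partial_deriv i \<psi> y \<partial>lborel) = - (\<integral>y. c y * \<psi> y \<partial>lborel)"
proof -
  let ?e = "axis i 1 :: vec3"
  define I where "I s = (\<integral>y. a y * \<psi> (y - s *\<^sub>R ?e) \<partial>lborel)" for s
  let ?J = "\<integral>y. c y * \<psi> y \<partial>lborel"
  have trans: "continuous_on UNIV (\<lambda>y. a (y + z))" for z
    by (rule continuous_on_compose2[OF a(1)]) (auto intro: continuous_intros)
  note int = test_function_integrable(1)[OF \<psi>]
  have \<psi>_int: "integrable lborel (\<lambda>y. \<bar>\<psi> y\<bar>)" using int[of "\<lambda>_. 1"] by simp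
  let ?S = "\<integral>y. \<bar>\<psi> y\<bar> \<partial>lborel"
  have S: "?S \<ge> 0" by simp
  have "(I has_real_derivative ?J) (at 0)"
    unfolding DERIV_def tendsto_iff eventually_at
  proof (intro allI impI)
    fix e :: real assume "e > 0"
    then have "e / (?S + 1) > 0"
      by (intro divide_pos_pos add_nonneg_pos S) auto
    from unif[OF this] obtain d where d: "d > 0" "\<And>s y. 0 < \<bar>s\<bar> \<Longrightarrow> \<bar>s\<bar> < d \<Longrightarrow>
      \<bar>a (y + s *\<^sub>R ?e) - a y - s * c y\<bar> \<le> e / (?S + 1) * \<bar>s\<bar>" by blast
    have "dist ((I (0 + s) - I 0) / s) ?J < e" if s: "s \<noteq> 0" "\<bar>s\<bar> < d" for s
    proof -
      let ?f = "\<lambda>y. ((a (y + s *\<^sub>R ?e) - a y - s * c y) / s) * \<psi> y"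
      have f_int: "integrable lborel ?f"
        using s(1) by (intro int continuous_intros trans a(1) c) auto
      have "(I (0 + s) - I 0) / s - ?J = (\<integral>y. ?f y \<partial>lborel)"
      proof -
        have "(I (0 + s) - I 0) / s - ?J
          = (\<integral>y. (a (y + s *\<^sub>R ?e) * \<psi> y - a y * \<psi> y) / s - c y * \<psi> y \<partial>lborel)"
          using int[OF trans[of "s *\<^sub>R ?e"]] int[OF a(1)] int[OF c]
            translated_integral_swap[OF \<psi> a(1), of "s *\<^sub>R ?e"]
          by (simp add: I_def)
        also have "\<dots> = (\<integral>y. ?f y \<partial>lborel)"
          using s(1) by (intro Bochner_Integration.integral_cong) (auto simp: field_simps)
        finally show ?thesis .
      qed
      also have "\<bar>\<dots>\<bar> \<le> (\<integral>y. e / (?S + 1) * \<bar>\<psi> y\<bar> \<partial>lborel)"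
      proof (rule integral_abs_bound_integral)
        show "integrable lborel ?f" by (rule f_int)
        show "integrable lborel (\<lambda>y. e / (?S + 1) * \<bar>\<psi> y\<bar>)" using \<psi>_int by simp
        show "\<bar>?f y\<bar> \<le> e / (?S + 1) * \<bar>\<psi> y\<bar>" for y
        proof -
          have "\<bar>(a (y + s *\<^sub>R ?e) - a y - s * c y) / s\<bar> \<le> e / (?S + 1)"
            using d(2)[of s y] s by (simp add: abs_divide pos_divide_le_eq)
          then show ?thesis by (simp only: abs_mult mult_right_mono abs_ge_zero)
        qed
      qed
      also have "\<dots> = e * (?S / (?S + 1))" by simp
      also have "\<dots> < e * 1"
        using S \<open>e > 0\<close> by (intro mult_strict_left_mono) (simp_all only: divide_less_eq_1, linarith)
      finally show ?thesis by (simp add: dist_real_def)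
    qed
    then show "\<exists>d>0. \<forall>s\<in>UNIV. s \<noteq> 0 \<and> dist s 0 < d \<longrightarrow> dist ((I (0 + s) - I 0) / s) ?J < e"
      using d(1) by (intro exI[of _ d]) auto
  qed
  moreover have "(I has_real_derivative - (\<integral>y. a y * partial_deriv i \<psi> y \<partial>lborel)) (at 0)"
    unfolding I_def by (rule derivative_of_translated_integral[OF \<psi> a])
  ultimately show ?thesis using DERIV_unique by fastforce
qed

section \<open>The inclusion at the origin\<close>

text \<open>Regular open sets serve two purposes. They are determined by their closures, which is all that
the Hausdorff distance can see; and whether a point belongs to such a set can be decided from a
countable dense set of points, which gives measurability.\<close>

definition regular_open :: "vec3 set \<Rightarrow> bool" where
  "regular_open U \<longleftrightarrow> interior (closure U) = U"

lemma regular_open_open: "regular_open U \<Longrightarrow> open U"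
  unfolding regular_open_def by (metis open_interior)

lemma regular_openI: "open U \<Longrightarrow> interior (closure U) \<subseteq> U \<Longrightarrow> regular_open U"
  unfolding regular_open_def by (simp add: interior_maximal closure_subset subset_antisym)

text \<open>An interior point of the closure that is missing from the domain would be a boundary point, but
the points strictly below the graph there have a neighbourhood free of the domain.\<close>

lemma lipschitz_domain_regular_open:
  assumes "lipschitz_domain U" shows "regular_open U"
proof (rule regular_openI)
  show "open U" using assms by (simp add: lipschitz_domain_def)
  show "interior (closure U) \<subseteq> U"
  proof
    fix x assume x: "x \<in> interior (closure U)"
    show "x \<in> U"
    proof (rule ccontr)
      assume "x \<notin> U"
      with x \<open>open U\<close> have "x \<in> frontier U"
        using interior_subset by (auto simp: frontier_def interior_open)
      then obtain r e L and g :: "vec3 \<Rightarrow> real" where r: "r > 0" and e: "norm e = 1"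
        and g: "L-lipschitz_on {w. e \<bullet> w = 0} g"
        and U: "\<And>z. z \<in> ball x r \<Longrightarrow> z \<in> U \<longleftrightarrow> e \<bullet> (z - x) > g ((z - x) - (e \<bullet> (z - x)) *\<^sub>R e)"
        using assms unfolding lipschitz_domain_def by meson
      have ee: "e \<bullet> e = 1" using e by (simp add: dot_square_norm)
      define G where "G z = g ((z - x) - (e \<bullet> (z - x)) *\<^sub>R e) - e \<bullet> (z - x)" for z
      have "continuous_on UNIV (\<lambda>z. g ((z - x) - (e \<bullet> (z - x)) *\<^sub>R e))"
        by (rule continuous_on_compose2[OF lipschitz_on_continuous_on[OF g]])
          (auto intro!: continuous_intros simp: inner_diff_right ee)
      then have G_cont: "continuous_on UNIV G"
        unfolding G_def by (intro continuous_intros)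
      have G_pos: "z \<notin> closure U" if "z \<in> ball x r" "G z > 0" for z
      proof -
        have "open {z. G z > 0}"
          using open_Collect_less[OF continuous_on_const[of UNIV 0] G_cont] .
        then have "open (ball x r \<inter> {z. G z > 0})" by (intro open_Int) auto
        moreover have "U \<inter> (ball x r \<inter> {z. G z > 0}) = {}" using U by (auto simp: G_def)
        ultimately have "closure U \<inter> (ball x r \<inter> {z. G z > 0}) = {}"
          by (metis Int_commute open_Int_closure_eq_empty)
        then show ?thesis using that by blast
      qed
      have "x \<in> closure U" using x interior_subset by blast
      then have "\<not> G x > 0" using G_pos[of x] r by auto
      moreover have "\<not> G x < 0" using U[of x] r \<open>x \<notin> U\<close> by (auto simp: G_def)
      ultimately have G0: "g 0 = 0" by (simp add: G_def)
      obtain d where d: "d > 0" "ball x d \<subseteq> interior (closure U)"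
        using x open_interior open_contains_ball by blast
      define t where "t = min d r / 2"
      have t: "0 < t" "t < d" "t < r" using d(1) r by (auto simp: t_def)
      let ?z = "x - t *\<^sub>R e"
      have "dist x ?z = t" using t(1) e by (simp add: dist_norm)
      then have "?z \<in> ball x r" "?z \<in> ball x d" using t by auto
      moreover have "G ?z > 0"
        using t(1) G0 ee by (simp add: G_def)
      ultimately show False using G_pos[of ?z] d(2) interior_subset by blast
    qed
  qed
qed

text \<open>The preimage of the interior of the closure is open and, by injectivity on \<open>V\<close>, contained in
\<open>closure U\<close>; hence it is contained in \<open>U\<close>.\<close>

lemma regular_open_diffeomorphic_image:
  assumes "continuous_on V \<phi>" "inj_on \<phi> V" "open V" "closure U \<subseteq> V" "regular_open U"
    and im: "\<phi> ` closure U = closure (\<phi> ` U)" and "open (\<phi> ` U)"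
  shows "regular_open (\<phi> ` U)"
proof (rule regular_openI)
  let ?W = "V \<inter> \<phi> -` interior (closure (\<phi> ` U))"
  have "open ?W"
    using continuous_open_preimage[OF assms(1,3) open_interior] .
  moreover have "?W \<subseteq> closure U"
  proof
    fix x assume x: "x \<in> ?W"
    then have "\<phi> x \<in> \<phi> ` closure U" using interior_subset im by blast
    then show "x \<in> closure U" using x assms(2,4) by (auto dest!: inj_onD)
  qed
  ultimately have "?W \<subseteq> U"
    using assms(5) interior_maximal unfolding regular_open_def by metis
  moreover have "interior (closure (\<phi> ` U)) \<subseteq> \<phi> ` ?W"
    using interior_subset[of "closure (\<phi> ` U)"] im assms(4) by fastforce
  ultimately show "interior (closure (\<phi> ` U)) \<subseteq> \<phi> ` U" by blast
qed (fact assms(7))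

lemma inclusion_decompositionD:
  assumes "admissible_geometry \<Omega> incl" "\<omega> \<in> \<Omega>"
  shows "(\<Union>k. incl \<omega> k) = \<omega>" "open (incl \<omega> k)" "connected (incl \<omega> k)"
    "disjoint_family (incl \<omega>)"
proof -
  have "inclusion_decomposition \<Omega> incl" using assms(1) by (simp add: admissible_geometry_def)
  note * = conjunct1[OF this[unfolded inclusion_decomposition_def], THEN bspec, OF assms(2)]
  show "(\<Union>k. incl \<omega> k) = \<omega>" by (rule sym) (use * in iprover)
  show "open (incl \<omega> k)" "connected (incl \<omega> k)" "disjoint_family (incl \<omega>)" using * by iprover+
qed

lemma inclusion_regular_open:
  assumes "admissible_geometry \<Omega> incl" "\<omega> \<in> \<Omega>"
  shows "regular_open (incl \<omega> k)"
proof -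
  have op: "open (incl \<omega> k)"
    using assms unfolding admissible_geometry_def inclusion_decomposition_def by blast
  obtain P1 P2 B and \<phi> :: "vec3 \<Rightarrow> vec3" where *: "lipschitz_domain P1" "lipschitz_domain P2" "closure P1 \<subseteq> P2"
    "C2_diffeomorphism P2 B \<phi>" "\<phi> ` closure P1 = closure (incl \<omega> k)" "\<phi> ` P1 = incl \<omega> k"
    using assms unfolding admissible_geometry_def inclusion_regularity_def by meson
  have "cont_diff_on (Suc (Suc 0)) P2 \<phi>" "inj_on \<phi> P2"
    using *(4) by (auto simp: C2_diffeomorphism_def bij_betw_def numeral_2_eq_2)
  then have "continuous_on P2 \<phi>"
    by (auto intro!: continuous_at_imp_continuous_on differentiable_imp_continuous_within)
  then have "regular_open (\<phi> ` P1)"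
    using * \<open>inj_on \<phi> P2\<close> op
    by (intro regular_open_diffeomorphic_image[where V=P2] lipschitz_domain_regular_open)
      (auto simp: lipschitz_domain_def)
  then show ?thesis using *(6) by simp
qed

lemma inclusions_separated:
  assumes "admissible_geometry \<Omega> incl"
  obtains \<tau> where "\<tau> > 0"
    "\<And>\<omega> j k x y. \<omega> \<in> \<Omega> \<Longrightarrow> j \<noteq> k \<Longrightarrow> x \<in> closure (incl \<omega> j) \<Longrightarrow> y \<in> closure (incl \<omega> k) \<Longrightarrow> \<tau> < dist x y"
proof -
  obtain \<tau> where \<tau>: "\<tau> > 0" "\<And>\<omega> j k. \<omega> \<in> \<Omega> \<Longrightarrow> j \<noteq> k \<Longrightarrow> setdist (incl \<omega> k) (incl \<omega> j) > \<tau>"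
    using assms unfolding admissible_geometry_def inclusion_decomposition_def by blast
  show ?thesis
  proof (rule that[OF \<tau>(1)])
    fix \<omega> j k x y assume *: "\<omega> \<in> \<Omega>" "j \<noteq> k" "x \<in> closure (incl \<omega> j)" "y \<in> closure (incl \<omega> k)"
    have "\<tau> < setdist (closure (incl \<omega> j)) (closure (incl \<omega> k))"
      using \<tau>(2)[OF *(1), of k j] *(2) by (simp add: setdist_closure_1 setdist_closure_2 setdist_sym)
    also have "\<dots> \<le> dist x y" by (rule setdist_le_dist[OF *(3,4)])
    finally show "\<tau> < dist x y" .
  qed
qed

text \<open>Because the inclusions keep a uniform distance, a small ball inside the closure of the
configuration meets, and hence lies in, the closure of a single inclusion.\<close>

lemma configuration_regular_open:
  assumes "admissible_geometry \<Omega> incl" "\<omega> \<in> \<Omega>"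
  shows "regular_open \<omega>"
proof (rule regular_openI)
  have dec: "\<omega> = (\<Union>k. incl \<omega> k)" "\<And>k. open (incl \<omega> k)"
    using assms unfolding admissible_geometry_def inclusion_decomposition_def by blast+
  then show "open \<omega>" by (metis open_UN)
  obtain \<tau> where \<tau>: "\<tau> > 0"
    "\<And>\<omega> j k x y. \<omega> \<in> \<Omega> \<Longrightarrow> j \<noteq> k \<Longrightarrow> x \<in> closure (incl \<omega> j) \<Longrightarrow> y \<in> closure (incl \<omega> k) \<Longrightarrow> \<tau> < dist x y"
    using inclusions_separated[OF assms(1)] by metis
  show "interior (closure \<omega>) \<subseteq> \<omega>"
  proof
    fix x assume x: "x \<in> interior (closure \<omega>)"
    then obtain d where d: "d > 0" "ball x d \<subseteq> closure \<omega>"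
      using mem_interior by blast
    have "x \<in> closure \<omega>" using x interior_subset by blast
    then obtain x' where "x' \<in> \<omega>" "dist x' x < \<tau> / 4"
      using \<tau>(1) closure_approachable[of x \<omega>] by (metis divide_pos_pos zero_less_numeral)
    then obtain k where k: "x' \<in> incl \<omega> k" using dec by blast
    have "ball x (min d (\<tau> / 4)) \<subseteq> closure (incl \<omega> k)"
    proof
      fix y assume y: "y \<in> ball x (min d (\<tau> / 4))"
      show "y \<in> closure (incl \<omega> k)"
        unfolding closure_approachable
      proof (intro allI impI)
        fix e :: real assume "e > 0"
        have "y \<in> closure \<omega>" using y d(2) by auto
        then obtain y' where y': "y' \<in> \<omega>" "dist y' y < min e (\<tau> / 4)"
          using \<open>e > 0\<close> \<tau>(1) closure_approachable[of y \<omega>] by (metis divide_pos_pos min_less_iff_conj zero_less_numeral)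
        then obtain j where j: "y' \<in> incl \<omega> j" using dec by blast
        have "dist y' x' < \<tau>"
          using y y'(2) \<open>dist x' x < \<tau> / 4\<close> \<tau>(1) dist_triangle[of y' x' y] dist_triangle[of y x' x]
          by (auto simp: dist_commute)
        then have "j = k"
          using \<tau>(2)[OF assms(2), of j k y' x'] j k closure_subset by (metis less_asym subsetD)
        then show "\<exists>z\<in>incl \<omega> k. dist z y < e" using j y'(2) by auto
      qed
    qed
    moreover have "min d (\<tau> / 4) > 0" using d \<tau>(1) by simp
    ultimately have "x \<in> interior (closure (incl \<omega> k))"
      using mem_interior by blast
    then show "x \<in> \<omega>"
      using inclusion_regular_open[OF assms, of k] dec(1) unfolding regular_open_def by blast
  qed
qed

lemma origin_inclusion_eq:
  assumes "admissible_geometry \<Omega> incl" "\<omega> \<in> \<Omega>" "0 \<in> incl \<omega> k"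
  shows "origin_inclusion \<omega> = incl \<omega> k"
proof
  note dec = inclusion_decompositionD[OF assms(1,2)]
  show "incl \<omega> k \<subseteq> origin_inclusion \<omega>"
    unfolding origin_inclusion_def
  proof (rule connected_component_maximal)
    show "incl \<omega> k \<subseteq> \<omega>" using dec(1) by (metis UN_upper UNIV_I)
  qed (fact assms(3) dec(3))+
  let ?B = "\<Union>j\<in>-{k}. incl \<omega> j"
  have "connected (origin_inclusion \<omega>)" unfolding origin_inclusion_def by (rule connected_connected_component)
  moreover have "open (incl \<omega> k)" using dec(2) .
  moreover have "open ?B" by (intro open_UN ballI dec(2))
  moreover have "incl \<omega> k \<inter> ?B \<inter> origin_inclusion \<omega> = {}"
    using disjoint_family_onD[OF dec(4) UNIV_I UNIV_I] by fastforce
  moreover have sub: "origin_inclusion \<omega> \<subseteq> incl \<omega> k \<union> ?B"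
  proof -
    have "incl \<omega> k \<union> ?B = (\<Union>j. incl \<omega> j)" by auto
    then have "incl \<omega> k \<union> ?B = \<omega>" by (simp only: dec(1))
    then show ?thesis using connected_component_subset[of \<omega> 0] unfolding origin_inclusion_def by (simp only:)
  qed
  ultimately have "incl \<omega> k \<inter> origin_inclusion \<omega> = {} \<or> ?B \<inter> origin_inclusion \<omega> = {}"
    by (rule connectedD)
  moreover have "0 \<in> origin_inclusion \<omega>"
  proof -
    have "0 \<in> (\<Union>j. incl \<omega> j)" by (rule UN_I[where a=k]) (simp_all add: assms(3))
    then have "0 \<in> \<omega>" by (simp only: dec(1))
    then show ?thesis unfolding origin_inclusion_def mem_Collect_eq by (rule connected_component_refl)
  qed
  then have "incl \<omega> k \<inter> origin_inclusion \<omega> \<noteq> {}" using assms(3) by (metis IntI empty_iff)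
  ultimately have *: "?B \<inter> origin_inclusion \<omega> = {}" by (elim disjE) (rule notE)
  show "origin_inclusion \<omega> \<subseteq> incl \<omega> k"
  proof
    fix x assume x: "x \<in> origin_inclusion \<omega>"
    then have "x \<in> incl \<omega> k \<union> ?B" using sub by (rule set_rev_mp)
    moreover have "x \<notin> ?B" using x * by (metis IntI empty_iff)
    ultimately show "x \<in> incl \<omega> k" by (metis UnE)
  qed
qed

lemma origin_inclusion_empty: "0 \<notin> \<omega> \<Longrightarrow> origin_inclusion \<omega> = {}"
  unfolding origin_inclusion_def using connected_component_eq_empty by blast

lemma origin_in_origin_inclusion: "0 \<in> origin_inclusion \<omega> \<longleftrightarrow> 0 \<in> \<omega>"
  unfolding origin_inclusion_def by (metis connected_component_refl connected_component_in mem_Collect_eq)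

lemma origin_inclusion_subset: "origin_inclusion \<omega> \<subseteq> \<omega>"
  unfolding origin_inclusion_def by (rule connected_component_subset)

lemma origin_inclusion_regular_open:
  assumes "admissible_geometry \<Omega> incl" "\<omega> \<in> \<Omega>"
  shows "regular_open (origin_inclusion \<omega>)"
proof (cases "0 \<in> \<omega>")
  case True
  moreover have "\<omega> = (\<Union>k. incl \<omega> k)"
    using assms unfolding admissible_geometry_def inclusion_decomposition_def by blast
  ultimately obtain k where "0 \<in> incl \<omega> k" by blast
  then show ?thesis
    using origin_inclusion_eq[OF assms] inclusion_regular_open[OF assms] by metis
next
  case False
  then show ?thesis by (simp add: origin_inclusion_empty regular_open_def)
qed

text \<open>Within the gap between inclusions, leaving the inclusion at the origin is the same as leaving
the configuration.\<close>

lemma near_origin_in_origin_inclusion: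
  assumes "admissible_geometry \<Omega> incl"
  obtains \<tau> where "\<tau> > 0"
    "\<And>\<omega> y. \<omega> \<in> \<Omega> \<Longrightarrow> norm y < \<tau> \<Longrightarrow> 0 \<in> \<omega> \<Longrightarrow> y \<in> origin_inclusion \<omega> \<longleftrightarrow> y \<in> \<omega>"
proof -
  obtain \<tau> where \<tau>: "\<tau> > 0"
    "\<And>\<omega> j k x y. \<omega> \<in> \<Omega> \<Longrightarrow> j \<noteq> k \<Longrightarrow> x \<in> closure (incl \<omega> j) \<Longrightarrow> y \<in> closure (incl \<omega> k) \<Longrightarrow> \<tau> < dist x y"
    using inclusions_separated[OF assms(1)] by metis
  show ?thesis
  proof (rule that[OF \<tau>(1)])
    fix \<omega> and y :: vec3 assume *: "\<omega> \<in> \<Omega>" "norm y < \<tau>" "0 \<in> \<omega>"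
    note dec = inclusion_decompositionD(1)[OF assms *(1)]
    obtain k where k: "0 \<in> incl \<omega> k" using *(3) dec by (metis UN_E)
    note eq = origin_inclusion_eq[OF assms *(1) k]
    show "y \<in> origin_inclusion \<omega> \<longleftrightarrow> y \<in> \<omega>"
    proof
      assume "y \<in> \<omega>"
      then obtain j where j: "y \<in> incl \<omega> j" using dec by (metis UN_E)
      have "j = k"
        using \<tau>(2)[OF *(1), of j k y 0] j k *(2) closure_subset by (metis dist_0_norm dist_commute less_asym subsetD)
      then show "y \<in> origin_inclusion \<omega>" using j eq by simp
    qed (use origin_inclusion_subset in blast)
  qed
qed

lemma mem_shift_iff: "z \<in> shift y \<omega> \<longleftrightarrow> z + y \<in> \<omega>"
  unfolding shift_def by (auto simp: image_iff algebra_simps intro: bexI[of _ "z + y"])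

lemma shift_add: "shift y (shift z \<omega>) = shift (y + z) \<omega>"
  by (auto simp: mem_shift_iff add_ac)

lemma shift_0: "shift 0 \<omega> = \<omega>"
  by (auto simp: mem_shift_iff)

text \<open>Moving the origin inside an inclusion moves the inclusion at the origin rigidly along. This is
what makes the family of functions of the inclusion at the origin accessible to small
translations.\<close>

lemma origin_inclusion_shift:
  assumes "y \<in> origin_inclusion \<omega>"
  shows "origin_inclusion (shift y \<omega>) = shift y (origin_inclusion \<omega>)"
proof -
  have img: "connected_component (shift z \<eta>) (a - z) (b - z)" if h: "connected_component \<eta> a b" for \<eta> z a b
  proof -
    obtain T where "connected T" "T \<subseteq> \<eta>" "a \<in> T" "b \<in> T"
      using h unfolding connected_component_def by blast
    then show ?thesis
      unfolding connected_component_def shift_def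
      by (intro exI[of _ "(\<lambda>x. x - z) ` T"] conjI connected_continuous_image image_mono imageI continuous_intros)
  qed
  have yy: "connected_component \<omega> 0 y" using assms unfolding origin_inclusion_def mem_Collect_eq .
  have "x \<in> origin_inclusion (shift y \<omega>) \<longleftrightarrow> x + y \<in> origin_inclusion \<omega>" for x
  proof -
    have "connected_component (shift y \<omega>) 0 x \<longleftrightarrow> connected_component \<omega> y (x + y)"
    proof
      assume "connected_component (shift y \<omega>) 0 x"
      from img[OF this, of "- y"] show "connected_component \<omega> y (x + y)"
        by (simp add: shift_add shift_0)
    next
      assume "connected_component \<omega> y (x + y)"
      from img[OF this, of y] show "connected_component (shift y \<omega>) 0 x" by simp
    qed
    also have "\<dots> \<longleftrightarrow> connected_component \<omega> 0 (x + y)"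
    proof
      show "connected_component \<omega> y (x + y) \<Longrightarrow> connected_component \<omega> 0 (x + y)"
        by (rule connected_component_trans[OF yy])
      show "connected_component \<omega> 0 (x + y) \<Longrightarrow> connected_component \<omega> y (x + y)"
        by (rule connected_component_trans[OF connected_component_sym[OF yy]])
    qed
    finally show ?thesis unfolding origin_inclusion_def mem_Collect_eq .
  qed
  then show ?thesis by (simp add: set_eq_iff mem_shift_iff)
qed

section \<open>From the Hausdorff distance to membership of points\<close>

text \<open>On sets of points, membership of each single point is a handier source of events than the
Hausdorff distance: translations and linear bijections are measurable for trivial reasons, and no
bounding box is involved.\<close>

definition points_sigma :: "vec3 set measure" where
  "points_sigma = sigma UNIV (range (\<lambda>q. {A. q \<in> A}))"

lemma space_points_sigma [simp]: "space points_sigma = UNIV"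
  by (simp add: points_sigma_def)

lemma pred_mem_points_sigma [measurable]: "Measurable.pred points_sigma (\<lambda>A. q \<in> A)"
proof -
  have "{A. q \<in> A} \<in> sets points_sigma" unfolding points_sigma_def by auto
  then show ?thesis by (simp add: pred_def)
qed

lemma measurable_points_sigmaI:
  assumes "\<And>q. Measurable.pred M (\<lambda>x. q \<in> f x)"
  shows "f \<in> M \<rightarrow>\<^sub>M points_sigma"
  unfolding points_sigma_def
proof (rule measurable_measure_of)
  fix Y assume "Y \<in> range (\<lambda>q. {A :: vec3 set. q \<in> A})"
  then obtain q where "Y = {A. q \<in> A}" by blast
  then have "f -` Y \<inter> space M = {x \<in> space M. q \<in> f x}" by auto
  then show "f -` Y \<inter> space M \<in> sets M" using assms[of q] by (simp add: pred_def)
qed auto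

lemma space_hausdorff_borel [simp]: "space hausdorff_borel = Pow cube"
  and hausdorff_open_measurable: "hausdorff_open U \<Longrightarrow> U \<in> sets hausdorff_borel"
proof -
  have sub: "{U. hausdorff_open U} \<subseteq> Pow (Pow cube)" by (auto simp: hausdorff_open_def)
  then show "space hausdorff_borel = Pow cube"
    unfolding hausdorff_borel_def by (rule space_measure_of)
  show "hausdorff_open U \<Longrightarrow> U \<in> sets hausdorff_borel"
    unfolding hausdorff_borel_def sets_measure_of[OF sub] by auto
qed

text \<open>Being at positive distance from \<open>q\<close> survives a small Hausdorff perturbation; for the empty set,
because it is infinitely far from all others.\<close>

lemma pred_closure_hausdorff [measurable]: "Measurable.pred hausdorff_borel (\<lambda>A. q \<in> closure A)"
proof -
  have "hausdorff_open {A \<in> Pow cube. q \<notin> closure A}"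
    unfolding hausdorff_open_def
  proof (intro conjI ballI)
    fix A assume "A \<in> {A \<in> Pow cube. q \<notin> closure A}"
    then obtain e where e: "e > 0" "\<And>x. x \<in> A \<Longrightarrow> e \<le> dist x q"
      unfolding closure_approachable by (auto simp: not_less)
    have "q \<notin> closure B" if B: "hausdorff_dist A B < ennreal (e / 2)" for B
    proof
      assume "q \<in> closure B"
      then obtain b where b: "b \<in> B" "dist b q < e / 2"
        using e(1) closure_approachable[of q B] by (metis half_gt_zero)
      have "(SUP y\<in>B. INF x\<in>A. ennreal (dist x y)) < ennreal (e / 2)"
        using B by (simp add: hausdorff_dist_def)
      then have "(INF x\<in>A. ennreal (dist x b)) < ennreal (e / 2)"
        using b(1) by (meson SUP_upper le_less_trans)
      then obtain a where a: "a \<in> A" "ennreal (dist a b) < ennreal (e / 2)"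
        unfolding INF_less_iff by blast
      then have "dist a b < e / 2" using e(1) by (simp add: ennreal_less_iff)
      then show False using e(2)[OF a(1)] b(2) dist_triangle[of a q b] by linarith
    qed
    then show "\<exists>\<epsilon>>0. \<forall>B\<in>Pow cube. hausdorff_dist A B < \<epsilon> \<longrightarrow> B \<in> {A \<in> Pow cube. q \<notin> closure A}"
      using e(1) by (intro exI[of _ "ennreal (e / 2)"]) auto
  qed auto
  from sets.compl_sets[OF hausdorff_open_measurable[OF this]]
  have "Pow cube - {A \<in> Pow cube. q \<notin> closure A} \<in> sets hausdorff_borel" by simp
  moreover have "Pow cube - {A \<in> Pow cube. q \<notin> closure A} = {A \<in> Pow cube. q \<in> closure A}" by blast
  ultimately show ?thesis by (simp add: pred_def)
qed

lemma mem_interior_closed_iff_dense: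
  assumes "closed (C :: 'a::metric_space set)" "closure D = UNIV"
  shows "x \<in> interior C \<longleftrightarrow> (\<exists>n::nat. \<forall>p\<in>D. dist x p < 1 / real (Suc n) \<longrightarrow> p \<in> C)"
proof
  assume "x \<in> interior C"
  then obtain e where e: "e > 0" "ball x e \<subseteq> C" using mem_interior by blast
  obtain n where "1 / real (Suc n) < e" using e(1) nat_approx_posE by blast
  then show "\<exists>n::nat. \<forall>p\<in>D. dist x p < 1 / real (Suc n) \<longrightarrow> p \<in> C"
    using e(2) by (intro exI[of _ n]) (auto simp: subset_iff)
next
  assume "\<exists>n::nat. \<forall>p\<in>D. dist x p < 1 / real (Suc n) \<longrightarrow> p \<in> C"
  then obtain n :: nat where n: "\<And>p. p \<in> D \<Longrightarrow> dist x p < 1 / real (Suc n) \<Longrightarrow> p \<in> C" by blast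
  let ?B = "ball x (1 / real (Suc n))"
  have "?B \<subseteq> closure (?B \<inter> D)"
    using open_Int_closure_subset[of ?B D] assms(2) by simp
  also have "\<dots> \<subseteq> C"
    using n assms(1) by (intro closure_minimal) auto
  finally have "?B \<subseteq> interior C" by (rule interior_maximal) simp
  then show "x \<in> interior C" by (rule subsetD) simp
qed

lemma countable_dense_vectors:
  obtains D :: "vec3 set" where "countable D" "closure D = UNIV"
proof -
  obtain D :: "vec3 set" where D: "countable D" "\<And>X. open X \<Longrightarrow> X \<noteq> {} \<Longrightarrow> \<exists>d\<in>D. d \<in> X"
    using countable_dense_exists by metis
  have "x \<in> closure D" for x
    unfolding closure_approachable
  proof (intro allI impI)
    fix e :: real assume "e > 0"
    then show "\<exists>y\<in>D. dist y x < e"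
      using D(2)[of "ball x e"] by (auto simp: dist_commute)
  qed
  then show ?thesis using that D(1) by blast
qed

text \<open>The passage from the Hausdorff structure to membership of points; on regular open sets the map
is the identity.\<close>

lemma measurable_interior_closure: "(\<lambda>A. interior (closure A)) \<in> hausdorff_borel \<rightarrow>\<^sub>M points_sigma"
proof (rule measurable_points_sigmaI)
  fix q
  obtain D :: "vec3 set" where D: "countable D" "closure D = UNIV" by (rule countable_dense_vectors)
  note [measurable] = D(1)
  show "Measurable.pred hausdorff_borel (\<lambda>A. q \<in> interior (closure A))"
    unfolding mem_interior_closed_iff_dense[OF closed_closure D(2)] by measurable
qed

section \<open>The translation group on the probability space\<close>

text \<open>The geometry and the stationary law, fixed for the study of the translations of configurations
as a group acting on square-integrable random variables.\<close>

locale stationary_inclusions =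
  fixes \<Omega> :: "vec3 set set" and incl :: "vec3 set \<Rightarrow> nat \<Rightarrow> vec3 set" and P :: "vec3 set measure"
  assumes geometry: "admissible_geometry \<Omega> incl"
    and law: "stationary_ergodic_law \<Omega> P"
begin

lemma prob_space_P: "prob_space P"
  and space_P: "space P = \<Omega>"
  and sets_P: "sets P = inclusion_sigma \<Omega>"
  and shift_measurable [measurable]: "shift y \<in> P \<rightarrow>\<^sub>M P"
  and distr_shift: "distr P P (shift y) = P"
  using law by (auto simp: stationary_ergodic_law_def shift_invariant_def)

lemma finite_measure_P: "finite_measure P"
  using prob_space_P by (rule prob_space.finite_measure)

lemma regular_open_config: "\<omega> \<in> space P \<Longrightarrow> regular_open \<omega>"
  using configuration_regular_open[OF geometry] by (simp add: space_P)

lemma open_config: "\<omega> \<in> space P \<Longrightarrow> open \<omega>"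
  by (rule regular_open_open[OF regular_open_config])

lemma shift_space: "\<omega> \<in> space P \<Longrightarrow> shift y \<omega> \<in> space P"
  using measurable_space[OF shift_measurable] .

lemma integral_shift:
  fixes f :: "vec3 set \<Rightarrow> 'b::{banach, second_countable_topology}"
  assumes [measurable]: "f \<in> borel_measurable P"
  shows "(\<integral>\<omega>. f (shift y \<omega>) \<partial>P) = (\<integral>\<omega>. f \<omega> \<partial>P)"
  using integral_distr[OF shift_measurable assms, of y] by (simp add: distr_shift)

lemma AE_shift:
  assumes "AE \<omega> in P. Q \<omega>" shows "AE \<omega> in P. Q (shift y \<omega>)"
proof -
  have "AE \<omega> in distr P P (shift y). Q \<omega>" using assms by (simp only: distr_shift)
  then show ?thesis by (rule AE_distrD[OF shift_measurable])
qed

lemma L2_shift: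
  assumes "f \<in> L2 P" shows "(\<lambda>\<omega>. f (shift y \<omega>)) \<in> L2 P"
proof (rule L2_I)
  note [measurable] = L2_measurable[OF assms]
  show "(\<lambda>\<omega>. f (shift y \<omega>)) \<in> borel_measurable P" by measurable
  have "integrable (distr P P (shift y)) (\<lambda>\<omega>. (norm (f \<omega>))\<^sup>2)"
    unfolding distr_shift by (rule L2_integrable_square[OF assms])
  then show "integrable P (\<lambda>\<omega>. (norm (f (shift y \<omega>)))\<^sup>2)"
    by (subst (asm) integrable_distr_eq) auto
qed

lemma L2norm_shift:
  assumes "f \<in> L2 P" shows "L2norm P (\<lambda>\<omega>. f (shift y \<omega>)) = L2norm P f"
proof -
  note [measurable] = L2_measurable[OF assms]
  show ?thesis unfolding L2norm_def
    by (subst integral_shift[symmetric, of "\<lambda>\<omega>. (norm (f \<omega>))\<^sup>2" y]) simp_all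
qed

lemma pred_mem_config [measurable]: "Measurable.pred P (\<lambda>\<omega>. q \<in> \<omega>)"
proof -
  have "{\<omega> \<in> \<Omega>. 0 \<in> \<omega>} = (\<lambda>\<omega>. indicator \<omega> (0::vec3) :: real) -` {1} \<inter> \<Omega>"
    by (auto simp: indicator_def)
  moreover have "(\<lambda>\<omega>. indicator \<omega> (0::vec3) :: real) -` {1} \<inter> \<Omega> \<in> inclusion_sigma \<Omega>"
    unfolding inclusion_sigma_def by (rule sigma_sets.Basic) force
  ultimately have [measurable]: "Measurable.pred P (\<lambda>\<omega>. 0 \<in> \<omega>)"
    by (simp add: pred_def space_P sets_P)
  have "Measurable.pred P (\<lambda>\<omega>. 0 \<in> shift q \<omega>)" by measurable
  then show ?thesis by (simp add: mem_shift_iff)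
qed

lemma pred_closure_config: "Measurable.pred P (\<lambda>\<omega>. q \<in> closure \<omega>)"
proof -
  obtain D :: "vec3 set" where D: "countable D" "closure D = UNIV" by (rule countable_dense_vectors)
  note [measurable] = D(1)
  have eq: "q \<in> closure \<omega> \<longleftrightarrow> (\<forall>n. \<exists>d\<in>D. dist d q < 1 / real (Suc n) \<and> d \<in> \<omega>)"
    if "\<omega> \<in> space P" for \<omega>
  proof -
    have "closure \<omega> = closure (\<omega> \<inter> D)"
      using closure_open_Int_superset[OF open_config[OF that], of D] D(2) by simp
    then have "q \<in> closure \<omega> \<longleftrightarrow> (\<forall>e>0. \<exists>d\<in>\<omega> \<inter> D. dist d q < e)"
      by (simp only: closure_approachable)
    also have "\<dots> \<longleftrightarrow> (\<forall>n. \<exists>d\<in>\<omega> \<inter> D. dist d q < 1 / real (Suc n))"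
    proof safe
      fix e :: real assume *: "\<forall>n. \<exists>d\<in>\<omega> \<inter> D. dist d q < 1 / real (Suc n)" and "e > 0"
      then obtain n where "1 / real (Suc n) < e" using nat_approx_posE by blast
      moreover obtain d where "d \<in> \<omega> \<inter> D" "dist d q < 1 / real (Suc n)" using * by blast
      ultimately show "\<exists>d\<in>\<omega> \<inter> D. dist d q < e" by (intro bexI[of _ d]) simp_all
    qed simp
    finally show ?thesis by auto
  qed
  have m: "Measurable.pred P (\<lambda>\<omega>. \<forall>n. \<exists>d\<in>D. dist d q < 1 / real (Suc n) \<and> d \<in> \<omega>)"
    by measurable
  show ?thesis by (rule measurable_cong[THEN iffD2, OF eq m])
qed

text \<open>Joint measurability in the configuration and the translation is what Fubini requires. Since
configurations are regular open, \<open>q + y \<in> \<omega>\<close> says that all points of a dense countable set near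
\<open>q + y\<close> lie in the closure of \<open>\<omega>\<close>, an event expressed by countably many measurable conditions.\<close>

lemma shift_measurable_pair [measurable]: "(\<lambda>(\<omega>, y). shift y \<omega>) \<in> P \<Otimes>\<^sub>M borel \<rightarrow>\<^sub>M P"
proof -
  obtain D :: "vec3 set" where D: "countable D" "closure D = UNIV" by (rule countable_dense_vectors)
  note [measurable] = D(1) pred_closure_config
  have mem [measurable]: "Measurable.pred (P \<Otimes>\<^sub>M borel) (\<lambda>(\<omega>, y). q + y \<in> \<omega>)" for q
  proof -
    have "Measurable.pred (P \<Otimes>\<^sub>M borel) (\<lambda>(\<omega>, y). \<exists>n::nat. \<forall>p\<in>D. dist (q + y) p < 1 / real (Suc n) \<longrightarrow> p \<in> closure \<omega>)"
      by measurable
    note m1 = this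
    have iff: "q + y \<in> \<omega> \<longleftrightarrow> (\<exists>n::nat. \<forall>p\<in>D. dist (q + y) p < 1 / real (Suc n) \<longrightarrow> p \<in> closure \<omega>)"
      if "\<omega> \<in> space P" for \<omega> y
      using mem_interior_closed_iff_dense[OF closed_closure D(2), of "q + y" \<omega>] regular_open_config[OF that]
      by (simp add: regular_open_def)
    have eq: "(case z of (\<omega>, y) \<Rightarrow> q + y \<in> \<omega>) =
        (case z of (\<omega>, y) \<Rightarrow> \<exists>n::nat. \<forall>p\<in>D. dist (q + y) p < 1 / real (Suc n) \<longrightarrow> p \<in> closure \<omega>)"
      if "z \<in> space (P \<Otimes>\<^sub>M borel)" for z
      using that iff[of "fst z" "snd z"] by (simp only: split_beta space_pair_measure mem_Times_iff)
    show ?thesis by (rule measurable_cong[THEN iffD2, OF eq m1])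
  qed
  show ?thesis
  proof (rule measurable_sigma_sets[OF sets_P[unfolded inclusion_sigma_def]])
    show "(\<lambda>(\<omega>, y). shift y \<omega>) \<in> space (P \<Otimes>\<^sub>M borel) \<rightarrow> \<Omega>"
      using shift_space by (auto simp: space_pair_measure space_P)
    fix Y assume "Y \<in> {(\<lambda>\<omega>. indicator \<omega> q :: real) -` A \<inter> \<Omega> | q A. (\<forall>i. q $ i \<in> \<rat>) \<and> A \<in> sets borel}"
    then obtain q :: vec3 and A :: "real set" where Y: "Y = (\<lambda>\<omega>. indicator \<omega> q) -` A \<inter> \<Omega>" and A: "A \<in> sets borel"
      by blast
    have "(\<lambda>z. if (case z of (\<omega>, y) \<Rightarrow> q + y \<in> \<omega>) then 1 else 0 :: real) \<in> borel_measurable (P \<Otimes>\<^sub>M borel)"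
      by measurable
    from measurable_sets[OF this A]
    have "(\<lambda>z. if (case z of (\<omega>, y) \<Rightarrow> q + y \<in> \<omega>) then 1 else 0 :: real) -` A \<inter> space (P \<Otimes>\<^sub>M borel) \<in> sets (P \<Otimes>\<^sub>M borel)" .
    moreover have "(\<lambda>z. if (case z of (\<omega>, y) \<Rightarrow> q + y \<in> \<omega>) then 1 else 0 :: real) -` A \<inter> space (P \<Otimes>\<^sub>M borel)
        = (\<lambda>(\<omega>, y). shift y \<omega>) -` Y \<inter> space (P \<Otimes>\<^sub>M borel)"
      using shift_space unfolding Y by (auto simp: space_pair_measure space_P mem_shift_iff indicator_def split: if_splits)
    ultimately show "(\<lambda>(\<omega>, y). shift y \<omega>) -` Y \<inter> space (P \<Otimes>\<^sub>M borel) \<in> sets (P \<Otimes>\<^sub>M borel)" by simp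
  qed auto
qed

text \<open>Exchanging the two quantifiers by Fubini leaves, for each \<open>y\<close>, the translate by \<open>y\<close> of one and the
same event, and stationarity removes the translation.\<close>

lemma vanishes_outside_iff:
  assumes "u \<in> borel_measurable P"
  shows "vanishes_outside P u \<longleftrightarrow> (AE \<omega> in P. 0 \<notin> \<omega> \<longrightarrow> u \<omega> = 0)"
proof -
  note [measurable] = assms
  interpret prob_space P by (rule prob_space_P)
  interpret pair_sigma_finite P "lborel :: vec3 measure"
    by unfold_locales
  let ?Q = "\<lambda>\<omega> y. 0 \<notin> shift y \<omega> \<longrightarrow> u (shift y \<omega>) = 0"
  have shl [measurable]: "(\<lambda>(\<omega>, y). shift y \<omega>) \<in> P \<Otimes>\<^sub>M lborel \<rightarrow>\<^sub>M P"
    using shift_measurable_pair by (simp cong: measurable_cong_sets sets_pair_measure_cong)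
  have "Measurable.pred P (\<lambda>\<omega>. 0 \<notin> \<omega> \<longrightarrow> u \<omega> = 0)" by measurable
  from measurable_compose[OF shl this]
  have m: "Measurable.pred (P \<Otimes>\<^sub>M lborel) (\<lambda>(\<omega>, y). ?Q \<omega> y)" by (simp add: split_beta')
  have "vanishes_outside P u \<longleftrightarrow> (AE \<omega> in P. AE y in lborel. ?Q \<omega> y)"
    by (simp add: vanishes_outside_def mem_shift_iff)
  also have "\<dots> \<longleftrightarrow> (AE y in lborel. AE \<omega> in P. ?Q \<omega> y)"
    by (rule AE_commute) (use m in \<open>simp add: pred_def split_beta'\<close>)
  also have "\<dots> \<longleftrightarrow> (AE y in (lborel :: vec3 measure). AE \<omega> in P. 0 \<notin> \<omega> \<longrightarrow> u \<omega> = 0)"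
  proof (rule AE_cong)
    fix y :: vec3
    show "(AE \<omega> in P. ?Q \<omega> y) \<longleftrightarrow> (AE \<omega> in P. 0 \<notin> \<omega> \<longrightarrow> u \<omega> = 0)"
      using AE_shift[of "\<lambda>\<omega>. 0 \<notin> \<omega> \<longrightarrow> u \<omega> = 0" y] AE_shift[of "\<lambda>\<omega>. ?Q \<omega> y" "- y"]
      by (intro iffI) (simp_all only: shift_add shift_0 add.left_inverse add.right_inverse)
  qed
  also have "\<dots> \<longleftrightarrow> (AE \<omega> in P. 0 \<notin> \<omega> \<longrightarrow> u \<omega> = 0)"
  proof -
    have "ae_filter (lborel :: vec3 measure) \<noteq> bot"
      unfolding ae_filter_eq_bot_iff by simp
    then show ?thesis by (simp add: eventually_const)
  qed
  finally show ?thesis .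
qed

end

section \<open>Strong continuity of translations\<close>

context stationary_inclusions begin

text \<open>For a fixed configuration, which is open, a point of it stays inside under small translations;
the statement follows by dominated convergence.\<close>

lemma measure_config_mem_tendsto_0:
  assumes "y \<longlonglongrightarrow> (0 :: vec3)"
  shows "(\<lambda>n. measure P {\<omega> \<in> space P. q \<in> \<omega> \<and> q + y n \<notin> \<omega>}) \<longlonglongrightarrow> 0"
proof -
  interpret prob_space P by (rule prob_space_P)
  have "(\<lambda>n. \<integral>\<omega>. indicator {\<omega> \<in> space P. q \<in> \<omega> \<and> q + y n \<notin> \<omega>} \<omega> \<partial>P) \<longlonglongrightarrow> (\<integral>\<omega>. (0::real) \<partial>P)"
  proof (rule integral_dominated_convergence[where w="\<lambda>_. 1"])
    show "AE \<omega> in P. (\<lambda>n. indicator {\<omega> \<in> space P. q \<in> \<omega> \<and> q + y n \<notin> \<omega>} \<omega> :: real) \<longlonglongrightarrow> 0"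
    proof (rule AE_I2, rule tendsto_eventually)
      fix \<omega> assume \<omega>: "\<omega> \<in> space P"
      have "(\<lambda>n. q + y n) \<longlonglongrightarrow> q" using tendsto_add[OF tendsto_const assms] by simp
      then have "q \<in> \<omega> \<Longrightarrow> \<forall>\<^sub>F n in sequentially. q + y n \<in> \<omega>"
        by (rule topological_tendstoD[OF _ open_config[OF \<omega>]])
      then show "\<forall>\<^sub>F n in sequentially. indicator {\<omega> \<in> space P. q \<in> \<omega> \<and> q + y n \<notin> \<omega>} \<omega> = (0::real)"
        by (cases "q \<in> \<omega>") (auto elim: eventually_mono)
    qed
  qed (auto split: split_indicator)
  then show ?thesis by simp
qed

text \<open>Entering the configuration is, by stationarity, leaving it under the opposite translation.\<close>

lemma measure_mem_change_tendsto_0: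
  assumes y: "y \<longlonglongrightarrow> (0 :: vec3)"
  shows "(\<lambda>n. measure P {\<omega> \<in> space P. q \<in> \<omega> \<longleftrightarrow> q + y n \<notin> \<omega>}) \<longlonglongrightarrow> 0"
proof -
  interpret prob_space P by (rule prob_space_P)
  let ?A = "\<lambda>z. {\<omega> \<in> space P. q \<in> \<omega> \<and> q + z \<notin> \<omega>}"
  have "(\<lambda>n. - y n) \<longlonglongrightarrow> 0" using tendsto_minus[OF y] by simp
  from tendsto_add[OF measure_config_mem_tendsto_0[OF y] measure_config_mem_tendsto_0[OF this]]
  have lim: "(\<lambda>n. measure P (?A (y n)) + measure P (?A (- y n))) \<longlonglongrightarrow> 0" by simp
  have "measure P {\<omega> \<in> space P. q \<in> \<omega> \<longleftrightarrow> q + y n \<notin> \<omega>} \<le> measure P (?A (y n)) + measure P (?A (- y n))" for n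
  proof -
    have "measure P {\<omega> \<in> space P. q \<in> \<omega> \<longleftrightarrow> q + y n \<notin> \<omega>}
        \<le> measure P (?A (y n) \<union> {\<omega> \<in> space P. q \<notin> \<omega> \<and> q + y n \<in> \<omega>})"
      by (rule finite_measure_mono) auto
    also have "\<dots> \<le> measure P (?A (y n)) + measure P {\<omega> \<in> space P. q \<notin> \<omega> \<and> q + y n \<in> \<omega>}"
      by (rule measure_Un_le) auto
    also have "measure P {\<omega> \<in> space P. q \<notin> \<omega> \<and> q + y n \<in> \<omega>} = measure P (?A (- y n))"
    proof -
      have "measure P (?A (- y n)) = measure (distr P P (shift (y n))) (?A (- y n))"
        by (simp only: distr_shift)
      also have "\<dots> = measure P (shift (y n) -` ?A (- y n) \<inter> space P)"
        by (rule measure_distr) auto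
      also have "shift (y n) -` ?A (- y n) \<inter> space P = {\<omega> \<in> space P. q \<notin> \<omega> \<and> q + y n \<in> \<omega>}"
        using shift_space by (auto simp: mem_shift_iff)
      finally show ?thesis by simp
    qed
    finally show ?thesis by simp
  qed
  then have "\<forall>\<^sub>F n in sequentially. measure P {\<omega> \<in> space P. q \<in> \<omega> \<longleftrightarrow> q + y n \<notin> \<omega>}
      \<le> measure P (?A (y n)) + measure P (?A (- y n))" by (rule always_eventually[OF allI])
  from real_tendsto_sandwich[OF _ this tendsto_const lim] show ?thesis by simp
qed

text \<open>The events that are nearly invariant under small translations form a \<open>\<sigma>\<close>-algebra: for a countable
union, finitely many members carry almost all of the mass, and the translate of the remainder has
the same small measure. The generators are covered by the preceding lemma.\<close>

lemma event_shift_continuous: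
  assumes "A \<in> sets P" and y: "y \<longlonglongrightarrow> (0 :: vec3)"
  shows "(\<lambda>n. measure P {\<omega> \<in> space P. \<omega> \<in> A \<longleftrightarrow> shift (y n) \<omega> \<notin> A}) \<longlonglongrightarrow> 0"
proof -
  interpret prob_space P by (rule prob_space_P)
  have sub: "{(\<lambda>\<omega>. indicator \<omega> q :: real) -` A \<inter> \<Omega> | q A. (\<forall>i. q $ i \<in> \<rat>) \<and> A \<in> sets borel} \<subseteq> Pow \<Omega>" by auto
  have "A \<in> sigma_sets \<Omega> {(\<lambda>\<omega>. indicator \<omega> q :: real) -` A \<inter> \<Omega> | q A. (\<forall>i. q $ i \<in> \<rat>) \<and> A \<in> sets borel}"
    using assms(1) by (simp add: sets_P inclusion_sigma_def)
  then show ?thesis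
  proof (induction rule: sigma_sets.induct)
    case (Basic a)
    then obtain q :: vec3 and B :: "real set" where a: "a = (\<lambda>\<omega>. indicator \<omega> q) -` B \<inter> \<Omega>" and B: "B \<in> sets borel" by blast
    have a_meas [measurable]: "a \<in> sets P"
      using Basic by (simp add: sets_P inclusion_sigma_def)
    show ?case
    proof (rule real_tendsto_sandwich[OF _ _ tendsto_const measure_mem_change_tendsto_0[OF y, of q]])
      show "\<forall>\<^sub>F n in sequentially. measure P {\<omega> \<in> space P. \<omega> \<in> a \<longleftrightarrow> shift (y n) \<omega> \<notin> a}
          \<le> measure P {\<omega> \<in> space P. q \<in> \<omega> \<longleftrightarrow> q + y n \<notin> \<omega>}"
      proof (intro always_eventually allI finite_measure_mono)
        fix n
        show "{\<omega> \<in> space P. \<omega> \<in> a \<longleftrightarrow> shift (y n) \<omega> \<notin> a} \<subseteq> {\<omega> \<in> space P. q \<in> \<omega> \<longleftrightarrow> q + y n \<notin> \<omega>}"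
        proof
          fix \<omega> assume "\<omega> \<in> {\<omega> \<in> space P. \<omega> \<in> a \<longleftrightarrow> shift (y n) \<omega> \<notin> a}"
          then have \<omega>: "\<omega> \<in> space P" and *: "\<omega> \<in> a \<longleftrightarrow> shift (y n) \<omega> \<notin> a" by blast+
          then have "\<omega> \<in> \<Omega>" "shift (y n) \<omega> \<in> \<Omega>" using shift_space by (auto simp: space_P)
          then have "indicator \<omega> q \<noteq> (indicator (shift (y n) \<omega>) q :: real)"
            using * unfolding a by auto
          then have "q \<in> \<omega> \<longleftrightarrow> q + y n \<notin> \<omega>"
            by (auto simp: indicator_def mem_shift_iff split: if_splits)
          with \<omega> show "\<omega> \<in> {\<omega> \<in> space P. q \<in> \<omega> \<longleftrightarrow> q + y n \<notin> \<omega>}" by blast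
        qed
      qed measurable
    qed auto
  next
    case Empty
    show ?case by simp
  next
    case (Compl a)
    have "{\<omega> \<in> space P. \<omega> \<in> \<Omega> - a \<longleftrightarrow> shift (y n) \<omega> \<notin> \<Omega> - a}
      = {\<omega> \<in> space P. \<omega> \<in> a \<longleftrightarrow> shift (y n) \<omega> \<notin> a}" for n
      using shift_space by (auto simp: space_P)
    then show ?case using Compl.IH by simp
  next
    case (Union a)
    have a_meas [measurable]: "a i \<in> sets P" for i
      using Union(1) by (simp add: sets_P inclusion_sigma_def)
    let ?d = "\<lambda>B n. measure P {\<omega> \<in> space P. \<omega> \<in> B \<longleftrightarrow> shift (y n) \<omega> \<notin> B}"
    let ?U = "\<Union>i. a i"
    have tail: "(\<lambda>m. measure P (?U - (\<Union>i<m. a i))) \<longlonglongrightarrow> 0"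
    proof -
      have "(\<lambda>m. measure P (?U - (\<Union>i<m. a i))) \<longlonglongrightarrow> measure P (\<Inter>m. ?U - (\<Union>i<m. a i))"
        by (rule finite_Lim_measure_decseq) (auto simp: decseq_def)
      moreover have "(\<Inter>m. ?U - (\<Union>i<m. a i)) = {}" by auto
      ultimately show ?thesis by (simp only: measure_empty)
    qed
    have bound: "?d ?U n \<le> (\<Sum>i<m. ?d (a i) n) + 2 * measure P (?U - (\<Union>i<m. a i))" for m n
    proof -
      let ?R = "?U - (\<Union>i<m. a i)"
      have Rm [measurable]: "?R \<in> sets P" by auto
      let ?S = "shift (y n) -` ?R \<inter> space P"
      have Sm [measurable]: "?S \<in> sets P" by (rule measurable_sets[OF shift_measurable Rm])
      have S: "measure P ?S = measure P ?R"
        using measure_distr[OF shift_measurable Rm, of "y n"] by (simp add: distr_shift)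
      have "?d ?U n \<le> measure P ((\<Union>i\<in>{..<m}. {\<omega> \<in> space P. \<omega> \<in> a i \<longleftrightarrow> shift (y n) \<omega> \<notin> a i}) \<union> (?R \<union> ?S))"
      proof (rule finite_measure_mono)
        show "{\<omega> \<in> space P. \<omega> \<in> ?U \<longleftrightarrow> shift (y n) \<omega> \<notin> ?U}
            \<subseteq> (\<Union>i\<in>{..<m}. {\<omega> \<in> space P. \<omega> \<in> a i \<longleftrightarrow> shift (y n) \<omega> \<notin> a i}) \<union> (?R \<union> ?S)"
          by auto
      qed measurable
      also have "\<dots> \<le> measure P (\<Union>i\<in>{..<m}. {\<omega> \<in> space P. \<omega> \<in> a i \<longleftrightarrow> shift (y n) \<omega> \<notin> a i}) + measure P (?R \<union> ?S)"
        by (rule measure_Un_le) measurable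
      also have "\<dots> \<le> (\<Sum>i<m. ?d (a i) n) + (measure P ?R + measure P ?S)"
        by (intro add_mono finite_measure_subadditive_finite measure_Un_le) auto
      finally show ?thesis by (simp add: S)
    qed
    show ?case
    proof (rule LIMSEQ_I)
      fix e :: real assume "e > 0"
      then have "\<forall>\<^sub>F m in sequentially. measure P (?U - (\<Union>i<m. a i)) < e / 4"
        using order_tendstoD(2)[OF tail, of "e / 4"] by simp
      then obtain m where m: "measure P (?U - (\<Union>i<m. a i)) < e / 4"
        by (auto simp: eventually_sequentially)
      have "(\<lambda>n. \<Sum>i<m. ?d (a i) n) \<longlonglongrightarrow> (\<Sum>i<m. 0)"
        by (intro tendsto_sum Union.IH)
      then have "\<forall>\<^sub>F n in sequentially. (\<Sum>i<m. ?d (a i) n) < e / 2"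
        using order_tendstoD(2)[of _ 0 _ "e / 2"] \<open>e > 0\<close> by simp
      then obtain N where N: "\<And>n. n \<ge> N \<Longrightarrow> (\<Sum>i<m. ?d (a i) n) < e / 2"
        by (auto simp: eventually_sequentially)
      have "norm (?d ?U n - 0) < e" if "n \<ge> N" for n
        using bound[of n m] m N[OF that] by simp
      then show "\<exists>N. \<forall>n\<ge>N. norm (?d ?U n - 0) < e" by blast
    qed
  qed
qed

lemma simple_function_shift_continuous:
  fixes s :: "vec3 set \<Rightarrow> 'b::euclidean_space"
  assumes s: "simple_function P s" and y: "y \<longlonglongrightarrow> (0 :: vec3)"
  shows "(\<lambda>n. L2norm P (\<lambda>\<omega>. s (shift (y n) \<omega>) - s \<omega>)) \<longlonglongrightarrow> 0"
proof -
  interpret prob_space P by (rule prob_space_P)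
  have fin: "finite (s ` space P)" and ev: "\<And>z. s -` {z} \<inter> space P \<in> sets P"
    using s by (auto intro: simple_functionD)
  have [measurable]: "s \<in> borel_measurable P" using s by (rule borel_measurable_simple_function)
  let ?A = "\<lambda>z. s -` {z} \<inter> space P"
  let ?d = "\<lambda>z n. measure P {\<omega> \<in> space P. \<omega> \<in> ?A z \<longleftrightarrow> shift (y n) \<omega> \<notin> ?A z}"
  obtain B where B: "B > 0" "\<And>\<omega>. \<omega> \<in> space P \<Longrightarrow> norm (s \<omega>) \<le> B"
    using finite_imp_bounded[OF fin] unfolding bounded_pos by auto
  have bound: "(L2norm P (\<lambda>\<omega>. s (shift (y n) \<omega>) - s \<omega>))\<^sup>2 \<le> (2 * B)\<^sup>2 * (\<Sum>z\<in>s ` space P. ?d z n)" for n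
  proof -
    let ?E = "\<Union>z\<in>s ` space P. {\<omega> \<in> space P. \<omega> \<in> ?A z \<longleftrightarrow> shift (y n) \<omega> \<notin> ?A z}"
    have Em [measurable]: "{\<omega> \<in> space P. \<omega> \<in> ?A z \<longleftrightarrow> shift (y n) \<omega> \<notin> ?A z} \<in> sets P" for z
      using ev[of z] by measurable
    have E: "?E \<in> sets P" by (intro sets.finite_UN fin Em)
    have "(L2norm P (\<lambda>\<omega>. s (shift (y n) \<omega>) - s \<omega>))\<^sup>2 \<le> (\<integral>\<omega>. (2 * B)\<^sup>2 * indicator ?E \<omega> \<partial>P)"
      unfolding L2norm_square
    proof (rule integral_mono_AE')
      show "integrable P (\<lambda>\<omega>. (2 * B)\<^sup>2 * indicator ?E \<omega>)"
        using E by (intro integrable_mult_right integrable_real_indicator) (auto simp: less_top[symmetric])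
      show "AE \<omega> in P. (norm (s (shift (y n) \<omega>) - s \<omega>))\<^sup>2 \<le> (2 * B)\<^sup>2 * indicator ?E \<omega>"
      proof (rule AE_I2)
        fix \<omega> assume \<omega>: "\<omega> \<in> space P"
        show "(norm (s (shift (y n) \<omega>) - s \<omega>))\<^sup>2 \<le> (2 * B)\<^sup>2 * indicator ?E \<omega>"
        proof (cases "s (shift (y n) \<omega>) = s \<omega>")
          case False
          then have "\<omega> \<in> ?E" using \<omega> shift_space[OF \<omega>] by auto
          then have ind: "indicator ?E \<omega> = (1::real)" by (rule indicator_simps(1))
          have "norm (s (shift (y n) \<omega>) - s \<omega>) \<le> 2 * B"
            using norm_triangle_ineq4[of "s (shift (y n) \<omega>)" "s \<omega>"] B(2)[OF \<omega>] B(2)[OF shift_space[OF \<omega>], of "y n"] by simp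
          then show ?thesis unfolding ind mult_1_right by (intro power_mono) auto
        qed simp
      qed
    qed simp
    also have "\<dots> = (2 * B)\<^sup>2 * measure P ?E" using E by simp
    also have "\<dots> \<le> (2 * B)\<^sup>2 * (\<Sum>z\<in>s ` space P. ?d z n)"
      by (intro mult_left_mono finite_measure_subadditive_finite fin) (auto intro: Em)
    finally show ?thesis .
  qed
  have "(\<lambda>n. (2 * B)\<^sup>2 * (\<Sum>z\<in>s ` space P. ?d z n)) \<longlonglongrightarrow> (2 * B)\<^sup>2 * (\<Sum>z\<in>s ` space P. 0)"
    by (intro tendsto_intros event_shift_continuous ev y)
  then have "(\<lambda>n. (2 * B)\<^sup>2 * (\<Sum>z\<in>s ` space P. ?d z n)) \<longlonglongrightarrow> 0" by simp
  then have "(\<lambda>n. (L2norm P (\<lambda>\<omega>. s (shift (y n) \<omega>) - s \<omega>))\<^sup>2) \<longlonglongrightarrow> 0"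
    by (rule real_tendsto_sandwich[rotated 3]) (use bound in auto)
  from tendsto_real_sqrt[OF this] show ?thesis by (simp add: L2norm_nonneg)
qed

text \<open>Simple functions are dense, and translations are isometries, so the approximation error is not
amplified.\<close>

lemma shift_continuous_L2:
  assumes u: "u \<in> L2 P"
  shows "((\<lambda>y. L2norm P (\<lambda>\<omega>. u (shift y \<omega>) - u \<omega>)) \<longlongrightarrow> 0) (at 0)"
  unfolding tendsto_at_iff_sequentially comp_def
proof (intro allI impI)
  fix y :: "nat \<Rightarrow> vec3" assume y: "y \<longlonglongrightarrow> 0"
  interpret prob_space P by (rule prob_space_P)
  note [measurable] = L2_measurable[OF u]
  obtain S where S: "\<And>i. simple_function P (S i)" "\<And>\<omega>. \<omega> \<in> space P \<Longrightarrow> (\<lambda>i. S i \<omega>) \<longlonglongrightarrow> u \<omega>"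
    "\<And>i \<omega>. \<omega> \<in> space P \<Longrightarrow> dist (S i \<omega>) 0 \<le> 2 * dist (u \<omega>) 0"
    using borel_measurable_implies_sequence_metric[OF L2_measurable[OF u], of 0] by blast
  have Sm [measurable]: "S i \<in> borel_measurable P" for i
    using S(1) by (rule borel_measurable_simple_function)
  have S_L2: "S i \<in> L2 P" for i
    using S(3) by (intro L2_dominated[OF u, where c=2]) auto
  have "(\<lambda>i. \<integral>\<omega>. (norm (S i \<omega> - u \<omega>))\<^sup>2 \<partial>P) \<longlonglongrightarrow> (\<integral>\<omega>. 0 \<partial>P)"
  proof (rule integral_dominated_convergence[where w="\<lambda>\<omega>. 9 * (norm (u \<omega>))\<^sup>2"])
    show "integrable P (\<lambda>\<omega>. 9 * (norm (u \<omega>))\<^sup>2)" using L2_integrable_square[OF u] by simp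
    show "AE \<omega> in P. (\<lambda>i. (norm (S i \<omega> - u \<omega>))\<^sup>2) \<longlonglongrightarrow> 0"
    proof (rule AE_I2)
      fix \<omega> assume "\<omega> \<in> space P"
      from tendsto_power[OF tendsto_norm[OF tendsto_diff[OF S(2)[OF this] tendsto_const[of "u \<omega>"]]], of 2]
      show "(\<lambda>i. (norm (S i \<omega> - u \<omega>))\<^sup>2) \<longlonglongrightarrow> 0" by simp
    qed
    show "AE \<omega> in P. norm ((norm (S i \<omega> - u \<omega>))\<^sup>2) \<le> 9 * (norm (u \<omega>))\<^sup>2" for i
    proof (rule AE_I2)
      fix \<omega> assume "\<omega> \<in> space P"
      then have "norm (S i \<omega> - u \<omega>) \<le> 3 * norm (u \<omega>)"
        using norm_triangle_ineq4[of "S i \<omega>" "u \<omega>"] S(3)[of \<omega> i] by simp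
      then have "(norm (S i \<omega> - u \<omega>))\<^sup>2 \<le> (3 * norm (u \<omega>))\<^sup>2" by (intro power_mono) auto
      then show "norm ((norm (S i \<omega> - u \<omega>))\<^sup>2) \<le> 9 * (norm (u \<omega>))\<^sup>2" by (simp add: power_mult_distrib)
    qed
  qed measurable
  from tendsto_real_sqrt[OF this] have approx: "(\<lambda>i. L2norm P (\<lambda>\<omega>. S i \<omega> - u \<omega>)) \<longlonglongrightarrow> 0"
    by (simp add: L2norm_def)
  show "(\<lambda>n. L2norm P (\<lambda>\<omega>. u (shift (y n) \<omega>) - u \<omega>)) \<longlonglongrightarrow> 0"
  proof (rule LIMSEQ_I)
    fix e :: real assume "e > 0"
    then have "\<forall>\<^sub>F i in sequentially. L2norm P (\<lambda>\<omega>. S i \<omega> - u \<omega>) < e / 4"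
      using order_tendstoD(2)[OF approx, of "e / 4"] by simp
    then obtain i where i: "L2norm P (\<lambda>\<omega>. S i \<omega> - u \<omega>) < e / 4"
      by (auto simp: eventually_sequentially)
    have "\<forall>\<^sub>F n in sequentially. L2norm P (\<lambda>\<omega>. S i (shift (y n) \<omega>) - S i \<omega>) < e / 2"
      using order_tendstoD(2)[OF simple_function_shift_continuous[OF S(1) y, of i], of "e / 2"] \<open>e > 0\<close> by simp
    then obtain N where N: "\<And>n. n \<ge> N \<Longrightarrow> L2norm P (\<lambda>\<omega>. S i (shift (y n) \<omega>) - S i \<omega>) < e / 2"
      by (auto simp: eventually_sequentially)
    have "norm (L2norm P (\<lambda>\<omega>. u (shift (y n) \<omega>) - u \<omega>) - 0) < e" if "n \<ge> N" for n
    proof -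
      let ?r = "\<lambda>\<omega>. S i \<omega> - u \<omega>"
      have r: "?r \<in> L2 P" by (rule L2_diff[OF S_L2 u])
      have "L2norm P (\<lambda>\<omega>. u (shift (y n) \<omega>) - u \<omega>)
          = L2norm P (\<lambda>\<omega>. ((S i (shift (y n) \<omega>) - S i \<omega>) + - ?r (shift (y n) \<omega>)) + ?r \<omega>)"
        by (intro arg_cong[where f="L2norm P"] ext) (simp add: algebra_simps)
      also have "\<dots> \<le> L2norm P (\<lambda>\<omega>. (S i (shift (y n) \<omega>) - S i \<omega>) + - ?r (shift (y n) \<omega>)) + L2norm P ?r"
        by (intro L2norm_triangle L2_add L2_diff L2_uminus L2_shift[of ?r] L2_shift[of "S i"] S_L2 r u L2_shift[of u])
      also have "\<dots> \<le> L2norm P (\<lambda>\<omega>. S i (shift (y n) \<omega>) - S i \<omega>) + L2norm P (\<lambda>\<omega>. - ?r (shift (y n) \<omega>)) + L2norm P ?r"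
        by (intro add_right_mono L2norm_triangle L2_diff L2_uminus L2_shift[of ?r] L2_shift[of "S i"] S_L2 r u L2_shift[of u])
      also have "L2norm P (\<lambda>\<omega>. - ?r (shift (y n) \<omega>)) = L2norm P ?r"
        using L2norm_uminus[of P "\<lambda>\<omega>. ?r (shift (y n) \<omega>)"] L2norm_shift[OF r, of "y n"] by simp
      finally show ?thesis using N[OF that] i L2norm_nonneg[of P "\<lambda>\<omega>. u (shift (y n) \<omega>) - u \<omega>"] by simp
    qed
    then show "\<exists>N. \<forall>n\<ge>N. norm (L2norm P (\<lambda>\<omega>. u (shift (y n) \<omega>) - u \<omega>) - 0) < e" by blast
  qed
qed

end

section \<open>Stationary gradients as limits of difference quotients\<close>

lemma linear_tensor_apply: "linear (tensor_apply C)"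
  by (rule linearI) (auto simp: tensor_apply_def vec_eq_iff algebra_simps sum.distrib sum_distrib_left)

lemma tensor_apply_measurable [measurable]: "tensor_apply C \<in> borel_measurable borel"
  using linear_tensor_apply
  by (intro borel_measurable_continuous_onI linear_continuous_on) (simp add: linear_conv_bounded_linear)

context stationary_inclusions begin

definition difference_remainder ::
  "(vec3 set \<Rightarrow> vec3) \<Rightarrow> (vec3 set \<Rightarrow> mat3) \<Rightarrow> 3 \<Rightarrow> real \<Rightarrow> vec3 set \<Rightarrow> vec3" where
  "difference_remainder u G i t \<omega> = u (shift (t *\<^sub>R axis i 1) \<omega>) - u \<omega> - t *\<^sub>R (G \<omega> $ i)"

text \<open>The gradient in the sense of the translation group: difference quotients converge in the
\<open>L2\<close> norm. Unlike the distributional definition, it refers to a neighbourhood of \<open>y = 0\<close> only, and it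
is the form in which gradients are transported to averages and to reflected or rotated fields.\<close>

definition strong_gradient :: "(vec3 set \<Rightarrow> vec3) \<Rightarrow> (vec3 set \<Rightarrow> mat3) \<Rightarrow> bool" where
  "strong_gradient u G \<longleftrightarrow>
     (\<forall>i. ((\<lambda>t. L2norm P (difference_remainder u G i t) / \<bar>t\<bar>) \<longlongrightarrow> 0) (at 0))"

lemma difference_remainder_L2:
  assumes "u \<in> L2 P" "G \<in> L2 P" shows "difference_remainder u G i t \<in> L2 P"
  unfolding difference_remainder_def[abs_def]
  by (intro L2_diff L2_shift L2_scaleR L2_vec_nth assms)

lemma strong_gradientD:
  assumes "strong_gradient u G" "e > 0"
  obtains d where "d > 0" "\<And>t. 0 < \<bar>t\<bar> \<Longrightarrow> \<bar>t\<bar> < d \<Longrightarrow> L2norm P (difference_remainder u G i t) \<le> e * \<bar>t\<bar>"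
proof -
  have "\<forall>\<^sub>F t in at 0. L2norm P (difference_remainder u G i t) / \<bar>t\<bar> < e"
    using assms order_tendstoD(2) unfolding strong_gradient_def by blast
  then obtain d where d: "d > 0" "\<And>t. t \<noteq> 0 \<Longrightarrow> dist t 0 < d \<Longrightarrow> L2norm P (difference_remainder u G i t) / \<bar>t\<bar> < e"
    unfolding eventually_at by blast
  show ?thesis
  proof (rule that[OF d(1)])
    fix t :: real assume "0 < \<bar>t\<bar>" "\<bar>t\<bar> < d"
    then have "L2norm P (difference_remainder u G i t) / \<bar>t\<bar> < e" using d(2)[of t] by simp
    then show "L2norm P (difference_remainder u G i t) \<le> e * \<bar>t\<bar>"
      using \<open>0 < \<bar>t\<bar>\<close> by (simp add: pos_divide_less_eq)
  qed
qed

lemma strong_gradientI: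
  assumes "\<And>e i. e > 0 \<Longrightarrow> \<exists>d>0. \<forall>t. 0 < \<bar>t\<bar> \<and> \<bar>t\<bar> < d \<longrightarrow> L2norm P (difference_remainder u G i t) \<le> e * \<bar>t\<bar>"
  shows "strong_gradient u G"
  unfolding strong_gradient_def tendsto_iff eventually_at
proof (intro allI impI)
  fix i and e :: real assume "e > 0"
  then obtain d where d: "d > 0" "\<And>t. 0 < \<bar>t\<bar> \<Longrightarrow> \<bar>t\<bar> < d \<Longrightarrow> L2norm P (difference_remainder u G i t) \<le> e / 2 * \<bar>t\<bar>"
    using assms[of "e / 2" i] by auto
  have "dist (L2norm P (difference_remainder u G i t) / \<bar>t\<bar>) 0 < e" if "t \<noteq> 0" "dist t 0 < d" for t
  proof -
    have "L2norm P (difference_remainder u G i t) / \<bar>t\<bar> \<le> e / 2"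
      using d(2)[of t] that by (simp add: pos_divide_le_eq)
    moreover have "0 \<le> L2norm P (difference_remainder u G i t) / \<bar>t\<bar>"
      by (simp add: L2norm_nonneg)
    ultimately show ?thesis unfolding dist_real_def using \<open>e > 0\<close> by linarith
  qed
  then show "\<exists>d>0. \<forall>t\<in>UNIV. t \<noteq> 0 \<and> dist t 0 < d \<longrightarrow> dist (L2norm P (difference_remainder u G i t) / \<bar>t\<bar>) 0 < e"
    using d(1) by blast
qed

text \<open>For fixed \<open>h\<close>, the correlation of the translated field with \<open>h\<close> is a bounded continuous function of
the translation, so that the results on distributional derivatives of such functions apply.\<close>

lemma correlation_bound:
  assumes "u \<in> L2 P" "h \<in> L2 P"
  shows "\<bar>\<integral>\<omega>. u (shift y \<omega>) \<bullet> h \<omega> \<partial>P\<bar> \<le> L2norm P u * L2norm P h"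
  using L2norm_Cauchy_Schwarz[OF L2_shift[OF assms(1)] assms(2), of y] L2norm_shift[OF assms(1), of y] by simp

lemma correlation_diff_bound:
  assumes "u \<in> L2 P" "h \<in> L2 P"
  shows "\<bar>(\<integral>\<omega>. u (shift (y + z) \<omega>) \<bullet> h \<omega> \<partial>P) - (\<integral>\<omega>. u (shift y \<omega>) \<bullet> h \<omega> \<partial>P)\<bar>
    \<le> L2norm P (\<lambda>\<omega>. u (shift z \<omega>) - u \<omega>) * L2norm P h"
proof -
  have "(\<integral>\<omega>. u (shift (y + z) \<omega>) \<bullet> h \<omega> \<partial>P) - (\<integral>\<omega>. u (shift y \<omega>) \<bullet> h \<omega> \<partial>P)
    = (\<integral>\<omega>. (u (shift z (shift y \<omega>)) - u (shift y \<omega>)) \<bullet> h \<omega> \<partial>P)"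
    using L2_integrable_inner[OF L2_shift[OF assms(1)] assms(2), of "y + z"]
      L2_integrable_inner[OF L2_shift[OF assms(1)] assms(2), of y]
    by (simp add: inner_diff_left shift_add add.commute[of z y])
  then show ?thesis
    using correlation_bound[OF L2_diff[OF L2_shift[OF assms(1), of z] assms(1)] assms(2), of y] by simp
qed

lemma correlation_continuous:
  assumes "u \<in> L2 P" "h \<in> L2 P"
  shows "continuous_on UNIV (\<lambda>y. \<integral>\<omega>. u (shift y \<omega>) \<bullet> h \<omega> \<partial>P)"
proof (rule continuous_at_imp_continuous_on, rule ballI)
  fix y :: vec3
  let ?a = "\<lambda>y. \<integral>\<omega>. u (shift y \<omega>) \<bullet> h \<omega> \<partial>P"
  have "((\<lambda>z. L2norm P (\<lambda>\<omega>. u (shift z \<omega>) - u \<omega>) * L2norm P h) \<longlongrightarrow> 0 * L2norm P h) (at 0)"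
    by (intro tendsto_mult shift_continuous_L2 assms tendsto_const)
  then have lim: "((\<lambda>z. L2norm P (\<lambda>\<omega>. u (shift z \<omega>) - u \<omega>) * L2norm P h) \<longlongrightarrow> 0) (at 0)" by (simp only: mult_zero_left)
  have "\<forall>\<^sub>F z in at 0. norm (?a (y + z) - ?a y) \<le> L2norm P (\<lambda>\<omega>. u (shift z \<omega>) - u \<omega>) * L2norm P h"
    unfolding real_norm_def by (intro always_eventually allI correlation_diff_bound assms)
  from Lim_null_comparison[OF this lim] have "((\<lambda>z. ?a (y + z)) \<longlongrightarrow> ?a y) (at 0)"
    by (rule LIM_zero_cancel)
  then show "isCont ?a y" unfolding isCont_def by (rule LIM_offset_zero_cancel)
qed

text \<open>The Taylor estimate, applied to the correlation with the remainder itself, bounds the square of the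
norm of the remainder by that norm times \<open>\<bar>t\<bar>\<close> times the modulus of continuity of the gradient under
translations.\<close>

lemma strong_gradient_of_stationary_gradient:
  assumes u: "u \<in> L2 P" and G: "stationary_gradient P u G"
  shows "strong_gradient u G"
proof (rule strong_gradientI)
  fix i :: 3 and e :: real assume "e > 0"
  have GL: "G \<in> L2 P" using G by (simp add: stationary_gradient_def)
  then have Gi: "(\<lambda>\<omega>. G \<omega> $ i) \<in> L2 P" by (rule L2_vec_nth)
  have "\<forall>\<^sub>F z in at 0. L2norm P (\<lambda>\<omega>. G (shift z \<omega>) $ i - G \<omega> $ i) < e"
    using order_tendstoD(2)[OF shift_continuous_L2[OF Gi] \<open>e > 0\<close>] .
  then obtain d where d: "d > 0" "\<And>z. z \<noteq> 0 \<Longrightarrow> dist z 0 < d \<Longrightarrow> L2norm P (\<lambda>\<omega>. G (shift z \<omega>) $ i - G \<omega> $ i) < e"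
    unfolding eventually_at by blast
  have "L2norm P (difference_remainder u G i t) \<le> e * \<bar>t\<bar>" if t: "\<bar>t\<bar> < d" for t
  proof -
    \<comment> \<open>The remainder is its own best test function.\<close>
    define h where "h = difference_remainder u G i t"
    have h: "h \<in> L2 P" unfolding h_def by (rule difference_remainder_L2[OF u GL])
    let ?a = "\<lambda>y. \<integral>\<omega>. u (shift y \<omega>) \<bullet> h \<omega> \<partial>P" and ?c = "\<lambda>y. \<integral>\<omega>. (G (shift y \<omega>) $ i) \<bullet> h \<omega> \<partial>P"
    have "\<bar>?a (t *\<^sub>R axis i 1) - ?a 0 - t * ?c 0\<bar> \<le> \<bar>t\<bar> * (e * L2norm P h)"
    proof (rule weak_derivative_Taylor_bound)
      show "continuous_on UNIV ?a" by (rule correlation_continuous[OF u h])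
      show "continuous_on UNIV ?c" by (rule correlation_continuous[OF Gi h])
      show "\<bar>?a y\<bar> \<le> L2norm P u * L2norm P h" for y by (rule correlation_bound[OF u h])
      show "(\<integral>y. ?a y * partial_deriv i \<psi> y \<partial>lborel) = - (\<integral>y. ?c y * \<psi> y \<partial>lborel)" if "test_function \<psi>" for \<psi>
        using G h that unfolding stationary_gradient_def by blast
      show "\<bar>?c (y + s *\<^sub>R axis i 1) - ?c y\<bar> \<le> e * L2norm P h" if s: "\<bar>s\<bar> \<le> \<bar>t\<bar>" for y s
      proof -
        have "L2norm P (\<lambda>\<omega>. G (shift (s *\<^sub>R axis i 1) \<omega>) $ i - G \<omega> $ i) \<le> e"
        proof (cases "s = 0")
          case True
          then show ?thesis using \<open>e > 0\<close> by (simp add: shift_0 L2norm_def)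
        next
          case False
          then show ?thesis using d(2)[of "s *\<^sub>R axis i 1"] s t
            by (simp add: axis_eq_0_iff norm_axis_1)
        qed
        then show ?thesis
          using correlation_diff_bound[OF Gi h, of y "s *\<^sub>R axis i 1"]
          by (meson L2norm_nonneg mult_right_mono order_trans)
      qed
    qed
    moreover have "?a (t *\<^sub>R axis i 1) - ?a 0 - t * ?c 0 = (L2norm P h)\<^sup>2"
    proof -
      have "?a (t *\<^sub>R axis i 1) - ?a 0 - t * ?c 0
        = (\<integral>\<omega>. u (shift (t *\<^sub>R axis i 1) \<omega>) \<bullet> h \<omega> - u \<omega> \<bullet> h \<omega> - t * ((G \<omega> $ i) \<bullet> h \<omega>) \<partial>P)"
        using L2_integrable_inner[OF L2_shift[OF u] h, of "t *\<^sub>R axis i 1"]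
          L2_integrable_inner[OF u h] L2_integrable_inner[OF Gi h]
        by (simp add: shift_0)
      also have "\<dots> = (\<integral>\<omega>. h \<omega> \<bullet> h \<omega> \<partial>P)"
        by (intro Bochner_Integration.integral_cong refl)
          (subst (4) h_def, simp add: difference_remainder_def inner_diff_left)
      finally show ?thesis by (simp add: L2norm_square_inner)
    qed
    ultimately have "L2norm P h * L2norm P h \<le> (e * \<bar>t\<bar>) * L2norm P h"
      by (simp add: power2_eq_square mult_ac)
    then have "L2norm P h \<le> e * \<bar>t\<bar>"
      using L2norm_nonneg[of P h] \<open>e > 0\<close> by (cases "L2norm P h = 0") (auto simp: mult_le_cancel_right)
    then show ?thesis by (simp add: h_def)
  qed
  then show "\<exists>d>0. \<forall>t. 0 < \<bar>t\<bar> \<and> \<bar>t\<bar> < d \<longrightarrow> L2norm P (difference_remainder u G i t) \<le> e * \<bar>t\<bar>"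
    using d(1) by blast
qed

lemma stationary_gradient_of_strong_gradient:
  assumes u: "u \<in> L2 P" and GL: "G \<in> L2 P" and G: "strong_gradient u G"
  shows "stationary_gradient P u G"
  unfolding stationary_gradient_def
proof (intro conjI allI ballI impI)
  fix i :: 3 and h :: "vec3 set \<Rightarrow> vec3" and \<psi> assume h: "h \<in> L2 P" and \<psi>: "test_function \<psi>"
  have Gi: "(\<lambda>\<omega>. G \<omega> $ i) \<in> L2 P" by (rule L2_vec_nth[OF GL])
  let ?a = "\<lambda>y. \<integral>\<omega>. u (shift y \<omega>) \<bullet> h \<omega> \<partial>P" and ?c = "\<lambda>y. \<integral>\<omega>. (G (shift y \<omega>) $ i) \<bullet> h \<omega> \<partial>P"
  show "(\<integral>y. ?a y * partial_deriv i \<psi> y \<partial>lborel) = - (\<integral>y. ?c y * \<psi> y \<partial>lborel)"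
  proof (rule weak_derivative_of_uniform_derivative[OF _ _ _ _ \<psi>])
    show "continuous_on UNIV ?a" by (rule correlation_continuous[OF u h])
    show "continuous_on UNIV ?c" by (rule correlation_continuous[OF Gi h])
    show "\<bar>?a y\<bar> \<le> L2norm P u * L2norm P h" for y by (rule correlation_bound[OF u h])
    fix e :: real assume "e > 0"
    define e' where "e' = e / (L2norm P h + 1)"
    have e': "e' > 0" "e' * L2norm P h \<le> e"
      using \<open>e > 0\<close> L2norm_nonneg[of P h] by (auto simp: e'_def field_simps)
    obtain d where d: "d > 0" "\<And>t. 0 < \<bar>t\<bar> \<Longrightarrow> \<bar>t\<bar> < d \<Longrightarrow> L2norm P (difference_remainder u G i t) \<le> e' * \<bar>t\<bar>"
      using strong_gradientD[OF G e'(1)] by metis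
    have "\<bar>?a (y + s *\<^sub>R axis i 1) - ?a y - s * ?c y\<bar> \<le> e * \<bar>s\<bar>" if s: "0 < \<bar>s\<bar>" "\<bar>s\<bar> < d" for s y
    proof -
      have "?a (y + s *\<^sub>R axis i 1) - ?a y - s * ?c y = (\<integral>\<omega>. difference_remainder u G i s (shift y \<omega>) \<bullet> h \<omega> \<partial>P)"
      proof -
        have "?a (y + s *\<^sub>R axis i 1) - ?a y - s * ?c y
          = (\<integral>\<omega>. u (shift (y + s *\<^sub>R axis i 1) \<omega>) \<bullet> h \<omega> - u (shift y \<omega>) \<bullet> h \<omega> - s * ((G (shift y \<omega>) $ i) \<bullet> h \<omega>) \<partial>P)"
          using L2_integrable_inner[OF L2_shift[OF u] h, of "y + s *\<^sub>R axis i 1"]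
            L2_integrable_inner[OF L2_shift[OF u] h, of y] L2_integrable_inner[OF L2_shift[OF Gi] h, of y]
          by simp
        also have "\<dots> = (\<integral>\<omega>. difference_remainder u G i s (shift y \<omega>) \<bullet> h \<omega> \<partial>P)"
          by (simp add: difference_remainder_def inner_diff_left shift_add add.commute[of _ y])
        finally show ?thesis .
      qed
      also have "\<bar>\<dots>\<bar> \<le> L2norm P (difference_remainder u G i s) * L2norm P h"
        by (rule correlation_bound[OF difference_remainder_L2[OF u GL] h])
      also have "\<dots> \<le> (e' * \<bar>s\<bar>) * L2norm P h"
        by (intro mult_right_mono d(2) s L2norm_nonneg)
      also have "\<dots> \<le> e * \<bar>s\<bar>"
        using mult_right_mono[OF e'(2), of "\<bar>s\<bar>"] by (simp add: mult_ac)
      finally show ?thesis .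
    qed
    then show "\<exists>d>0. \<forall>s y. 0 < \<bar>s\<bar> \<and> \<bar>s\<bar> < d \<longrightarrow> \<bar>?a (y + s *\<^sub>R axis i 1) - ?a y - s * ?c y\<bar> \<le> e * \<bar>s\<bar>"
      using d(1) by blast
  qed
qed (fact GL)

lemma stationary_gradient_L2: "stationary_gradient P u G \<Longrightarrow> G \<in> L2 P"
  by (simp add: stationary_gradient_def)

lemma stationary_gradient_lincomb:
  assumes u: "u \<in> L2 P" "stationary_gradient P u G" and v: "v \<in> L2 P" "stationary_gradient P v H"
  shows "stationary_gradient P (\<lambda>\<omega>. a *\<^sub>R u \<omega> + b *\<^sub>R v \<omega>) (\<lambda>\<omega>. a *\<^sub>R G \<omega> + b *\<^sub>R H \<omega>)"
proof (rule stationary_gradient_of_strong_gradient)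
  note GH = stationary_gradient_L2[OF u(2)] stationary_gradient_L2[OF v(2)]
  show "(\<lambda>\<omega>. a *\<^sub>R u \<omega> + b *\<^sub>R v \<omega>) \<in> L2 P" by (intro L2_add L2_scaleR u v)
  show "(\<lambda>\<omega>. a *\<^sub>R G \<omega> + b *\<^sub>R H \<omega>) \<in> L2 P" by (intro L2_add L2_scaleR GH)
  show "strong_gradient (\<lambda>\<omega>. a *\<^sub>R u \<omega> + b *\<^sub>R v \<omega>) (\<lambda>\<omega>. a *\<^sub>R G \<omega> + b *\<^sub>R H \<omega>)"
  proof (rule strong_gradientI)
    fix i :: 3 and e :: real assume "e > 0"
    define e' where "e' = e / (\<bar>a\<bar> + \<bar>b\<bar> + 1)"
    have e': "e' > 0" "(\<bar>a\<bar> + \<bar>b\<bar>) * e' \<le> e" using \<open>e > 0\<close> by (auto simp: e'_def field_simps)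
    obtain d1 where d1: "d1 > 0" "\<And>t. 0 < \<bar>t\<bar> \<Longrightarrow> \<bar>t\<bar> < d1 \<Longrightarrow> L2norm P (difference_remainder u G i t) \<le> e' * \<bar>t\<bar>"
      using strong_gradientD[OF strong_gradient_of_stationary_gradient[OF u] e'(1)] by metis
    obtain d2 where d2: "d2 > 0" "\<And>t. 0 < \<bar>t\<bar> \<Longrightarrow> \<bar>t\<bar> < d2 \<Longrightarrow> L2norm P (difference_remainder v H i t) \<le> e' * \<bar>t\<bar>"
      using strong_gradientD[OF strong_gradient_of_stationary_gradient[OF v] e'(1)] by metis
    have "L2norm P (difference_remainder (\<lambda>\<omega>. a *\<^sub>R u \<omega> + b *\<^sub>R v \<omega>) (\<lambda>\<omega>. a *\<^sub>R G \<omega> + b *\<^sub>R H \<omega>) i t) \<le> e * \<bar>t\<bar>"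
      if t: "0 < \<bar>t\<bar>" "\<bar>t\<bar> < min d1 d2" for t
    proof -
      have "difference_remainder (\<lambda>\<omega>. a *\<^sub>R u \<omega> + b *\<^sub>R v \<omega>) (\<lambda>\<omega>. a *\<^sub>R G \<omega> + b *\<^sub>R H \<omega>) i t
        = (\<lambda>\<omega>. a *\<^sub>R difference_remainder u G i t \<omega> + b *\<^sub>R difference_remainder v H i t \<omega>)"
        by (simp add: difference_remainder_def fun_eq_iff algebra_simps)
      then have "L2norm P (difference_remainder (\<lambda>\<omega>. a *\<^sub>R u \<omega> + b *\<^sub>R v \<omega>) (\<lambda>\<omega>. a *\<^sub>R G \<omega> + b *\<^sub>R H \<omega>) i t)
        \<le> L2norm P (\<lambda>\<omega>. a *\<^sub>R difference_remainder u G i t \<omega>) + L2norm P (\<lambda>\<omega>. b *\<^sub>R difference_remainder v H i t \<omega>)"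
        by (simp only:) (intro L2norm_triangle L2_scaleR difference_remainder_L2 u v GH)
      also have "\<dots> \<le> \<bar>a\<bar> * (e' * \<bar>t\<bar>) + \<bar>b\<bar> * (e' * \<bar>t\<bar>)"
        unfolding L2norm_scaleR using t by (intro add_mono mult_left_mono d1 d2) auto
      also have "\<dots> \<le> e * \<bar>t\<bar>"
        using mult_right_mono[OF e'(2), of "\<bar>t\<bar>"] by (simp add: algebra_simps)
      finally show ?thesis .
    qed
    then show "\<exists>d>0. \<forall>t. 0 < \<bar>t\<bar> \<and> \<bar>t\<bar> < d \<longrightarrow>
        L2norm P (difference_remainder (\<lambda>\<omega>. a *\<^sub>R u \<omega> + b *\<^sub>R v \<omega>) (\<lambda>\<omega>. a *\<^sub>R G \<omega> + b *\<^sub>R H \<omega>) i t) \<le> e * \<bar>t\<bar>"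
      using d1(1) d2(1) by (intro exI[of _ "min d1 d2"]) auto
  qed
qed

text \<open>For a field that vanishes almost everywhere the remainder is \<open>- t\<close> times the gradient.\<close>

lemma stationary_gradient_zero_AE:
  assumes "stationary_gradient P u G" "u \<in> L2 P" "AE \<omega> in P. u \<omega> = 0"
  shows "AE \<omega> in P. G \<omega> = 0"
proof -
  have GL: "G \<in> L2 P" by (rule stationary_gradient_L2[OF assms(1)])
  have "AE \<omega> in P. G \<omega> $ i = 0" for i
  proof (rule L2norm_eq_0[OF L2_vec_nth[OF GL]], rule field_le_epsilon[THEN antisym])
    fix e :: real assume "e > 0"
    obtain d where d: "d > 0" "\<And>t. 0 < \<bar>t\<bar> \<Longrightarrow> \<bar>t\<bar> < d \<Longrightarrow> L2norm P (difference_remainder u G i t) \<le> e * \<bar>t\<bar>"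
      using strong_gradientD[OF strong_gradient_of_stationary_gradient[OF assms(2,1)] \<open>e > 0\<close>] by metis
    define t where "t = d / 2"
    have t: "0 < t" "t < d" using d(1) by (auto simp: t_def)
    have "L2norm P (difference_remainder u G i t) = L2norm P (\<lambda>\<omega>. (- t) *\<^sub>R (G \<omega> $ i))"
    proof (rule L2norm_cong_AE)
      show "difference_remainder u G i t \<in> borel_measurable P"
        by (rule L2_measurable[OF difference_remainder_L2[OF assms(2) GL]])
      show "(\<lambda>\<omega>. (- t) *\<^sub>R (G \<omega> $ i)) \<in> borel_measurable P"
        by (rule L2_measurable[OF L2_scaleR[OF L2_vec_nth[OF GL]]])
      show "AE \<omega> in P. difference_remainder u G i t \<omega> = (- t) *\<^sub>R (G \<omega> $ i)"
        using assms(3) AE_shift[OF assms(3), of "t *\<^sub>R axis i 1"]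
        by eventually_elim (simp add: difference_remainder_def)
    qed
    also have "\<dots> = t * L2norm P (\<lambda>\<omega>. G \<omega> $ i)" unfolding L2norm_scaleR using t by simp
    finally have "t * L2norm P (\<lambda>\<omega>. G \<omega> $ i) \<le> t * e" using d(2)[of t] t by (simp add: mult.commute)
    then show "L2norm P (\<lambda>\<omega>. G \<omega> $ i) \<le> 0 + e" using t(1) by simp
  qed (rule L2norm_nonneg)
  then have "AE \<omega> in P. \<forall>i. G \<omega> $ i = 0" by (simp add: AE_all_countable)
  then show ?thesis by (simp add: vec_eq_iff)
qed

lemma stationary_gradient_unique:
  assumes "u \<in> L2 P" "stationary_gradient P u G" "stationary_gradient P v H" "v \<in> L2 P" "AE \<omega> in P. u \<omega> = v \<omega>"
  shows "AE \<omega> in P. G \<omega> = H \<omega>"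
proof -
  have "AE \<omega> in P. 1 *\<^sub>R G \<omega> + (- 1) *\<^sub>R H \<omega> = 0"
  proof (rule stationary_gradient_zero_AE)
    show "stationary_gradient P (\<lambda>\<omega>. 1 *\<^sub>R u \<omega> + (- 1) *\<^sub>R v \<omega>) (\<lambda>\<omega>. 1 *\<^sub>R G \<omega> + (- 1) *\<^sub>R H \<omega>)"
      by (intro stationary_gradient_lincomb assms)
    show "(\<lambda>\<omega>. 1 *\<^sub>R u \<omega> + (- 1) *\<^sub>R v \<omega>) \<in> L2 P" by (intro L2_add L2_scaleR assms)
    show "AE \<omega> in P. 1 *\<^sub>R u \<omega> + (- 1) *\<^sub>R v \<omega> = 0" using assms(5) by (auto elim: eventually_mono)
  qed
  then show ?thesis by (auto elim: eventually_mono)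
qed

lemma stat_grad_stationary_gradient: "u \<in> H1 P \<Longrightarrow> stationary_gradient P u (stat_grad P u)"
  using someI_ex[of "stationary_gradient P u"] by (auto simp: H1_def stat_grad_def)

lemma elastic_form_eq:
  assumes "u \<in> L2 P" "stationary_gradient P u G" "v \<in> L2 P" "stationary_gradient P v H"
  shows "elastic_form P C u v = (\<integral>\<omega>. tensor_apply C (G \<omega>) \<bullet> H \<omega> \<partial>P)"
proof -
  have "u \<in> H1 P" "v \<in> H1 P" using assms by (auto simp: H1_def)
  note g = stat_grad_stationary_gradient[OF this(1)] stat_grad_stationary_gradient[OF this(2)]
  note meas [measurable] = L2_measurable[OF stationary_gradient_L2[OF g(1)]]
    L2_measurable[OF stationary_gradient_L2[OF g(2)]]
    L2_measurable[OF stationary_gradient_L2[OF assms(2)]] L2_measurable[OF stationary_gradient_L2[OF assms(4)]]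
  have "AE \<omega> in P. stat_grad P u \<omega> = G \<omega>" "AE \<omega> in P. stat_grad P v \<omega> = H \<omega>"
    by (rule stationary_gradient_unique[of u _ u] stationary_gradient_unique[of v _ v]; simp add: assms g)+
  then have "AE \<omega> in P. tensor_apply C (stat_grad P u \<omega>) \<bullet> stat_grad P v \<omega> = tensor_apply C (G \<omega>) \<bullet> H \<omega>"
    by eventually_elim simp
  then show ?thesis unfolding elastic_form_def by (intro integral_cong_AE) auto
qed

end

section \<open>Conditional expectation given the inclusion at the origin\<close>

text \<open>The Doob-Dynkin factorization: level sets of simple functions are preimages under \<open>X\<close>, and the
factorization survives pointwise limits.\<close>

lemma factor_through_vimage_algebra:
  fixes f :: "'a \<Rightarrow> real"
  assumes X: "X \<in> \<Omega> \<rightarrow> space N" and f: "f \<in> borel_measurable (vimage_algebra \<Omega> X N)"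
  obtains F where "F \<in> borel_measurable N" "\<And>\<omega>. \<omega> \<in> \<Omega> \<Longrightarrow> F (X \<omega>) = f \<omega>"
proof -
  let ?V = "vimage_algebra \<Omega> X N"
  obtain s where s: "\<And>i. simple_function ?V (s i)" "\<And>\<omega>. \<omega> \<in> \<Omega> \<Longrightarrow> (\<lambda>i. s i \<omega>) \<longlonglongrightarrow> f \<omega>"
    using borel_measurable_implies_sequence_metric[OF f, of 0] by (auto simp: space_vimage_algebra)
  have "\<exists>B\<in>sets N. s i -` {z} \<inter> \<Omega> = X -` B \<inter> \<Omega>" for i z
    using simple_functionD(2)[OF s(1), of i "{z}"] sets_vimage_algebra2[OF X] by auto
  then obtain B where B: "\<And>i z. B i z \<in> sets N" "\<And>i z. s i -` {z} \<inter> \<Omega> = X -` B i z \<inter> \<Omega>"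
    by metis
  note [measurable] = B(1)
  define S where "S i x = (\<Sum>z\<in>s i ` \<Omega>. z * indicator (B i z) x)" for i x
  have S_meas [measurable]: "S i \<in> borel_measurable N" for i unfolding S_def by measurable
  have S_X: "S i (X \<omega>) = s i \<omega>" if "\<omega> \<in> \<Omega>" for i \<omega>
  proof -
    have fin: "finite (s i ` \<Omega>)" using simple_functionD(1)[OF s(1), of i] by simp
    have "S i (X \<omega>) = (\<Sum>z\<in>s i ` \<Omega>. if z = s i \<omega> then z else 0)"
      unfolding S_def
    proof (rule sum.cong[OF refl])
      fix z
      have "X \<omega> \<in> B i z \<longleftrightarrow> s i \<omega> = z" using B(2)[of i z] that by blast
      then show "z * indicator (B i z) (X \<omega>) = (if z = s i \<omega> then z else 0)"
        by (auto simp: indicator_def)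
    qed
    also have "\<dots> = s i \<omega>" using fin that by simp
    finally show ?thesis .
  qed
  show ?thesis
  proof (rule that)
    show "(\<lambda>x. lim (\<lambda>i. S i x)) \<in> borel_measurable N" by measurable
    show "lim (\<lambda>i. S i (X \<omega>)) = f \<omega>" if "\<omega> \<in> \<Omega>" for \<omega>
      using s(2)[OF that] S_X[OF that] by (simp add: limI)
  qed
qed

text \<open>Square integrability is Jensen's inequality for the square.\<close>

lemma conditional_expectation_given_map_real:
  fixes f :: "'a \<Rightarrow> real"
    and X :: "'a \<Rightarrow> 'c"
  assumes M: "finite_measure M" and X: "X \<in> M \<rightarrow>\<^sub>M N" and f: "f \<in> L2 M"
  obtains F where "F \<in> borel_measurable N" "(\<lambda>\<omega>. F (X \<omega>)) \<in> L2 M"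
    "\<And>K. K \<in> borel_measurable N \<Longrightarrow> (\<lambda>\<omega>. K (X \<omega>)) \<in> L2 M \<Longrightarrow>
      (\<integral>\<omega>. K (X \<omega>) * f \<omega> \<partial>M) = (\<integral>\<omega>. K (X \<omega>) * F (X \<omega>) \<partial>M)"
proof -
  note [measurable] = X L2_measurable[OF f]
  let ?V = "vimage_algebra (space M) X N"
  have XS: "X \<in> space M \<rightarrow> space N" using measurable_space[OF X] by blast
  interpret finite_measure M by (rule M)
  interpret finite_measure_subalgebra M ?V
  proof
    show "subalgebra M ?V"
      using XS X by (auto simp: subalgebra_def sets_vimage_algebra2 dest: measurable_sets)
  qed
  obtain F where F [measurable]: "F \<in> borel_measurable N" and FX: "\<And>\<omega>. \<omega> \<in> space M \<Longrightarrow> F (X \<omega>) = real_cond_exp M ?V f \<omega>"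
    using factor_through_vimage_algebra[OF XS borel_measurable_cond_exp] by metis
  have f_int: "integrable M f" by (rule L2_integrable[OF M f])
  have f2: "integrable M (\<lambda>\<omega>. (f \<omega>)\<^sup>2)" using L2_integrable_square[OF f] by simp
  have jensen: "AE \<omega> in M. (real_cond_exp M ?V f \<omega>)\<^sup>2 \<le> real_cond_exp M ?V (\<lambda>\<omega>. (f \<omega>)\<^sup>2) \<omega>"
    by (rule real_cond_exp_jensens_inequality(2)[where I=UNIV and q="\<lambda>x. x\<^sup>2"]) (auto simp: f_int f2 convex_power2)
  have int2: "integrable M (\<lambda>\<omega>. real_cond_exp M ?V (\<lambda>\<omega>. (f \<omega>)\<^sup>2) \<omega>)"
    using real_cond_exp_int(1)[OF f2] .
  have F2: "(\<lambda>\<omega>. F (X \<omega>)) \<in> L2 M"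
  proof (rule L2_I)
    show "(\<lambda>\<omega>. F (X \<omega>)) \<in> borel_measurable M" by measurable
    show "integrable M (\<lambda>\<omega>. (norm (F (X \<omega>)))\<^sup>2)"
    proof (rule Bochner_Integration.integrable_bound[OF int2])
      show "AE \<omega> in M. norm ((norm (F (X \<omega>)))\<^sup>2) \<le> norm (real_cond_exp M ?V (\<lambda>\<omega>. (f \<omega>)\<^sup>2) \<omega>)"
        using jensen by (rule AE_mp) (auto simp: FX)
    qed measurable
  qed
  show ?thesis
  proof (rule that[OF F F2])
    fix K :: "'c \<Rightarrow> real" assume K [measurable]: "K \<in> borel_measurable N" and K2: "(\<lambda>\<omega>. K (X \<omega>)) \<in> L2 M"
    have "(\<lambda>\<omega>. K (X \<omega>)) \<in> borel_measurable ?V"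
      by (rule measurable_compose[OF measurable_vimage_algebra1[OF XS] K])
    moreover have "integrable M (\<lambda>\<omega>. K (X \<omega>) * f \<omega>)"
      using L2_integrable_inner[OF K2 f] by simp
    ultimately have "(\<integral>\<omega>. K (X \<omega>) * real_cond_exp M ?V f \<omega> \<partial>M) = (\<integral>\<omega>. K (X \<omega>) * f \<omega> \<partial>M)"
      by (intro real_cond_exp_intg(2)) auto
    also have "(\<integral>\<omega>. K (X \<omega>) * real_cond_exp M ?V f \<omega> \<partial>M) = (\<integral>\<omega>. K (X \<omega>) * F (X \<omega>) \<partial>M)"
      by (rule Bochner_Integration.integral_cong) (auto simp: FX)
    finally show "(\<integral>\<omega>. K (X \<omega>) * f \<omega> \<partial>M) = (\<integral>\<omega>. K (X \<omega>) * F (X \<omega>) \<partial>M)" by simp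
  qed
qed

lemma conditional_expectation_given_map:
  fixes f :: "'a \<Rightarrow> 'b::euclidean_space"
    and X :: "'a \<Rightarrow> 'c"
  assumes M: "finite_measure M" and X: "X \<in> M \<rightarrow>\<^sub>M N" and f: "f \<in> L2 M"
  obtains F where "F \<in> borel_measurable N" "(\<lambda>\<omega>. F (X \<omega>)) \<in> L2 M"
    "\<And>K. K \<in> borel_measurable N \<Longrightarrow> (\<lambda>\<omega>. K (X \<omega>)) \<in> L2 M \<Longrightarrow>
      (\<integral>\<omega>. K (X \<omega>) \<bullet> f \<omega> \<partial>M) = (\<integral>\<omega>. K (X \<omega>) \<bullet> F (X \<omega>) \<partial>M)"
proof -
  have comp: "(\<lambda>\<omega>. h \<omega> \<bullet> b) \<in> L2 M" if "h \<in> L2 M" for h :: "'a \<Rightarrow> 'b" and b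
    by (rule L2_linear_image[OF _ that]) (auto intro: linearI simp: inner_add_left)
  have "\<exists>F :: 'c \<Rightarrow> real. F \<in> borel_measurable N \<and> (\<lambda>\<omega>. F (X \<omega>)) \<in> L2 M \<and>
    (\<forall>K :: 'c \<Rightarrow> real. K \<in> borel_measurable N \<longrightarrow> (\<lambda>\<omega>. K (X \<omega>)) \<in> L2 M \<longrightarrow>
      (\<integral>\<omega>. K (X \<omega>) * (f \<omega> \<bullet> b) \<partial>M) = (\<integral>\<omega>. K (X \<omega>) * F (X \<omega>) \<partial>M))" for b
    by (rule conditional_expectation_given_map_real[OF M X comp[OF f, of b]]) (intro exI conjI allI impI)
  from choice[OF allI[OF this]] obtain F :: "'b \<Rightarrow> 'c \<Rightarrow> real" where F: "\<And>b. F b \<in> borel_measurable N" "\<And>b. (\<lambda>\<omega>. F b (X \<omega>)) \<in> L2 M"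
    "\<And>b (K :: 'c \<Rightarrow> real). K \<in> borel_measurable N \<Longrightarrow> (\<lambda>\<omega>. K (X \<omega>)) \<in> L2 M \<Longrightarrow>
      (\<integral>\<omega>. K (X \<omega>) * (f \<omega> \<bullet> b) \<partial>M) = (\<integral>\<omega>. K (X \<omega>) * F b (X \<omega>) \<partial>M)" by iprover
  define G where "G x = (\<Sum>b\<in>Basis. F b x *\<^sub>R b)" for x
  have G_inner: "G x \<bullet> b = F b x" if "b \<in> Basis" for x b
    using that by (simp add: G_def inner_sum_left_Basis)
  show ?thesis
  proof (rule that[of G])
    show "G \<in> borel_measurable N" unfolding G_def using F(1) by measurable
    have "finite A \<Longrightarrow> (\<lambda>\<omega>. \<Sum>b\<in>A. F b (X \<omega>) *\<^sub>R b) \<in> L2 M" for A :: "'b set"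
    proof (induction A rule: finite_induct)
      case empty
      show ?case using L2_const[OF M, of 0] by simp
    next
      case (insert b A)
      have "(\<lambda>\<omega>. F b (X \<omega>) *\<^sub>R b) \<in> L2 M"
        by (rule L2_linear_image[OF _ F(2)]) (auto intro: linearI simp: algebra_simps)
      then show ?case using insert by (simp add: L2_add)
    qed
    then show G2: "(\<lambda>\<omega>. G (X \<omega>)) \<in> L2 M" unfolding G_def by simp
    fix K :: "'c \<Rightarrow> 'b" assume K [measurable]: "K \<in> borel_measurable N" and K2: "(\<lambda>\<omega>. K (X \<omega>)) \<in> L2 M"
    have eq: "(\<integral>\<omega>. K (X \<omega>) \<bullet> h \<omega> \<partial>M) = (\<Sum>b\<in>Basis. \<integral>\<omega>. (K (X \<omega>) \<bullet> b) * (h \<omega> \<bullet> b) \<partial>M)"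
      if "h \<in> L2 M" for h
    proof -
      have "integrable M (\<lambda>\<omega>. (K (X \<omega>) \<bullet> b) * (h \<omega> \<bullet> b))" for b
        using L2_integrable_inner[OF comp[OF K2, of b] comp[OF that, of b]] by simp
      then show ?thesis
        by (subst euclidean_inner) (simp add: Bochner_Integration.integral_sum)
    qed
    show "(\<integral>\<omega>. K (X \<omega>) \<bullet> f \<omega> \<partial>M) = (\<integral>\<omega>. K (X \<omega>) \<bullet> G (X \<omega>) \<partial>M)"
      unfolding eq[OF f] eq[OF G2]
    proof (rule sum.cong[OF refl])
      fix b :: 'b assume b: "b \<in> Basis"
      show "(\<integral>\<omega>. (K (X \<omega>) \<bullet> b) * (f \<omega> \<bullet> b) \<partial>M) = (\<integral>\<omega>. (K (X \<omega>) \<bullet> b) * (G (X \<omega>) \<bullet> b) \<partial>M)"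
        unfolding G_inner[OF b] by (rule F(3)) (use comp[OF K2] in auto)
    qed
  qed
qed

text \<open>The hypothesis holds when \<open>f\<close> is the orthogonal projection of \<open>g\<close>.\<close>

lemma L2norm_le_of_inner:
  assumes "f \<in> L2 M" "g \<in> L2 M" "(\<integral>x. f x \<bullet> f x \<partial>M) = (\<integral>x. f x \<bullet> g x \<partial>M)"
  shows "L2norm M f \<le> L2norm M g"
proof -
  have "L2norm M f * L2norm M f \<le> L2norm M f * L2norm M g"
    using L2norm_Cauchy_Schwarz[OF assms(1,2)] assms(3) L2norm_square_inner[of M f]
    by (simp add: power2_eq_square)
  then show ?thesis
    using L2norm_nonneg[of M f] L2norm_nonneg[of M g] by (cases "L2norm M f = 0") (auto simp: mult_le_cancel_left)
qed

locale measurable_origin_inclusion = stationary_inclusions +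
  assumes origin_inclusion_measurable: "origin_inclusion \<in> P \<rightarrow>\<^sub>M hausdorff_borel"
begin

abbreviation X :: "vec3 set \<Rightarrow> vec3 set" where "X \<equiv> origin_inclusion"

abbreviation at_X :: "(vec3 set \<Rightarrow> 'b) \<Rightarrow> vec3 set \<Rightarrow> 'b" where
  "at_X F \<equiv> \<lambda>\<omega>. F (X \<omega>)"

lemma X_regular_open: "\<omega> \<in> space P \<Longrightarrow> interior (closure (X \<omega>)) = X \<omega>"
  using origin_inclusion_regular_open[OF geometry] by (simp add: space_P regular_open_def)

lemma X_subset_cube: "\<omega> \<in> space P \<Longrightarrow> X \<omega> \<in> Pow cube"
  using measurable_space[OF origin_inclusion_measurable] by (simp only: space_hausdorff_borel)

lemma X_measurable [measurable]: "X \<in> P \<rightarrow>\<^sub>M points_sigma"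
  by (rule measurable_cong[THEN iffD1, OF X_regular_open
        measurable_compose[OF origin_inclusion_measurable measurable_interior_closure]])

lemma zero_in_X_iff: "0 \<in> X \<omega> \<longleftrightarrow> 0 \<in> \<omega>"
  by (rule origin_in_origin_inclusion)

lemma shift_points_measurable [measurable]: "shift y \<in> points_sigma \<rightarrow>\<^sub>M points_sigma"
  by (rule measurable_points_sigmaI) (simp add: mem_shift_iff)

text \<open>The translations that are too short to reach another inclusion, in either direction along the
line through the origin.\<close>

definition near :: "vec3 \<Rightarrow> bool" where
  "near y \<longleftrightarrow> (\<forall>\<omega>\<in>space P. 0 \<in> \<omega> \<longrightarrow> (y \<in> X \<omega> \<longleftrightarrow> y \<in> \<omega>) \<and> (- y \<in> X \<omega> \<longleftrightarrow> - y \<in> \<omega>))"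

lemma near_origin: obtains \<tau> where "\<tau> > 0" "\<And>y. norm y < \<tau> \<Longrightarrow> near y"
proof -
  obtain \<tau> where "\<tau> > 0"
    "\<And>\<omega> y. \<omega> \<in> \<Omega> \<Longrightarrow> norm y < \<tau> \<Longrightarrow> 0 \<in> \<omega> \<Longrightarrow> y \<in> origin_inclusion \<omega> \<longleftrightarrow> y \<in> \<omega>"
    using near_origin_in_origin_inclusion[OF geometry] by metis
  then show ?thesis using that[of \<tau>] by (simp add: near_def space_P)
qed

text \<open>Vanishing outside the inclusions, tested at the origin only; see \<open>vanishes_outside_iff\<close>.\<close>

definition supported :: "(vec3 set \<Rightarrow> 'b::zero) \<Rightarrow> bool" where
  "supported f \<longleftrightarrow> (AE \<omega> in P. 0 \<notin> \<omega> \<longrightarrow> f \<omega> = 0)"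

lemma supported_profile: "F {} = 0 \<Longrightarrow> supported (at_X F)"
  unfolding supported_def by (rule AE_I2) (auto simp: origin_inclusion_empty)

text \<open>A random variable is replaced by the function of the inclusion at the origin closest to it. When
it vanishes outside the inclusions, so does its projection, and the value at the empty set can be
taken to be zero.\<close>

lemma condexp_X:
  fixes f :: "vec3 set \<Rightarrow> 'b::euclidean_space"
  assumes f: "f \<in> L2 P" "supported f"
  obtains F where "F \<in> borel_measurable points_sigma" "F {} = 0" "(at_X F) \<in> L2 P"
    "\<And>K. K \<in> borel_measurable points_sigma \<Longrightarrow> (at_X K) \<in> L2 P \<Longrightarrow>
      (\<integral>\<omega>. K (X \<omega>) \<bullet> f \<omega> \<partial>P) = (\<integral>\<omega>. K (X \<omega>) \<bullet> F (X \<omega>) \<partial>P)"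
proof -
  obtain F where F: "F \<in> borel_measurable points_sigma" "(at_X F) \<in> L2 P"
    "\<And>K. K \<in> borel_measurable points_sigma \<Longrightarrow> (at_X K) \<in> L2 P \<Longrightarrow>
      (\<integral>\<omega>. K (X \<omega>) \<bullet> f \<omega> \<partial>P) = (\<integral>\<omega>. K (X \<omega>) \<bullet> F (X \<omega>) \<partial>P)"
    by (rule conditional_expectation_given_map[OF finite_measure_P X_measurable f(1)]) (rule that, assumption, assumption, blast)
  define F' where "F' A = (if 0 \<in> A then F A else 0)" for A
  note [measurable] = F(1) L2_measurable[OF f(1)]
  have F'_meas [measurable]: "F' \<in> borel_measurable points_sigma" unfolding F'_def by measurable
  show ?thesis
  proof (rule that[OF F'_meas])
    show "F' {} = 0" by (simp add: F'_def)
    show "(at_X F') \<in> L2 P"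
      unfolding F'_def by (rule L2_restrict[OF F(2)]) measurable
    fix K :: "vec3 set \<Rightarrow> 'b" assume K [measurable]: "K \<in> borel_measurable points_sigma" and K2: "(at_X K) \<in> L2 P"
    define K' where "K' A = (if 0 \<in> A then K A else 0)" for A
    have K'_meas [measurable]: "K' \<in> borel_measurable points_sigma" unfolding K'_def by measurable
    have "(at_X K') \<in> L2 P"
      unfolding K'_def by (rule L2_restrict[OF K2]) measurable
    from F(3)[OF K'_meas this]
    have "(\<integral>\<omega>. K' (X \<omega>) \<bullet> f \<omega> \<partial>P) = (\<integral>\<omega>. K' (X \<omega>) \<bullet> F (X \<omega>) \<partial>P)" .
    also have "\<dots> = (\<integral>\<omega>. K (X \<omega>) \<bullet> F' (X \<omega>) \<partial>P)"
      by (intro Bochner_Integration.integral_cong) (auto simp: K'_def F'_def)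
    also have "(\<integral>\<omega>. K' (X \<omega>) \<bullet> f \<omega> \<partial>P) = (\<integral>\<omega>. K (X \<omega>) \<bullet> f \<omega> \<partial>P)"
    proof (rule integral_cong_AE)
      show "AE \<omega> in P. K' (X \<omega>) \<bullet> f \<omega> = K (X \<omega>) \<bullet> f \<omega>"
        using f(2) unfolding supported_def
        by eventually_elim (auto simp: K'_def zero_in_X_iff)
    qed measurable
    finally show "(\<integral>\<omega>. K (X \<omega>) \<bullet> f \<omega> \<partial>P) = (\<integral>\<omega>. K (X \<omega>) \<bullet> F' (X \<omega>) \<partial>P)" .
  qed
qed

end

section \<open>Averaging preserves gradients\<close>

context measurable_origin_inclusion begin

definition inner_remainder ::
  "(vec3 set \<Rightarrow> vec3) \<Rightarrow> (vec3 set \<Rightarrow> mat3) \<Rightarrow> 3 \<Rightarrow> real \<Rightarrow> vec3 set \<Rightarrow> vec3" where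
  "inner_remainder u G i t \<omega> = (if 0 \<in> \<omega> then difference_remainder u G i t \<omega> else 0)"

text \<open>The part of a field that a translation by \<open>y\<close> carries out of the inclusions.\<close>

definition leak :: "(vec3 set \<Rightarrow> vec3) \<Rightarrow> vec3 \<Rightarrow> vec3 set \<Rightarrow> vec3" where
  "leak u y \<omega> = (if - y \<in> X \<omega> then 0 else u \<omega>)"

lemma inner_remainder_L2: "u \<in> L2 P \<Longrightarrow> G \<in> L2 P \<Longrightarrow> inner_remainder u G i t \<in> L2 P"
  unfolding inner_remainder_def[abs_def] by (intro L2_restrict difference_remainder_L2) auto

lemma leak_L2: assumes "u \<in> L2 P" shows "leak u y \<in> L2 P"
proof -
  have "Measurable.pred P (\<lambda>\<omega>. - y \<notin> X \<omega>)" by measurable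
  from L2_restrict[OF assms this] have "(\<lambda>\<omega>. if - y \<notin> X \<omega> then u \<omega> else 0) \<in> L2 P" .
  moreover have "(\<lambda>\<omega>. if - y \<notin> X \<omega> then u \<omega> else 0) = leak u y"
    by (auto simp: leak_def fun_eq_iff)
  ultimately show ?thesis by simp
qed

text \<open>Off the inclusions, the increment is the field itself seen at the translated origin, and
stationarity moves it back; what is left there is the leak. Both terms on the right live
on configurations with the origin in an inclusion, whereas the increment as such also sees those in
which the translation enters an inclusion from outside.\<close>

lemma difference_remainder_decomposition:
  assumes u: "u \<in> L2 P" "supported u" and G: "G \<in> L2 P" "supported G" and near: "near (t *\<^sub>R axis i 1)"
  shows "(L2norm P (difference_remainder u G i t))\<^sup>2
    = (L2norm P (inner_remainder u G i t))\<^sup>2 + (L2norm P (leak u (t *\<^sub>R axis i 1)))\<^sup>2"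
proof -
  let ?y = "t *\<^sub>R axis i 1 :: vec3"
  define h where "h \<omega> = (if - ?y \<notin> \<omega> then u \<omega> else 0)" for \<omega>
  have h: "h \<in> L2 P" unfolding h_def by (intro L2_restrict u) measurable
  have D: "difference_remainder u G i t \<in> L2 P" by (rule difference_remainder_L2[OF u(1) G(1)])
  note [measurable] = L2_measurable[OF D] L2_measurable[OF h] L2_measurable[OF leak_L2[OF u(1)]]
  have "L2norm P (\<lambda>\<omega>. if 0 \<in> \<omega> then 0 else difference_remainder u G i t \<omega>) = L2norm P (\<lambda>\<omega>. h (shift ?y \<omega>))"
  proof (rule L2norm_cong_AE)
    show "AE \<omega> in P. (if 0 \<in> \<omega> then 0 else difference_remainder u G i t \<omega>) = h (shift ?y \<omega>)"
      using u(2) G(2) unfolding supported_def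
      by eventually_elim (auto simp: h_def mem_shift_iff difference_remainder_def)
  qed measurable
  also have "\<dots> = L2norm P h" by (rule L2norm_shift[OF h])
  also have "\<dots> = L2norm P (leak u ?y)"
  proof (rule L2norm_cong_AE)
    show "AE \<omega> in P. h \<omega> = leak u ?y \<omega>"
      using u(2)[unfolded supported_def] AE_space
    proof eventually_elim
      case (elim \<omega>)
      then show ?case using near by (cases "0 \<in> \<omega>") (auto simp: h_def leak_def near_def)
    qed
  qed measurable
  finally show ?thesis
    using L2norm_split[OF D, of "\<lambda>\<omega>. 0 \<in> \<omega>"] by (simp add: inner_remainder_def[abs_def])
qed

text \<open>\<open>F\<close> represents the conditional expectation of \<open>f\<close> given the inclusion at the origin.\<close>

definition is_condexp :: "(vec3 set \<Rightarrow> 'b::euclidean_space) \<Rightarrow> (vec3 set \<Rightarrow> 'b) \<Rightarrow> bool" where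
  "is_condexp f F \<longleftrightarrow> F \<in> borel_measurable points_sigma \<and> F {} = 0 \<and> (at_X F) \<in> L2 P \<and>
    (\<forall>K\<in>borel_measurable points_sigma. (at_X K) \<in> L2 P \<longrightarrow>
      (\<integral>\<omega>. K (X \<omega>) \<bullet> f \<omega> \<partial>P) = (\<integral>\<omega>. K (X \<omega>) \<bullet> F (X \<omega>) \<partial>P))"

lemma is_condexpD:
  assumes "is_condexp f F"
  shows "F \<in> borel_measurable points_sigma" "F {} = 0" "(at_X F) \<in> L2 P"
    "K \<in> borel_measurable points_sigma \<Longrightarrow> (at_X K) \<in> L2 P \<Longrightarrow>
      (\<integral>\<omega>. K (X \<omega>) \<bullet> f \<omega> \<partial>P) = (\<integral>\<omega>. K (X \<omega>) \<bullet> F (X \<omega>) \<partial>P)"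
  using assms unfolding is_condexp_def by blast+

lemma is_condexp_exists:
  assumes "f \<in> L2 P" "supported f" obtains F where "is_condexp f F"
  by (rule condexp_X[OF assms]) (rule that, unfold is_condexp_def, intro conjI ballI impI)

text \<open>The adjoint of translating inside the inclusion at the origin, on the level of functions of that
inclusion.\<close>

definition pull :: "vec3 \<Rightarrow> (vec3 set \<Rightarrow> vec3) \<Rightarrow> vec3 set \<Rightarrow> vec3" where
  "pull y K A = (if 0 \<in> A \<and> - y \<in> A then K (shift (- y) A) else 0)"

lemma pull_measurable [measurable]:
  assumes [measurable]: "K \<in> borel_measurable points_sigma"
  shows "pull y K \<in> borel_measurable points_sigma"
  unfolding pull_def[abs_def] by measurable

lemma X_shift: "y \<in> X \<omega> \<Longrightarrow> X (shift y \<omega>) = shift y (X \<omega>)"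
  by (rule origin_inclusion_shift)

lemma pull_L2:
  assumes K [measurable]: "K \<in> borel_measurable points_sigma" and K2: "(at_X K) \<in> L2 P"
  shows "(\<lambda>\<omega>. pull y K (X \<omega>)) \<in> L2 P"
proof (rule L2_dominated[OF L2_shift[OF K2, of "- y"], where c=1])
  show "AE \<omega> in P. norm (pull y K (X \<omega>)) \<le> 1 * norm (K (X (shift (- y) \<omega>)))"
    by (rule AE_I2) (auto simp: pull_def X_shift)
qed measurable

text \<open>When both \<open>0\<close> and \<open>y\<close> lie in the same inclusion, the inclusion seen from \<open>0\<close> and the one seen from
\<open>y\<close> carry the same information. Hence testing the translated field with functions of the inclusion
at the origin is the same as testing the field itself.\<close>

lemma integral_shift_inside:
  assumes K [measurable]: "K \<in> borel_measurable points_sigma"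
    and u: "u \<in> L2 P" "supported u" and near: "near y"
  shows "(\<integral>\<omega>. K (X \<omega>) \<bullet> (if 0 \<in> \<omega> then u (shift y \<omega>) else 0) \<partial>P) = (\<integral>\<omega>. pull y K (X \<omega>) \<bullet> u \<omega> \<partial>P)"
proof -
  note [measurable] = L2_measurable[OF u(1)]
  have "(\<integral>\<omega>. K (X \<omega>) \<bullet> (if 0 \<in> \<omega> then u (shift y \<omega>) else 0) \<partial>P)
      = (\<integral>\<omega>. pull y K (X (shift y \<omega>)) \<bullet> u (shift y \<omega>) \<partial>P)"
  proof (rule integral_cong_AE)
    show "AE \<omega> in P. K (X \<omega>) \<bullet> (if 0 \<in> \<omega> then u (shift y \<omega>) else 0) = pull y K (X (shift y \<omega>)) \<bullet> u (shift y \<omega>)"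
      using AE_shift[OF u(2)[unfolded supported_def], of y] AE_space
    proof eventually_elim
      case (elim \<omega>)
      consider "0 \<notin> \<omega>" | "0 \<in> \<omega>" "y \<in> X \<omega>" | "0 \<in> \<omega>" "y \<notin> X \<omega>" by blast
      then show ?case
      proof cases
        case 1
        then have "- y \<notin> X (shift y \<omega>)"
          using origin_inclusion_subset[of "shift y \<omega>"] by (auto simp: mem_shift_iff)
        then show ?thesis using 1 by (simp add: pull_def)
      next
        case 2
        then show ?thesis
          by (simp add: pull_def X_shift mem_shift_iff zero_in_X_iff shift_add shift_0)
      next
        case 3
        then have "y \<notin> \<omega>" using near elim(2) by (simp add: near_def)
        then have "u (shift y \<omega>) = 0" using elim(1) by (simp add: mem_shift_iff)
        then show ?thesis by simp
      qed
    qed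
  qed measurable
  also have "\<dots> = (\<integral>\<omega>. pull y K (X \<omega>) \<bullet> u \<omega> \<partial>P)"
    by (rule integral_shift[where f="\<lambda>\<omega>. pull y K (X \<omega>) \<bullet> u \<omega>"]) measurable
  finally show ?thesis .
qed

text \<open>The inner remainder of a field that is a function of the inclusion at the origin is again a
function of that inclusion, given by this formula.\<close>

definition profile_remainder ::
  "(vec3 set \<Rightarrow> vec3) \<Rightarrow> (vec3 set \<Rightarrow> mat3) \<Rightarrow> 3 \<Rightarrow> real \<Rightarrow> vec3 set \<Rightarrow> vec3" where
  "profile_remainder F H i t A =
     (if 0 \<in> A \<and> t *\<^sub>R axis i 1 \<in> A then F (shift (t *\<^sub>R axis i 1) A) else 0) - F A - t *\<^sub>R (H A $ i)"

lemma profile_remainder_measurable [measurable]: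
  assumes [measurable]: "F \<in> borel_measurable points_sigma" "H \<in> borel_measurable points_sigma"
  shows "profile_remainder F H i t \<in> borel_measurable points_sigma"
proof -
  have [measurable]: "(\<lambda>A. H A $ i) \<in> borel_measurable points_sigma"
    by (rule borel_measurable_continuous_on[OF _ assms(2)]) (intro continuous_intros)
  show ?thesis unfolding profile_remainder_def[abs_def] by measurable
qed

lemma inner_remainder_profile:
  assumes "F {} = 0" "H {} = 0" "near (t *\<^sub>R axis i 1)" "\<omega> \<in> space P"
  shows "inner_remainder (at_X F) (at_X H) i t \<omega> = profile_remainder F H i t (X \<omega>)"
proof -
  let ?y = "t *\<^sub>R axis i 1 :: vec3"
  consider "0 \<notin> \<omega>" | "0 \<in> \<omega>" "?y \<in> X \<omega>" | "0 \<in> \<omega>" "?y \<notin> X \<omega>" by blast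
  then show ?thesis
  proof cases
    case 1
    then show ?thesis using assms
      by (simp add: inner_remainder_def profile_remainder_def origin_inclusion_empty)
  next
    case 2
    then show ?thesis
      by (simp add: inner_remainder_def difference_remainder_def profile_remainder_def X_shift zero_in_X_iff)
  next
    case 3
    then have "?y \<notin> \<omega>" using assms(3,4) by (simp add: near_def)
    then have "X (shift ?y \<omega>) = {}" by (intro origin_inclusion_empty) (simp add: mem_shift_iff)
    then show ?thesis using 3 assms
      by (simp add: inner_remainder_def difference_remainder_def profile_remainder_def)
  qed
qed

lemma is_condexp_row:
  fixes G :: "vec3 set \<Rightarrow> mat3"
  assumes "is_condexp G H" "K \<in> borel_measurable points_sigma" "(at_X K) \<in> L2 P"
  shows "(\<integral>\<omega>. K (X \<omega>) \<bullet> (G \<omega> $ i) \<partial>P) = (\<integral>\<omega>. K (X \<omega>) \<bullet> (H (X \<omega>) $ i) \<partial>P)"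
proof -
  define E :: "vec3 \<Rightarrow> mat3" where "E k = (\<chi> m. if m = i then k else 0)" for k
  have lin: "linear E" by (rule linearI) (auto simp: E_def vec_eq_iff)
  have E: "E k \<bullet> M = k \<bullet> (M $ i)" for k M
  proof -
    have "(E k $ m) \<bullet> (M $ m) = (if m = i then k \<bullet> (M $ i) else 0)" for m
      by (simp add: E_def)
    then show ?thesis by (simp add: inner_vec_def[of "E k" M])
  qed
  have "E \<in> borel_measurable borel"
    using lin by (intro borel_measurable_continuous_onI linear_continuous_on) (simp add: linear_conv_bounded_linear)
  then have "(\<lambda>A. E (K A)) \<in> borel_measurable points_sigma" using assms(2) by measurable
  moreover have "(\<lambda>\<omega>. E (K (X \<omega>))) \<in> L2 P" by (rule L2_linear_image[OF lin assms(3)])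
  ultimately show ?thesis using is_condexpD(4)[OF assms(1), of "\<lambda>A. E (K A)"] by (simp add: E)
qed

text \<open>Conditional expectation commutes with the increment inside an inclusion. Outside of the inclusions
it does not, because there the inclusion at the origin is empty and carries no information; this is
why the leak is treated separately.\<close>

lemma condexp_inner_remainder:
  assumes u: "u \<in> L2 P" "supported u" "is_condexp u F" and G: "G \<in> L2 P" "supported G" "is_condexp G H"
    and near: "near (t *\<^sub>R axis i 1)"
    and K [measurable]: "K \<in> borel_measurable points_sigma" and K2: "(at_X K) \<in> L2 P"
  shows "(\<integral>\<omega>. K (X \<omega>) \<bullet> inner_remainder u G i t \<omega> \<partial>P)
    = (\<integral>\<omega>. K (X \<omega>) \<bullet> inner_remainder (at_X F) (at_X H) i t \<omega> \<partial>P)"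
proof -
  let ?y = "t *\<^sub>R axis i 1 :: vec3"
  have expand: "(\<integral>\<omega>. K (X \<omega>) \<bullet> inner_remainder v J i t \<omega> \<partial>P)
    = (\<integral>\<omega>. pull ?y K (X \<omega>) \<bullet> v \<omega> \<partial>P) - (\<integral>\<omega>. K (X \<omega>) \<bullet> v \<omega> \<partial>P) - t * (\<integral>\<omega>. K (X \<omega>) \<bullet> (J \<omega> $ i) \<partial>P)"
    if v: "v \<in> L2 P" "supported v" and J: "J \<in> L2 P" "supported J" for v J
  proof -
    note m = L2_measurable[OF v(1)] L2_measurable[OF L2_vec_nth[OF J(1), of i]]
      L2_measurable[OF inner_remainder_L2[OF v(1) J(1), of i t]]
    note [measurable] = m
    have sh: "(\<lambda>\<omega>. if 0 \<in> \<omega> then v (shift ?y \<omega>) else 0) \<in> L2 P"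
      by (intro L2_restrict L2_shift v) measurable
    note [measurable] = L2_measurable[OF sh]
    have "(\<integral>\<omega>. K (X \<omega>) \<bullet> inner_remainder v J i t \<omega> \<partial>P)
      = (\<integral>\<omega>. K (X \<omega>) \<bullet> (if 0 \<in> \<omega> then v (shift ?y \<omega>) else 0) - K (X \<omega>) \<bullet> v \<omega> - t * (K (X \<omega>) \<bullet> (J \<omega> $ i)) \<partial>P)"
    proof (rule integral_cong_AE)
      show "AE \<omega> in P. K (X \<omega>) \<bullet> inner_remainder v J i t \<omega>
        = K (X \<omega>) \<bullet> (if 0 \<in> \<omega> then v (shift ?y \<omega>) else 0) - K (X \<omega>) \<bullet> v \<omega> - t * (K (X \<omega>) \<bullet> (J \<omega> $ i))"
        using v(2) J(2) unfolding supported_def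
        by eventually_elim (auto simp: inner_remainder_def difference_remainder_def inner_diff_right)
    qed measurable
    also have "\<dots> = (\<integral>\<omega>. K (X \<omega>) \<bullet> (if 0 \<in> \<omega> then v (shift ?y \<omega>) else 0) \<partial>P)
      - (\<integral>\<omega>. K (X \<omega>) \<bullet> v \<omega> \<partial>P) - t * (\<integral>\<omega>. K (X \<omega>) \<bullet> (J \<omega> $ i) \<partial>P)"
      using L2_integrable_inner[OF K2 sh] L2_integrable_inner[OF K2 v(1)]
        L2_integrable_inner[OF K2 L2_vec_nth[OF J(1), of i]] by simp
    finally show ?thesis by (simp only: integral_shift_inside[OF K v near])
  qed
  note F = is_condexpD[OF u(3)] and H = is_condexpD[OF G(3)]
  show ?thesis
    using expand[OF u(1,2) G(1,2)] expand[OF F(3) supported_profile[where F=F, OF F(2)] H(3) supported_profile[where F=H, OF H(2)]]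
      F(4)[OF pull_measurable[OF K] pull_L2[OF K K2], of ?y] F(4)[OF K K2] is_condexp_row[OF G(3) K K2]
    by simp
qed

text \<open>Both parts of the remainder of the average are projections of the corresponding parts for the
original field.\<close>

lemma condexp_remainder_le:
  assumes u: "u \<in> L2 P" "supported u" "is_condexp u F" and G: "G \<in> L2 P" "supported G" "is_condexp G H"
    and near: "near (t *\<^sub>R axis i 1)"
  shows "L2norm P (difference_remainder (at_X F) (at_X H) i t) \<le> L2norm P (difference_remainder u G i t)"
proof (rule power2_le_imp_le)
  note F = is_condexpD[OF u(3)] and H = is_condexpD[OF G(3)]
  note [measurable] = F(1) H(1)
  let ?y = "t *\<^sub>R axis i 1 :: vec3"
  let ?R = "inner_remainder (at_X F) (at_X H) i t"
  let ?\<Phi> = "profile_remainder F H i t"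
  have R2: "?R \<in> L2 P" by (rule inner_remainder_L2[OF F(3) H(3)])
  have R\<Phi>: "\<omega> \<in> space P \<Longrightarrow> ?R \<omega> = ?\<Phi> (X \<omega>)" for \<omega>
    by (rule inner_remainder_profile[where F=F and H=H, OF F(2) H(2) near])
  have \<Phi>2: "(\<lambda>\<omega>. ?\<Phi> (X \<omega>)) \<in> L2 P"
    by (rule L2_dominated[OF R2, where c=1]) (auto simp: R\<Phi>)
  have "L2norm P ?R \<le> L2norm P (inner_remainder u G i t)"
  proof (rule L2norm_le_of_inner[OF R2 inner_remainder_L2[OF u(1) G(1)]])
    have "(\<integral>\<omega>. ?R \<omega> \<bullet> ?R \<omega> \<partial>P) = (\<integral>\<omega>. ?\<Phi> (X \<omega>) \<bullet> ?R \<omega> \<partial>P)"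
      by (intro Bochner_Integration.integral_cong) (auto simp: R\<Phi>)
    also have "\<dots> = (\<integral>\<omega>. ?\<Phi> (X \<omega>) \<bullet> inner_remainder u G i t \<omega> \<partial>P)"
      by (rule condexp_inner_remainder[OF u G near _ \<Phi>2, symmetric]) measurable
    also have "\<dots> = (\<integral>\<omega>. ?R \<omega> \<bullet> inner_remainder u G i t \<omega> \<partial>P)"
      by (intro Bochner_Integration.integral_cong) (auto simp: R\<Phi>)
    finally show "(\<integral>\<omega>. ?R \<omega> \<bullet> ?R \<omega> \<partial>P) = (\<integral>\<omega>. ?R \<omega> \<bullet> inner_remainder u G i t \<omega> \<partial>P)" .
  qed
  moreover have "L2norm P (leak (at_X F) ?y) \<le> L2norm P (leak u ?y)"
  proof (rule L2norm_le_of_inner[OF leak_L2[OF F(3)] leak_L2[OF u(1)]])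
    define K where "K A = (if - ?y \<in> A then 0 else F A)" for A
    have K [measurable]: "K \<in> borel_measurable points_sigma" unfolding K_def by measurable
    have leak: "leak (at_X F) ?y = (at_X K)" by (simp add: leak_def K_def fun_eq_iff)
    have K2: "(at_X K) \<in> L2 P" using leak_L2[OF F(3), of ?y] by (simp add: leak)
    have "(\<integral>\<omega>. K (X \<omega>) \<bullet> K (X \<omega>) \<partial>P) = (\<integral>\<omega>. K (X \<omega>) \<bullet> F (X \<omega>) \<partial>P)"
      by (intro Bochner_Integration.integral_cong) (auto simp: K_def)
    also have "\<dots> = (\<integral>\<omega>. K (X \<omega>) \<bullet> u \<omega> \<partial>P)" by (rule F(4)[OF K K2, symmetric])
    also have "\<dots> = (\<integral>\<omega>. K (X \<omega>) \<bullet> leak u ?y \<omega> \<partial>P)"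
      by (intro Bochner_Integration.integral_cong) (auto simp: K_def leak_def)
    finally show "(\<integral>\<omega>. leak (at_X F) ?y \<omega> \<bullet> leak (at_X F) ?y \<omega> \<partial>P)
      = (\<integral>\<omega>. leak (at_X F) ?y \<omega> \<bullet> leak u ?y \<omega> \<partial>P)" by (simp only: leak)
  qed
  ultimately show "(L2norm P (difference_remainder (at_X F) (at_X H) i t))\<^sup>2
    \<le> (L2norm P (difference_remainder u G i t))\<^sup>2"
    unfolding difference_remainder_decomposition[OF u(1,2) G(1,2) near]
      difference_remainder_decomposition[OF F(3) supported_profile[where F=F, OF F(2)] H(3) supported_profile[where F=H, OF H(2)] near]
    by (intro add_mono power_mono L2norm_nonneg)
qed (rule L2norm_nonneg)

text \<open>Averaging over all configurations with the same inclusion at the origin maps fields with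
square-integrable gradient that vanish outside the inclusions to such fields, and commutes with the
gradient.\<close>

lemma condexp_stationary_gradient:
  assumes u: "u \<in> L2 P" "supported u" "is_condexp u F" and G: "stationary_gradient P u G" "supported G" "is_condexp G H"
  shows "stationary_gradient P (at_X F) (at_X H)"
proof (rule stationary_gradient_of_strong_gradient)
  show "(at_X F) \<in> L2 P" "(at_X H) \<in> L2 P" using u(3) G(3) by (auto dest: is_condexpD)
  show "strong_gradient (at_X F) (at_X H)"
  proof (rule strong_gradientI)
    fix e :: real and i :: 3 assume "e > 0"
    obtain \<tau> where \<tau>: "\<tau> > 0" "\<And>y. norm y < \<tau> \<Longrightarrow> near y" by (rule near_origin) (rule that, assumption, blast)
    obtain d where d: "d > 0" "\<And>t. 0 < \<bar>t\<bar> \<Longrightarrow> \<bar>t\<bar> < d \<Longrightarrow> L2norm P (difference_remainder u G i t) \<le> e * \<bar>t\<bar>"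
      using strong_gradientD[OF strong_gradient_of_stationary_gradient[OF u(1) G(1)] \<open>e > 0\<close>] by metis
    have "L2norm P (difference_remainder (at_X F) (at_X H) i t) \<le> e * \<bar>t\<bar>"
      if "0 < \<bar>t\<bar>" "\<bar>t\<bar> < min d \<tau>" for t
    proof -
      have "near (t *\<^sub>R axis i 1)" using that by (intro \<tau>(2)) (simp add: norm_axis_1)
      from condexp_remainder_le[OF u stationary_gradient_L2[OF G(1)] G(2,3) this] d(2)[of t] that
      show ?thesis by simp
    qed
    then show "\<exists>d>0. \<forall>t. 0 < \<bar>t\<bar> \<and> \<bar>t\<bar> < d \<longrightarrow>
      L2norm P (difference_remainder (at_X F) (at_X H) i t) \<le> e * \<bar>t\<bar>"
      using d(1) \<tau>(1) by (intro exI[of _ "min d \<tau>"]) auto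
  qed
qed

text \<open>Where both the origin and its translate lie outside the inclusions, the remainder is \<open>- t\<close> times the
gradient, which is therefore small there. The exceptional set, on which the translation enters an
inclusion, becomes after translating back the set on which it leaves one, and this shrinks to
nothing because configurations are open.\<close>

lemma gradient_supported:
  assumes u: "u \<in> L2 P" "supported u" and G: "stationary_gradient P u G"
  shows "supported G"
proof -
  have GL: "G \<in> L2 P" by (rule stationary_gradient_L2[OF G])
  have "AE \<omega> in P. (if 0 \<in> \<omega> then 0 else G \<omega> $ i) = 0" for i
  proof -
    define g where "g \<omega> = G \<omega> $ i" for \<omega>
    have g: "g \<in> L2 P" unfolding g_def by (rule L2_vec_nth[OF GL])
    note [measurable] = L2_measurable[OF g]
    \<comment> \<open>The norm of the gradient outside of the inclusions is split along this sequence into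
      \<open>a\<close> (remainder), \<open>b\<close> (continuity of translations) and \<open>c\<close> (mass leaving the inclusions).\<close>
    define y where "y n = (1 / real (Suc n)) *\<^sub>R (axis i 1 :: vec3)" for n
    have t0: "(\<lambda>n. 1 / real (Suc n)) \<longlonglongrightarrow> 0" by (rule lim_1_over_n[THEN LIMSEQ_Suc])
    then have y0: "y \<longlonglongrightarrow> 0"
      unfolding y_def using tendsto_scaleR[OF t0 tendsto_const[of "axis i 1 :: vec3"]] by simp
    have t_at: "filterlim (\<lambda>n. 1 / real (Suc n)) (at 0) sequentially"
      using t0 by (simp add: filterlim_at)
    have y_at: "filterlim y (at 0) sequentially"
      using y0 by (auto simp: filterlim_at y_def axis_eq_0_iff)
    have my_at: "filterlim (\<lambda>n. - y n) (at 0) sequentially"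
      using tendsto_minus[OF y0] by (auto simp: filterlim_at y_def axis_eq_0_iff)
    define a where "a n = L2norm P (difference_remainder u G i (1 / real (Suc n))) / \<bar>1 / real (Suc n)\<bar>" for n
    define b where "b n = L2norm P (\<lambda>\<omega>. g (shift (- y n) \<omega>) - g \<omega>)" for n
    define c where "c n = L2norm P (\<lambda>\<omega>. if 0 \<in> \<omega> \<and> - y n \<notin> \<omega> then g \<omega> else 0)" for n
    have a0: "a \<longlonglongrightarrow> 0"
      unfolding a_def
      by (rule filterlim_compose[OF _ t_at, of "\<lambda>t. L2norm P (difference_remainder u G i t) / \<bar>t\<bar>"])
        (use strong_gradient_of_stationary_gradient[OF u(1) G] in \<open>simp add: strong_gradient_def\<close>)
    have b0: "b \<longlonglongrightarrow> 0"
      unfolding b_def by (rule filterlim_compose[OF shift_continuous_L2[OF g] my_at])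
    have "(\<lambda>n. \<integral>\<omega>. (norm (if 0 \<in> \<omega> \<and> - y n \<notin> \<omega> then g \<omega> else 0))\<^sup>2 \<partial>P) \<longlonglongrightarrow> (\<integral>\<omega>. 0 \<partial>P)"
    proof (rule integral_dominated_convergence[where w="\<lambda>\<omega>. (norm (g \<omega>))\<^sup>2"])
      show "integrable P (\<lambda>\<omega>. (norm (g \<omega>))\<^sup>2)" by (rule L2_integrable_square[OF g])
      show "AE \<omega> in P. (\<lambda>n. (norm (if 0 \<in> \<omega> \<and> - y n \<notin> \<omega> then g \<omega> else 0))\<^sup>2) \<longlonglongrightarrow> 0"
      proof (rule AE_I2, rule tendsto_eventually)
        fix \<omega> assume \<omega>: "\<omega> \<in> space P"
        have "(\<lambda>n. - y n) \<longlonglongrightarrow> 0" using tendsto_minus[OF y0] by simp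
        from topological_tendstoD[OF this open_config[OF \<omega>]]
        have "0 \<in> \<omega> \<Longrightarrow> \<forall>\<^sub>F n in sequentially. - y n \<in> \<omega>" .
        then show "\<forall>\<^sub>F n in sequentially. (norm (if 0 \<in> \<omega> \<and> - y n \<notin> \<omega> then g \<omega> else 0))\<^sup>2 = 0"
        proof (cases "0 \<in> \<omega>")
          case True
          from \<open>0 \<in> \<omega> \<Longrightarrow> \<forall>\<^sub>F n in sequentially. - y n \<in> \<omega>\<close>[OF this] show ?thesis
            by (rule eventually_mono) auto
        qed simp
      qed
    qed auto
    from tendsto_real_sqrt[OF this] have c0: "c \<longlonglongrightarrow> 0"
      unfolding c_def L2norm_def by simp
    have bound: "L2norm P (\<lambda>\<omega>. if 0 \<in> \<omega> then 0 else g \<omega>) \<le> a n + (b n + c n)" for n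
    proof -
      let ?t = "1 / real (Suc n)"
      define g1 where "g1 \<omega> = (if 0 \<notin> \<omega> \<and> y n \<notin> \<omega> then g \<omega> else 0)" for \<omega>
      define g2 where "g2 \<omega> = (if 0 \<in> \<omega> \<and> - y n \<notin> \<omega> then g (shift (- y n) \<omega>) else 0)" for \<omega>
      have g1: "g1 \<in> L2 P" unfolding g1_def by (intro L2_restrict g) measurable
      have g2: "g2 \<in> L2 P" unfolding g2_def by (intro L2_restrict L2_shift g) measurable
      have D: "difference_remainder u G i ?t \<in> L2 P" by (rule difference_remainder_L2[OF u(1) GL])
      have "L2norm P (\<lambda>\<omega>. if 0 \<in> \<omega> then 0 else g \<omega>) = L2norm P (\<lambda>\<omega>. g1 \<omega> + g2 (shift (y n) \<omega>))"
        by (intro arg_cong[where f="L2norm P"] ext)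
          (auto simp: g1_def g2_def mem_shift_iff shift_add shift_0)
      also have "\<dots> \<le> L2norm P g1 + L2norm P (\<lambda>\<omega>. g2 (shift (y n) \<omega>))"
        by (rule L2norm_triangle[OF g1 L2_shift[OF g2]])
      also have "L2norm P (\<lambda>\<omega>. g2 (shift (y n) \<omega>)) = L2norm P g2" by (rule L2norm_shift[OF g2])
      also have "L2norm P g1 \<le> a n"
      proof -
        have "?t * L2norm P g1 = L2norm P (\<lambda>\<omega>. ?t *\<^sub>R g1 \<omega>)" unfolding L2norm_scaleR by simp
        also have "\<dots> \<le> L2norm P (difference_remainder u G i ?t)"
        proof (rule L2norm_mono[OF D])
          show "(\<lambda>\<omega>. ?t *\<^sub>R g1 \<omega>) \<in> borel_measurable P" by (rule L2_measurable[OF L2_scaleR[OF g1]])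
          show "AE \<omega> in P. norm (?t *\<^sub>R g1 \<omega>) \<le> norm (difference_remainder u G i ?t \<omega>)"
            using u(2)[unfolded supported_def] AE_shift[OF u(2)[unfolded supported_def], of "y n"]
            by eventually_elim (auto simp: g1_def g_def difference_remainder_def mem_shift_iff y_def)
        qed
        finally show ?thesis unfolding a_def by (simp add: field_simps)
      qed
      also have "L2norm P g2 \<le> b n + c n"
      proof -
        let ?p = "\<lambda>\<omega>. if 0 \<in> \<omega> \<and> - y n \<notin> \<omega> then g (shift (- y n) \<omega>) - g \<omega> else 0"
        let ?q = "\<lambda>\<omega>. if 0 \<in> \<omega> \<and> - y n \<notin> \<omega> then g \<omega> else 0"
        have p: "?p \<in> L2 P" by (intro L2_restrict L2_diff L2_shift[of g] g) measurable
        have q: "?q \<in> L2 P" by (intro L2_restrict g) measurable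
        have "L2norm P g2 = L2norm P (\<lambda>\<omega>. ?p \<omega> + ?q \<omega>)"
          by (intro arg_cong[where f="L2norm P"] ext) (auto simp: g2_def)
        also have "\<dots> \<le> L2norm P ?p + L2norm P ?q" by (rule L2norm_triangle[OF p q])
        also have "L2norm P ?p \<le> b n"
          unfolding b_def by (rule L2norm_mono[OF L2_diff[OF L2_shift[OF g] g] L2_measurable[OF p]]) auto
        finally show ?thesis by (simp add: c_def)
      qed
      finally show ?thesis by simp
    qed
    have "L2norm P (\<lambda>\<omega>. if 0 \<in> \<omega> then 0 else g \<omega>) \<le> 0"
    proof (rule LIMSEQ_le_const)
      show "(\<lambda>n. a n + (b n + c n)) \<longlonglongrightarrow> 0"
        using tendsto_add[OF a0 tendsto_add[OF b0 c0]] by simp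
    qed (use bound in blast)
    then have "L2norm P (\<lambda>\<omega>. if 0 \<in> \<omega> then 0 else g \<omega>) = 0"
      using L2norm_nonneg by (rule antisym)
    moreover have "(\<lambda>\<omega>. if 0 \<in> \<omega> then 0 else g \<omega>) \<in> L2 P"
      by (rule L2_dominated[OF g, where c=1]) auto
    ultimately show ?thesis using L2norm_eq_0 unfolding g_def by blast
  qed
  then have "AE \<omega> in P. \<forall>i. (if 0 \<in> \<omega> then 0 else G \<omega> $ i) = 0" by (simp add: AE_all_countable)
  then show ?thesis unfolding supported_def
    by eventually_elim (auto simp: vec_eq_iff split: if_splits)
qed

end

section \<open>Signed permutations of the coordinates\<close>

definition signed_perm :: "(3 \<Rightarrow> real) \<Rightarrow> (3 \<Rightarrow> 3) \<Rightarrow> vec3 \<Rightarrow> vec3" where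
  "signed_perm \<epsilon> \<pi> x = (\<chi> i. \<epsilon> i * x $ \<pi> i)"

text \<open>Conjugation \<open>R ** \<xi> ** transpose R\<close> by the matrix \<open>R\<close> of the signed permutation: the rule by which
the gradient of a vector field transforms.\<close>

definition conj_signed_perm :: "(3 \<Rightarrow> real) \<Rightarrow> (3 \<Rightarrow> 3) \<Rightarrow> mat3 \<Rightarrow> mat3" where
  "conj_signed_perm \<epsilon> \<pi> \<xi> = (\<chi> i j. \<epsilon> i * \<epsilon> j * \<xi> $ \<pi> i $ \<pi> j)"

text \<open>Reflections in coordinate planes and quarter turns about coordinate axes are both of this kind.
They map coordinate axes to coordinate axes, so that partial derivatives go to partial derivatives up
to a sign. In the following, \<open>g\<close> is the map and \<open>k\<close> its inverse; \<open>cg\<close> and \<open>ck\<close> are the conjugations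
with them.\<close>

locale signed_permutation =
  fixes \<epsilon> :: "3 \<Rightarrow> real" and \<pi> :: "3 \<Rightarrow> 3"
  assumes bij: "bij \<pi>" and sign: "\<epsilon> i * \<epsilon> i = 1"
begin

abbreviation g :: "vec3 \<Rightarrow> vec3" where "g \<equiv> signed_perm \<epsilon> \<pi>"
abbreviation k :: "vec3 \<Rightarrow> vec3" where "k \<equiv> signed_perm (\<lambda>i. \<epsilon> (inv \<pi> i)) (inv \<pi>)"
abbreviation cg :: "mat3 \<Rightarrow> mat3" where "cg \<equiv> conj_signed_perm \<epsilon> \<pi>"
abbreviation ck :: "mat3 \<Rightarrow> mat3" where "ck \<equiv> conj_signed_perm (\<lambda>i. \<epsilon> (inv \<pi> i)) (inv \<pi>)"

lemma inv_perm [simp]: "inv \<pi> (\<pi> i) = i" "\<pi> (inv \<pi> i) = i"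
  using bij by (simp_all add: bij_is_inj bij_is_surj surj_f_inv_f)

lemma sum_perm: "(\<Sum>i\<in>UNIV. f (\<pi> i)) = (\<Sum>i\<in>UNIV. f i)"
  using bij by (rule sum.reindex_bij_betw)

lemma inverse_signed_permutation: "signed_permutation (\<lambda>i. \<epsilon> (inv \<pi> i)) (inv \<pi>)"
  by unfold_locales (simp_all add: sign bij bij_imp_bij_inv)

lemma inverse_inverse: "inv (inv \<pi>) = \<pi>"
  using bij by (rule inv_inv_eq)

lemma linear_g: "linear g"
  by (rule linearI) (simp_all add: signed_perm_def vec_eq_iff algebra_simps)

lemma linear_k: "linear k"
  by (rule linearI) (simp_all add: signed_perm_def vec_eq_iff algebra_simps)

lemma linear_cg: "linear cg"
  by (rule linearI) (simp_all add: conj_signed_perm_def vec_eq_iff algebra_simps)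

lemma g_k [simp]: "g (k x) = x" and k_g [simp]: "k (g x) = x"
  by (simp_all add: signed_perm_def vec_eq_iff sign mult.assoc[symmetric])

lemma image_g_k [simp]: "g ` k ` A = A" "k ` g ` A = A"
  by (simp_all add: image_comp comp_def)

lemma mem_image_k_iff: "q \<in> k ` A \<longleftrightarrow> g q \<in> A"
  by (auto simp: image_iff intro!: bexI[of _ "g q"])

lemma mem_image_g_iff: "q \<in> g ` A \<longleftrightarrow> k q \<in> A"
  by (auto simp: image_iff intro!: bexI[of _ "k q"])

lemma inner_g: "g x \<bullet> y = x \<bullet> k y"
proof -
  have "g x \<bullet> y = (\<Sum>i\<in>UNIV. x $ \<pi> i * (\<epsilon> (inv \<pi> (\<pi> i)) * y $ inv \<pi> (\<pi> i)))"
    by (simp add: signed_perm_def inner_vec_def mult_ac)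
  also have "\<dots> = x \<bullet> k y"
    unfolding sum_perm[of "\<lambda>i. x $ i * (\<epsilon> (inv \<pi> i) * y $ inv \<pi> i)"]
    by (simp add: signed_perm_def inner_vec_def)
  finally show ?thesis .
qed

lemma norm_g: "norm (g x) = norm x"
  by (simp add: norm_eq_sqrt_inner inner_g)

lemma k_axis: "k (t *\<^sub>R axis i 1) = (\<epsilon> i * t) *\<^sub>R axis (\<pi> i) 1"
proof -
  have "inv \<pi> j = i \<longleftrightarrow> j = \<pi> i" for j by (metis inv_perm)
  then show ?thesis by (auto simp: signed_perm_def vec_eq_iff axis_def)
qed

lemma g_axis: "g (axis (\<pi> i) 1) = \<epsilon> i *\<^sub>R axis i 1"
proof -
  have "\<pi> j = \<pi> i \<longleftrightarrow> j = i" for j by (metis inv_perm)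
  then show ?thesis by (auto simp: signed_perm_def vec_eq_iff axis_def)
qed

lemma abs_sign: "\<bar>\<epsilon> i\<bar> = 1"
proof -
  have "(\<bar>\<epsilon> i\<bar>)\<^sup>2 = 1" using sign[of i] by (simp add: power2_eq_square)
  then show ?thesis by (auto simp: power2_eq_1_iff)
qed

lemma g_cube: "x \<in> cube \<Longrightarrow> g x \<in> cube"
proof -
  have "g x $ i \<in> {-2..2}" if "x \<in> cube" for i
  proof -
    have "\<bar>g x $ i\<bar> = \<bar>x $ \<pi> i\<bar>" by (simp add: signed_perm_def abs_mult abs_sign)
    moreover have "x $ \<pi> i \<in> {-2..2}" using that unfolding cube_def by blast
    then have "\<bar>x $ \<pi> i\<bar> \<le> 2" by (auto simp: abs_le_iff)
    ultimately show ?thesis by (auto simp: abs_le_iff)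
  qed
  then show "x \<in> cube \<Longrightarrow> g x \<in> cube" by (simp add: cube_def)
qed

lemma cg_row: "cg \<xi> $ i = \<epsilon> i *\<^sub>R g (\<xi> $ \<pi> i)"
  by (simp add: conj_signed_perm_def signed_perm_def vec_eq_iff)

lemma inner_cg: "cg \<xi> \<bullet> \<eta> = \<xi> \<bullet> ck \<eta>"
proof -
  have ck_row: "ck \<eta> $ \<pi> i = \<epsilon> i *\<^sub>R k (\<eta> $ i)" for i
    by (simp add: conj_signed_perm_def signed_perm_def vec_eq_iff)
  have "cg \<xi> \<bullet> \<eta> = (\<Sum>i\<in>UNIV. \<xi> $ \<pi> i \<bullet> ck \<eta> $ \<pi> i)"
    unfolding inner_vec_def[of "cg \<xi>"] cg_row ck_row by (simp add: inner_g)
  also have "\<dots> = \<xi> \<bullet> ck \<eta>"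
    unfolding sum_perm[of "\<lambda>i. \<xi> $ i \<bullet> ck \<eta> $ i"] by (simp add: inner_vec_def[of \<xi>])
  finally show ?thesis .
qed

lemma cg_mat_1: "cg (mat 1) = mat 1"
proof -
  have "\<pi> j = \<pi> i \<longleftrightarrow> j = i" for i j by (metis inv_perm)
  then show ?thesis by (auto simp: conj_signed_perm_def mat_def vec_eq_iff sign)
qed

lemma trace_cg: "trace (cg \<xi>) = trace \<xi>"
  using sum_perm[of "\<lambda>i. \<xi> $ i $ i"] by (simp add: trace_def conj_signed_perm_def sign)

lemma transpose_cg: "transpose (cg \<xi>) = cg (transpose \<xi>)"
  by (simp add: transpose_def conj_signed_perm_def vec_eq_iff mult_ac)

text \<open>Trace and symmetric part commute with conjugation by an orthogonal matrix.\<close>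

lemma isotropic_cg:
  assumes "isotropic C" shows "tensor_apply C (cg \<xi>) = cg (tensor_apply C \<xi>)"
proof -
  obtain c1 c2 where C: "\<And>\<xi>. tensor_apply C \<xi> =
      (c1 * trace \<xi>) *\<^sub>R mat 1 + c2 *\<^sub>R ((1/2) *\<^sub>R (\<xi> + transpose \<xi>))"
    using assms unfolding isotropic_def by blast
  show ?thesis
    unfolding C by (simp only: trace_cg transpose_cg linear_add[OF linear_cg] linear_scale[OF linear_cg] cg_mat_1)
qed

lemma closure_image_k: "interior (closure (k ` A)) = k ` interior (closure A)"
proof -
  have "inj k" by (metis g_k injI)
  then show ?thesis
    using linear_k by (simp add: closure_injective_linear_image[symmetric] interior_injective_linear_image)
qed

lemma shift_image_k: "shift (k y) (k ` A) = k ` shift y A"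
  unfolding shift_def image_image linear_diff[OF linear_k] ..

lemma image_k_measurable [measurable]: "(\<lambda>A. k ` A) \<in> points_sigma \<rightarrow>\<^sub>M points_sigma"
  by (rule measurable_points_sigmaI) (simp add: mem_image_k_iff)

lemma image_g_measurable [measurable]: "(\<lambda>A. g ` A) \<in> points_sigma \<rightarrow>\<^sub>M points_sigma"
  by (rule measurable_points_sigmaI) (simp add: mem_image_g_iff)

lemma g_measurable [measurable]: "g \<in> borel_measurable borel"
  using linear_g by (intro borel_measurable_continuous_onI linear_continuous_on) (simp add: linear_conv_bounded_linear)

lemma cg_measurable [measurable]: "cg \<in> borel_measurable borel"
  using linear_cg by (intro borel_measurable_continuous_onI linear_continuous_on) (simp add: linear_conv_bounded_linear)

lemma norm_cg: "norm (cg \<xi>) = norm \<xi>"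
proof -
  have "ck (cg \<xi>) = \<xi>"
    using sign by (simp add: conj_signed_perm_def vec_eq_iff algebra_simps) 
  then show ?thesis by (simp add: norm_eq_sqrt_inner inner_cg)
qed

end

context measurable_origin_inclusion begin

text \<open>Invariance of the law of the inclusion at the origin, for the events generated by membership of
points.\<close>

definition law_invariant :: "(vec3 \<Rightarrow> vec3) \<Rightarrow> bool" where
  "law_invariant h \<longleftrightarrow> distr P points_sigma (\<lambda>\<omega>. h ` X \<omega>) = distr P points_sigma X"

lemma law_invariant_integral:
  fixes f :: "vec3 set \<Rightarrow> 'b::{banach, second_countable_topology}"
  assumes "law_invariant h" "(\<lambda>A. h ` A) \<in> points_sigma \<rightarrow>\<^sub>M points_sigma" "f \<in> borel_measurable points_sigma"
  shows "(\<integral>\<omega>. f (h ` X \<omega>) \<partial>P) = (\<integral>\<omega>. f (X \<omega>) \<partial>P)"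
    and "integrable P (\<lambda>\<omega>. f (h ` X \<omega>)) \<longleftrightarrow> integrable P (\<lambda>\<omega>. f (X \<omega>))"
proof -
  note [measurable] = assms(2,3)
  have hX: "(\<lambda>\<omega>. h ` X \<omega>) \<in> P \<rightarrow>\<^sub>M points_sigma" by measurable
  show "(\<integral>\<omega>. f (h ` X \<omega>) \<partial>P) = (\<integral>\<omega>. f (X \<omega>) \<partial>P)"
    using integral_distr[OF hX assms(3)] integral_distr[OF X_measurable assms(3)] assms(1)
    unfolding law_invariant_def by (simp only:)
  show "integrable P (\<lambda>\<omega>. f (h ` X \<omega>)) \<longleftrightarrow> integrable P (\<lambda>\<omega>. f (X \<omega>))"
    using integrable_distr_eq[OF hX assms(3)] integrable_distr_eq[OF X_measurable assms(3)] assms(1)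
    unfolding law_invariant_def by (simp only:)
qed

text \<open>Events on point sets are pulled back to Hausdorff events through \<open>A \<mapsto> interior (closure A)\<close>, which is
the identity on inclusions. The statement for the inverse then yields the one for the map, by
applying it to preimages.\<close>

lemma law_invariant_inverse:
  assumes "signed_permutation \<epsilon> \<pi>" "origin_law_invariant P (signed_perm \<epsilon> \<pi>)"
  shows "law_invariant (signed_perm (\<lambda>i. \<epsilon> (inv \<pi> i)) (inv \<pi>))"
    and "law_invariant (signed_perm \<epsilon> \<pi>)"
proof -
  interpret signed_permutation \<epsilon> \<pi> by (rule assms(1))
  interpret inv: signed_permutation "\<lambda>i. \<epsilon> (inv \<pi> i)" "inv \<pi>" by (rule inverse_signed_permutation)
  interpret prob_space P by (rule prob_space_P)
  have *: "measure P {\<omega> \<in> space P. X \<omega> \<in> S} = measure P {\<omega> \<in> space P. k ` X \<omega> \<in> S}" if S: "S \<in> sets points_sigma" for S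
  proof -
    define H where "H = (\<lambda>A. interior (closure A)) -` S \<inter> space hausdorff_borel"
    have "H \<in> sets hausdorff_borel" unfolding H_def by (rule measurable_sets[OF measurable_interior_closure S])
    then have "measure P {\<omega> \<in> space P. X \<omega> \<in> H} = measure P {\<omega> \<in> space P. X \<omega> \<in> (\<lambda>A. g ` A) ` H}"
      using bspec[OF assms(2)[unfolded origin_law_invariant_def]] by simp
    also have "{\<omega> \<in> space P. X \<omega> \<in> H} = {\<omega> \<in> space P. X \<omega> \<in> S}"
      unfolding H_def
      by (rule Collect_cong, rule conj_cong[OF refl])
        (simp only: vimage_eq Int_iff space_hausdorff_borel X_subset_cube X_regular_open simp_thms)
    also have "{\<omega> \<in> space P. X \<omega> \<in> (\<lambda>A. g ` A) ` H} = {\<omega> \<in> space P. k ` X \<omega> \<in> S}"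
    proof (rule Collect_cong, rule conj_cong[OF refl])
      fix \<omega> assume \<omega>: "\<omega> \<in> space P"
      have "X \<omega> \<in> (\<lambda>A. g ` A) ` H \<longleftrightarrow> k ` X \<omega> \<in> H"
      proof
        assume "X \<omega> \<in> (\<lambda>A. g ` A) ` H"
        then obtain A where "A \<in> H" "X \<omega> = g ` A" by (rule imageE)
        then show "k ` X \<omega> \<in> H" by (simp only: image_g_k)
      next
        assume "k ` X \<omega> \<in> H"
        then have "g ` k ` X \<omega> \<in> (\<lambda>A. g ` A) ` H" by (rule imageI)
        then show "X \<omega> \<in> (\<lambda>A. g ` A) ` H" by (simp only: image_g_k)
      qed
      also have "k ` X \<omega> \<in> Pow cube" using X_subset_cube[OF \<omega>] inv.g_cube by auto
      then have "k ` X \<omega> \<in> H \<longleftrightarrow> k ` X \<omega> \<in> S"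
        using X_regular_open[OF \<omega>] by (simp add: H_def closure_image_k)
      finally show "X \<omega> \<in> (\<lambda>A. g ` A) ` H \<longleftrightarrow> k ` X \<omega> \<in> S" .
    qed
    finally show ?thesis .
  qed
  have eq: "law_invariant h" if h [measurable]: "(\<lambda>A. h ` A) \<in> points_sigma \<rightarrow>\<^sub>M points_sigma"
    and m: "\<And>S. S \<in> sets points_sigma \<Longrightarrow> measure P {\<omega> \<in> space P. h ` X \<omega> \<in> S} = measure P {\<omega> \<in> space P. X \<omega> \<in> S}" for h
    unfolding law_invariant_def
  proof (rule measure_eqI)
    fix S assume "S \<in> sets (distr P points_sigma (\<lambda>\<omega>. h ` X \<omega>))"
    then have S: "S \<in> sets points_sigma" by simp
    show "emeasure (distr P points_sigma (\<lambda>\<omega>. h ` X \<omega>)) S = emeasure (distr P points_sigma X) S"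
      using m[OF S] S by (simp add: emeasure_distr emeasure_eq_measure vimage_def Int_def conj_commute)
  qed simp
  show "law_invariant k" by (rule eq[OF image_k_measurable *[symmetric]])
  show "law_invariant g"
  proof (rule eq[OF image_g_measurable])
    fix S assume S: "S \<in> sets points_sigma"
    have "(\<lambda>A. g ` A) -` S \<inter> space points_sigma \<in> sets points_sigma"
      by (rule measurable_sets[OF image_g_measurable S])
    from *[OF this] show "measure P {\<omega> \<in> space P. g ` X \<omega> \<in> S} = measure P {\<omega> \<in> space P. X \<omega> \<in> S}"
      by simp
  qed
qed

text \<open>The mean of this function of the inclusion at the origin is the squared norm of the remainder, which
therefore depends on the law of that inclusion only.\<close>

definition energy :: "(vec3 set \<Rightarrow> vec3) \<Rightarrow> (vec3 set \<Rightarrow> mat3) \<Rightarrow> 3 \<Rightarrow> real \<Rightarrow> vec3 set \<Rightarrow> real" where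
  "energy F H i t A = (norm (profile_remainder F H i t A))\<^sup>2
      + (norm (if - (t *\<^sub>R axis i 1) \<in> A then 0 else F A))\<^sup>2"

lemma energy_measurable [measurable]:
  assumes [measurable]: "F \<in> borel_measurable points_sigma" "H \<in> borel_measurable points_sigma"
  shows "energy F H i t \<in> borel_measurable points_sigma"
  unfolding energy_def[abs_def] by measurable

lemma remainder_energy:
  assumes F: "F \<in> borel_measurable points_sigma" "F {} = 0" "(at_X F) \<in> L2 P"
    and H: "H \<in> borel_measurable points_sigma" "H {} = 0" "(at_X H) \<in> L2 P"
    and near: "near (t *\<^sub>R axis i 1)"
  shows "(L2norm P (difference_remainder (at_X F) (at_X H) i t))\<^sup>2 = (\<integral>\<omega>. energy F H i t (X \<omega>) \<partial>P)"
proof -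
  let ?y = "t *\<^sub>R axis i 1 :: vec3"
  let ?R = "inner_remainder (at_X F) (at_X H) i t" and ?L = "leak (at_X F) ?y"
  have "(L2norm P (difference_remainder (at_X F) (at_X H) i t))\<^sup>2
      = (\<integral>\<omega>. (norm (?R \<omega>))\<^sup>2 + (norm (?L \<omega>))\<^sup>2 \<partial>P)"
    using difference_remainder_decomposition[OF F(3) supported_profile[where F=F, OF F(2)] H(3) supported_profile[where F=H, OF H(2)] near]
      L2_integrable_square[OF inner_remainder_L2[OF F(3) H(3)], of i t] L2_integrable_square[OF leak_L2[OF F(3)], of ?y]
    by (simp add: L2norm_square)
  also have "\<dots> = (\<integral>\<omega>. energy F H i t (X \<omega>) \<partial>P)"
    by (intro Bochner_Integration.integral_cong refl)
      (simp add: energy_def leak_def inner_remainder_profile[where F=F and H=H, OF F(2) H(2) near])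
  finally show ?thesis .
qed

text \<open>The field \<open>F\<close>, read in coordinates rotated or reflected by \<open>g\<close>, has the conjugated gradient: its
remainder along one axis has the same energy as that of \<open>F\<close> along another, up to the transformation of
the inclusion, which does not change the law.\<close>

lemma transformed_gradient:
  assumes sp: "signed_permutation \<epsilon> \<pi>"
    and inv: "law_invariant (signed_perm (\<lambda>i. \<epsilon> (inv \<pi> i)) (inv \<pi>))"
    and F: "F \<in> borel_measurable points_sigma" "F {} = 0" "(at_X F) \<in> L2 P"
    and H: "H \<in> borel_measurable points_sigma" "H {} = 0"
    and FH: "stationary_gradient P (at_X F) (at_X H)"
  defines "F' \<equiv> \<lambda>A. signed_perm \<epsilon> \<pi> (F (signed_perm (\<lambda>i. \<epsilon> (inv \<pi> i)) (inv \<pi>) ` A))"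
    and "H' \<equiv> \<lambda>A. conj_signed_perm \<epsilon> \<pi> (H (signed_perm (\<lambda>i. \<epsilon> (inv \<pi> i)) (inv \<pi>) ` A))"
  shows "F' \<in> borel_measurable points_sigma" "F' {} = 0" "(at_X F') \<in> L2 P"
    "H' \<in> borel_measurable points_sigma" "H' {} = 0"
    "stationary_gradient P (at_X F') (at_X H')"
proof -
  interpret signed_permutation \<epsilon> \<pi> by (rule sp)
  note [measurable] = F(1) H(1)
  have H2: "(at_X H) \<in> L2 P" by (rule stationary_gradient_L2[OF FH])
  have F'_def: "F' A = g (F (k ` A))" and H'_def: "H' A = cg (H (k ` A))" for A
    by (simp_all add: F'_def H'_def)
  show F'm [measurable]: "F' \<in> borel_measurable points_sigma" unfolding F'_def[abs_def] by measurable
  show H'm [measurable]: "H' \<in> borel_measurable points_sigma" unfolding H'_def[abs_def] by measurable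
  show F'0: "F' {} = 0" using F(2) by (simp add: F'_def linear_0[OF linear_g])
  show H'0: "H' {} = 0" using H(2) by (simp add: H'_def linear_0[OF linear_cg])
  show F'2: "(at_X F') \<in> L2 P"
  proof (rule L2_I)
    show "integrable P (\<lambda>\<omega>. (norm (F' (X \<omega>)))\<^sup>2)"
      using law_invariant_integral(2)[OF inv image_k_measurable, of "\<lambda>A. (norm (F A))\<^sup>2"] L2_integrable_square[OF F(3)]
      by (simp add: F'_def norm_g)
  qed measurable
  have H'2: "(at_X H') \<in> L2 P"
  proof (rule L2_I)
    show "integrable P (\<lambda>\<omega>. (norm (H' (X \<omega>)))\<^sup>2)"
      using law_invariant_integral(2)[OF inv image_k_measurable, of "\<lambda>A. (norm (H A))\<^sup>2"] L2_integrable_square[OF H2]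
      by (simp add: H'_def norm_cg)
  qed measurable
  have energy: "energy F' H' i t A = energy F H (\<pi> i) (\<epsilon> i * t) (k ` A)" for i t A
  proof -
    have mem: "(\<epsilon> i * t) *\<^sub>R axis (\<pi> i) 1 \<in> k ` A \<longleftrightarrow> t *\<^sub>R axis i 1 \<in> A"
      "- ((\<epsilon> i * t) *\<^sub>R axis (\<pi> i) 1) \<in> k ` A \<longleftrightarrow> - (t *\<^sub>R axis i 1) \<in> A"
      unfolding k_axis[symmetric] mem_image_k_iff by (simp_all add: linear_neg[OF linear_g])
    have zero: "0 \<in> k ` A \<longleftrightarrow> 0 \<in> A" unfolding mem_image_k_iff by (simp add: linear_0[OF linear_g])
    have sh: "shift ((\<epsilon> i * t) *\<^sub>R axis (\<pi> i) 1) (k ` A) = k ` shift (t *\<^sub>R axis i 1) A"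
      unfolding k_axis[symmetric] by (rule shift_image_k)
    have "profile_remainder F' H' i t A = g (profile_remainder F H (\<pi> i) (\<epsilon> i * t) (k ` A))"
      unfolding profile_remainder_def mem zero sh F'_def H'_def cg_row
      by (simp add: linear_diff[OF linear_g] linear_scale[OF linear_g] linear_0[OF linear_g] mult.commute)
    moreover have "(if - (t *\<^sub>R axis i 1) \<in> A then 0 else F' A)
        = g (if - ((\<epsilon> i * t) *\<^sub>R axis (\<pi> i) 1) \<in> k ` A then 0 else F (k ` A))"
      unfolding mem F'_def by (simp add: linear_0[OF linear_g])
    ultimately show ?thesis unfolding energy_def by (simp only: norm_g)
  qed
  obtain \<tau> where \<tau>: "\<tau> > 0" "\<And>y. norm y < \<tau> \<Longrightarrow> near y" by (rule near_origin) (rule that, assumption, blast)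
  have transfer: "L2norm P (difference_remainder (at_X F') (at_X H') i t)
      = L2norm P (difference_remainder (at_X F) (at_X H) (\<pi> i) (\<epsilon> i * t))" if "\<bar>t\<bar> < \<tau>" for i t
  proof -
    have near: "near (t *\<^sub>R axis i 1)" "near ((\<epsilon> i * t) *\<^sub>R axis (\<pi> i) 1)"
      using that by (intro \<tau>(2); simp add: norm_axis_1 abs_mult abs_sign)+
    have "(L2norm P (difference_remainder (at_X F') (at_X H') i t))\<^sup>2 = (\<integral>\<omega>. energy F' H' i t (X \<omega>) \<partial>P)"
      by (rule remainder_energy[where F=F' and H=H', OF F'm F'0 F'2 H'm H'0 H'2 near(1)])
    also have "\<dots> = (\<integral>\<omega>. energy F H (\<pi> i) (\<epsilon> i * t) (X \<omega>) \<partial>P)"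
      unfolding energy by (rule law_invariant_integral(1)[OF inv image_k_measurable]) measurable
    also have "\<dots> = (L2norm P (difference_remainder (at_X F) (at_X H) (\<pi> i) (\<epsilon> i * t)))\<^sup>2"
      by (rule remainder_energy[where F=F and H=H, OF F H H2 near(2), symmetric])
    finally show ?thesis using L2norm_nonneg by (meson power2_eq_imp_eq)
  qed
  have "strong_gradient (at_X F') (at_X H')"
  proof (rule strong_gradientI)
    fix e :: real and i :: 3 assume "e > 0"
    obtain d where d: "d > 0" "\<And>t. 0 < \<bar>t\<bar> \<Longrightarrow> \<bar>t\<bar> < d \<Longrightarrow>
        L2norm P (difference_remainder (at_X F) (at_X H) (\<pi> i) t) \<le> e * \<bar>t\<bar>"
      using strong_gradientD[OF strong_gradient_of_stationary_gradient[OF F(3) FH] \<open>e > 0\<close>] by metis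
    have "L2norm P (difference_remainder (at_X F') (at_X H') i t) \<le> e * \<bar>t\<bar>"
      if t: "0 < \<bar>t\<bar>" "\<bar>t\<bar> < min d \<tau>" for t
      using d(2)[of "\<epsilon> i * t"] transfer[of t i] t by (simp add: abs_mult abs_sign)
    then show "\<exists>d>0. \<forall>t. 0 < \<bar>t\<bar> \<and> \<bar>t\<bar> < d \<longrightarrow>
        L2norm P (difference_remainder (at_X F') (at_X H') i t) \<le> e * \<bar>t\<bar>"
      using d(1) \<tau>(1) by (intro exI[of _ "min d \<tau>"]) auto
  qed
  then show "stationary_gradient P (at_X F') (at_X H')"
    by (rule stationary_gradient_of_strong_gradient[OF F'2 H'2])
qed

end

section \<open>Symmetry of the beta-matrix\<close>

lemma isotropic_symmetric:
  assumes "isotropic C" shows "tensor_apply C \<xi> \<bullet> \<eta> = \<xi> \<bullet> tensor_apply C \<eta>"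
proof -
  obtain c1 c2 where C: "\<And>\<xi>. tensor_apply C \<xi> =
      (c1 * trace \<xi>) *\<^sub>R mat 1 + c2 *\<^sub>R ((1/2) *\<^sub>R (\<xi> + transpose \<xi>))"
    using assms unfolding isotropic_def by blast
  have tr: "mat 1 \<bullet> \<zeta> = trace \<zeta>" for \<zeta> :: mat3
    by (simp add: inner_vec_def trace_def mat_def if_distrib[of "\<lambda>x. x * _"] cong: if_cong)
  have "transpose \<xi> \<bullet> \<eta> = \<xi> \<bullet> transpose \<eta>" for \<xi> \<eta> :: mat3
    unfolding inner_vec_def by (subst sum.swap) (simp add: transpose_def)
  then show ?thesis
    unfolding C by (simp add: inner_add_left inner_add_right tr inner_commute[of _ "mat 1"])
qed

context measurable_origin_inclusion begin

lemma H1_0_iff: "u \<in> H1_0 P \<longleftrightarrow> u \<in> L2 P \<and> (\<exists>G. stationary_gradient P u G) \<and> supported u"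
  unfolding H1_0_def H1_def supported_def using vanishes_outside_iff[OF L2_measurable] by blast

lemma L2_0_iff: "u \<in> L2_0 P \<longleftrightarrow> u \<in> L2 P \<and> supported u"
  unfolding L2_0_def supported_def using vanishes_outside_iff[OF L2_measurable] by blast

text \<open>The weak form of the resolvent equation with a constant load \<open>\<xi>\<close> in place of a coordinate vector.
Symmetries map coordinate vectors to multiples of coordinate vectors, and then linearity in the load
is needed.\<close>

definition is_solution :: "tensor4 \<Rightarrow> real \<Rightarrow> vec3 \<Rightarrow> (vec3 set \<Rightarrow> vec3) \<Rightarrow> bool" where
  "is_solution C l \<xi> b \<longleftrightarrow> b \<in> H1_0 P \<and>
     (\<forall>\<phi>\<in>H1_0 P. elastic_form P C b \<phi> = (\<integral>\<omega>. (l *\<^sub>R b \<omega> + \<xi>) \<bullet> \<phi> \<omega> \<partial>P))"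

lemma elastic_form_lincomb:
  assumes "u \<in> H1_0 P" "v \<in> H1_0 P" "\<phi> \<in> H1_0 P"
  shows "elastic_form P C (\<lambda>\<omega>. a *\<^sub>R u \<omega> + b *\<^sub>R v \<omega>) \<phi> = a * elastic_form P C u \<phi> + b * elastic_form P C v \<phi>"
proof -
  obtain G H J where u: "u \<in> L2 P" "stationary_gradient P u G" and v: "v \<in> L2 P" "stationary_gradient P v H"
    and \<phi>: "\<phi> \<in> L2 P" "stationary_gradient P \<phi> J"
    using assms by (auto simp: H1_0_iff)
  note I = L2_integrable_inner[OF L2_linear_image[OF linear_tensor_apply stationary_gradient_L2[OF u(2)]] stationary_gradient_L2[OF \<phi>(2)], of C]
    L2_integrable_inner[OF L2_linear_image[OF linear_tensor_apply stationary_gradient_L2[OF v(2)]] stationary_gradient_L2[OF \<phi>(2)], of C]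
  have uv: "(\<lambda>\<omega>. a *\<^sub>R u \<omega> + b *\<^sub>R v \<omega>) \<in> L2 P" by (intro L2_add L2_scaleR u v)
  have "elastic_form P C (\<lambda>\<omega>. a *\<^sub>R u \<omega> + b *\<^sub>R v \<omega>) \<phi>
      = (\<integral>\<omega>. tensor_apply C (a *\<^sub>R G \<omega> + b *\<^sub>R H \<omega>) \<bullet> J \<omega> \<partial>P)"
    by (rule elastic_form_eq[OF uv stationary_gradient_lincomb[OF u v] \<phi>])
  also have "\<dots> = (\<integral>\<omega>. a * (tensor_apply C (G \<omega>) \<bullet> J \<omega>) + b * (tensor_apply C (H \<omega>) \<bullet> J \<omega>) \<partial>P)"
    by (simp add: linear_add[OF linear_tensor_apply] linear_scale[OF linear_tensor_apply] inner_add_left)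
  also have "\<dots> = a * elastic_form P C u \<phi> + b * elastic_form P C v \<phi>"
    using I by (simp add: elastic_form_eq[OF u \<phi>] elastic_form_eq[OF v \<phi>])
  finally show ?thesis .
qed

lemma H1_0_lincomb:
  assumes "u \<in> H1_0 P" "v \<in> H1_0 P"
  shows "(\<lambda>\<omega>. a *\<^sub>R u \<omega> + b *\<^sub>R v \<omega>) \<in> H1_0 P"
proof -
  obtain G H where u: "u \<in> L2 P" "stationary_gradient P u G" "supported u"
    and v: "v \<in> L2 P" "stationary_gradient P v H" "supported v"
    using assms by (auto simp: H1_0_iff)
  have "supported (\<lambda>\<omega>. a *\<^sub>R u \<omega> + b *\<^sub>R v \<omega>)"
    using u(3) v(3) unfolding supported_def by eventually_elim simp
  moreover have "(\<lambda>\<omega>. a *\<^sub>R u \<omega> + b *\<^sub>R v \<omega>) \<in> L2 P" by (intro L2_add L2_scaleR u v)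
  ultimately show ?thesis
    using stationary_gradient_lincomb[OF u(1,2) v(1,2)] unfolding H1_0_iff by iprover
qed

lemma integrable_load:
  assumes "b \<in> L2 P" "\<phi> \<in> L2 P"
  shows "integrable P (\<lambda>\<omega>. (l *\<^sub>R b \<omega> + \<xi>) \<bullet> \<phi> \<omega>)"
  by (intro L2_integrable_inner L2_add L2_scaleR L2_const finite_measure_P assms)

lemma is_solution_lincomb:
  assumes "is_solution C l \<xi> u" "is_solution C l \<eta> v"
  shows "is_solution C l (a *\<^sub>R \<xi> + b *\<^sub>R \<eta>) (\<lambda>\<omega>. a *\<^sub>R u \<omega> + b *\<^sub>R v \<omega>)"
  unfolding is_solution_def
proof (intro conjI ballI)
  have uv: "u \<in> H1_0 P" "v \<in> H1_0 P" using assms by (simp_all add: is_solution_def)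
  show "(\<lambda>\<omega>. a *\<^sub>R u \<omega> + b *\<^sub>R v \<omega>) \<in> H1_0 P" by (rule H1_0_lincomb[OF uv])
  fix \<phi> assume \<phi>: "\<phi> \<in> H1_0 P"
  have L: "u \<in> L2 P" "v \<in> L2 P" "\<phi> \<in> L2 P" using uv \<phi> by (simp_all add: H1_0_iff)
  have "elastic_form P C (\<lambda>\<omega>. a *\<^sub>R u \<omega> + b *\<^sub>R v \<omega>) \<phi>
      = a * (\<integral>\<omega>. (l *\<^sub>R u \<omega> + \<xi>) \<bullet> \<phi> \<omega> \<partial>P) + b * (\<integral>\<omega>. (l *\<^sub>R v \<omega> + \<eta>) \<bullet> \<phi> \<omega> \<partial>P)"
    using assms \<phi> by (simp add: elastic_form_lincomb[OF uv \<phi>] is_solution_def)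
  also have "\<dots> = (\<integral>\<omega>. a * ((l *\<^sub>R u \<omega> + \<xi>) \<bullet> \<phi> \<omega>) + b * ((l *\<^sub>R v \<omega> + \<eta>) \<bullet> \<phi> \<omega>) \<partial>P)"
    using integrable_load[OF L(1,3), of l \<xi>] integrable_load[OF L(2,3), of l \<eta>] by simp
  also have "\<dots> = (\<integral>\<omega>. (l *\<^sub>R (a *\<^sub>R u \<omega> + b *\<^sub>R v \<omega>) + (a *\<^sub>R \<xi> + b *\<^sub>R \<eta>)) \<bullet> \<phi> \<omega> \<partial>P)"
    by (intro Bochner_Integration.integral_cong refl) (simp add: inner_add_left algebra_simps)
  finally show "elastic_form P C (\<lambda>\<omega>. a *\<^sub>R u \<omega> + b *\<^sub>R v \<omega>) \<phi>
      = (\<integral>\<omega>. (l *\<^sub>R (a *\<^sub>R u \<omega> + b *\<^sub>R v \<omega>) + (a *\<^sub>R \<xi> + b *\<^sub>R \<eta>)) \<bullet> \<phi> \<omega> \<partial>P)" .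
qed

text \<open>The constant load does not vanish outside of the inclusions, but its restriction to the inclusions
does, and test fields do not see the difference.\<close>

lemma is_solution_exists:
  assumes "l \<notin> op_spectrum P (A0 P C)"
  obtains b where "is_solution C l \<xi> b"
proof -
  define h where "h \<omega> = (if 0 \<in> \<omega> then \<xi> else 0)" for \<omega> :: "vec3 set"
  have h: "h \<in> L2 P" unfolding h_def by (intro L2_restrict L2_const finite_measure_P) measurable
  have "supported h" unfolding supported_def by (rule AE_I2) (simp add: h_def)
  then have "h \<in> L2_0 P" using h by (simp add: L2_0_iff)
  then obtain b f where bf: "(b, f) \<in> A0 P C" "AE \<omega> in P. f \<omega> - l *\<^sub>R b \<omega> = h \<omega>"
    using assms unfolding op_spectrum_def resolvent_set_def by blast
  have b: "b \<in> H1_0 P" "f \<in> L2_0 P" and form: "\<And>\<phi>. \<phi> \<in> H1_0 P \<Longrightarrow> elastic_form P C b \<phi> = (\<integral>\<omega>. f \<omega> \<bullet> \<phi> \<omega> \<partial>P)"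
    using bf(1) by (auto simp: A0_def)
  have L: "b \<in> L2 P" "f \<in> L2 P" using b by (auto simp: H1_0_iff L2_0_iff)
  have "is_solution C l \<xi> b"
    unfolding is_solution_def
  proof (intro conjI ballI b(1))
    fix \<phi> assume \<phi>: "\<phi> \<in> H1_0 P"
    then have \<phi>L: "\<phi> \<in> L2 P" "supported \<phi>" by (auto simp: H1_0_iff)
    note [measurable] = L2_measurable[OF L(1)] L2_measurable[OF L(2)] L2_measurable[OF \<phi>L(1)]
    have "(\<integral>\<omega>. f \<omega> \<bullet> \<phi> \<omega> \<partial>P) = (\<integral>\<omega>. (l *\<^sub>R b \<omega> + \<xi>) \<bullet> \<phi> \<omega> \<partial>P)"
    proof (rule integral_cong_AE)
      show "AE \<omega> in P. f \<omega> \<bullet> \<phi> \<omega> = (l *\<^sub>R b \<omega> + \<xi>) \<bullet> \<phi> \<omega>"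
        using bf(2) \<phi>L(2)[unfolded supported_def]
      proof eventually_elim
        case (elim \<omega>)
        then have "f \<omega> = l *\<^sub>R b \<omega> + h \<omega>" by (simp add: algebra_simps)
        then show ?case using elim(2) by (cases "0 \<in> \<omega>") (simp_all add: h_def)
      qed
    qed measurable
    then show "elastic_form P C b \<phi> = (\<integral>\<omega>. (l *\<^sub>R b \<omega> + \<xi>) \<bullet> \<phi> \<omega> \<partial>P)" using form[OF \<phi>] by simp
  qed
  then show ?thesis by (rule that)
qed

lemma is_solution_unique:
  assumes "l \<notin> op_spectrum P (A0 P C)" "is_solution C l \<xi> u" "is_solution C l \<xi> v"
  shows "AE \<omega> in P. u \<omega> = v \<omega>"
proof -
  define d where "d \<omega> = 1 *\<^sub>R u \<omega> + (- 1) *\<^sub>R v \<omega>" for \<omega>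
  have "is_solution C l (1 *\<^sub>R \<xi> + (- 1) *\<^sub>R \<xi>) d"
    unfolding d_def by (rule is_solution_lincomb[OF assms(2,3)])
  then have d: "d \<in> H1_0 P" "\<And>\<phi>. \<phi> \<in> H1_0 P \<Longrightarrow> elastic_form P C d \<phi> = (\<integral>\<omega>. (l *\<^sub>R d \<omega>) \<bullet> \<phi> \<omega> \<partial>P)"
    by (auto simp: is_solution_def)
  have dL: "d \<in> L2 P" "supported d" using d(1) by (auto simp: H1_0_iff)
  have "(\<lambda>\<omega>. l *\<^sub>R d \<omega>) \<in> L2_0 P"
    unfolding L2_0_iff using L2_scaleR[OF dL(1)] dL(2) by (auto simp: supported_def elim: eventually_mono)
  then have "(d, \<lambda>\<omega>. l *\<^sub>R d \<omega>) \<in> A0 P C" using d by (auto simp: A0_def)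
  moreover obtain K where K: "\<forall>(u, f)\<in>A0 P C. L2norm P u \<le> K * L2norm P (\<lambda>\<omega>. f \<omega> - l *\<^sub>R u \<omega>)"
    using assms(1) unfolding op_spectrum_def resolvent_set_def by blast
  ultimately have "L2norm P d \<le> K * L2norm P (\<lambda>\<omega>. l *\<^sub>R d \<omega> - l *\<^sub>R d \<omega>)" by fastforce
  then have "L2norm P d \<le> 0" by (simp add: L2norm_def)
  then have "L2norm P d = 0" using L2norm_nonneg by (rule antisym)
  then have "AE \<omega> in P. d \<omega> = 0" by (rule L2norm_eq_0[OF dL(1)])
  then show ?thesis by (auto simp: d_def elim: eventually_mono)
qed

lemma H1_0_condexp:
  assumes "u \<in> H1_0 P"
  obtains G F H where "stationary_gradient P u G" "is_condexp u F" "is_condexp G H"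
    "stationary_gradient P (at_X F) (at_X H)" "(at_X F) \<in> H1_0 P"
proof -
  obtain G where u: "u \<in> L2 P" "supported u" and G: "stationary_gradient P u G"
    using assms unfolding H1_0_iff by blast
  have sG: "supported G" by (rule gradient_supported[OF u G])
  obtain F where F: "is_condexp u F" by (rule is_condexp_exists[OF u])
  obtain H where H: "is_condexp G H" by (rule is_condexp_exists[OF stationary_gradient_L2[OF G] sG])
  have FH: "stationary_gradient P (at_X F) (at_X H)"
    by (rule condexp_stationary_gradient[OF u F G sG H])
  moreover have "(at_X F) \<in> H1_0 P"
    unfolding H1_0_iff using is_condexpD[OF F] FH supported_profile[where F=F] by blast
  ultimately show ?thesis using that G F H by blast
qed

lemma elastic_form_condexp_right:
  assumes u: "(at_X F) \<in> L2 P" "stationary_gradient P (at_X F) (at_X H)"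
      "H \<in> borel_measurable points_sigma"
    and \<phi>: "\<phi> \<in> L2 P" "stationary_gradient P \<phi> G\<phi>" "is_condexp G\<phi> H\<phi>"
  shows "elastic_form P C (at_X F) \<phi> = (\<integral>\<omega>. tensor_apply C (H (X \<omega>)) \<bullet> H\<phi> (X \<omega>) \<partial>P)"
proof -
  note [measurable] = u(3)
  have "elastic_form P C (at_X F) \<phi> = (\<integral>\<omega>. tensor_apply C (H (X \<omega>)) \<bullet> G\<phi> \<omega> \<partial>P)"
    by (rule elastic_form_eq[OF u(1,2) \<phi>(1,2)])
  also have "\<dots> = (\<integral>\<omega>. tensor_apply C (H (X \<omega>)) \<bullet> H\<phi> (X \<omega>) \<partial>P)"
    by (rule is_condexpD(4)[OF \<phi>(3)]) (measurable, rule L2_linear_image[OF linear_tensor_apply stationary_gradient_L2[OF u(2)]])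
  finally show ?thesis .
qed

lemma load_condexp_right:
  assumes "F \<in> borel_measurable points_sigma" "(at_X F) \<in> L2 P" "is_condexp \<phi> F\<phi>"
  shows "(\<integral>\<omega>. (l *\<^sub>R F (X \<omega>) + \<xi>) \<bullet> \<phi> \<omega> \<partial>P) = (\<integral>\<omega>. (l *\<^sub>R F (X \<omega>) + \<xi>) \<bullet> F\<phi> (X \<omega>) \<partial>P)"
proof -
  note [measurable] = assms(1)
  have "(\<lambda>A. l *\<^sub>R F A + \<xi>) \<in> borel_measurable points_sigma" by measurable
  from is_condexpD(4)[OF assms(3) this] show ?thesis
    by (simp add: L2_add L2_scaleR L2_const finite_measure_P assms(2))
qed

text \<open>The averaged solution solves the same equation, because averaging is a symmetric operation that
commutes with the gradient, and can therefore be moved to the test field and back.\<close>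

lemma condexp_solution:
  assumes C: "isotropic C" and b: "is_solution C l \<xi> b"
    and F: "stationary_gradient P b G" "is_condexp b F" "is_condexp G H"
      "stationary_gradient P (at_X F) (at_X H)" "(at_X F) \<in> H1_0 P"
  shows "is_solution C l \<xi> (at_X F)"
  unfolding is_solution_def
proof (intro conjI ballI F(5))
  fix \<phi> assume \<phi>: "\<phi> \<in> H1_0 P"
  then have \<phi>L: "\<phi> \<in> L2 P" by (simp add: H1_0_iff)
  have bL: "b \<in> L2 P" using b by (simp add: is_solution_def H1_0_iff)
  obtain G\<phi> F\<phi> H\<phi> where \<phi>F: "stationary_gradient P \<phi> G\<phi>" "is_condexp \<phi> F\<phi>" "is_condexp G\<phi> H\<phi>"
    "stationary_gradient P (at_X F\<phi>) (at_X H\<phi>)" "(at_X F\<phi>) \<in> H1_0 P"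
    by (rule H1_0_condexp[OF \<phi>])
  note FD = is_condexpD[OF F(2)] and HD = is_condexpD[OF F(3)]
    and F\<phi>D = is_condexpD[OF \<phi>F(2)] and H\<phi>D = is_condexpD[OF \<phi>F(3)]
  note [measurable] = FD(1) HD(1) F\<phi>D(1) H\<phi>D(1)
  have "elastic_form P C (at_X F) \<phi> = (\<integral>\<omega>. tensor_apply C (H (X \<omega>)) \<bullet> H\<phi> (X \<omega>) \<partial>P)"
    by (rule elastic_form_condexp_right[OF FD(3) F(4) HD(1) \<phi>L \<phi>F(1,3)])
  also have "\<dots> = (\<integral>\<omega>. tensor_apply C (H\<phi> (X \<omega>)) \<bullet> H (X \<omega>) \<partial>P)"
    by (intro Bochner_Integration.integral_cong refl) (subst isotropic_symmetric[OF C], rule inner_commute)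
  also have "\<dots> = (\<integral>\<omega>. tensor_apply C (H\<phi> (X \<omega>)) \<bullet> G \<omega> \<partial>P)"
    by (rule is_condexpD(4)[OF F(3), symmetric]) (measurable, rule L2_linear_image[OF linear_tensor_apply H\<phi>D(3)])
  also have "\<dots> = (\<integral>\<omega>. tensor_apply C (G \<omega>) \<bullet> H\<phi> (X \<omega>) \<partial>P)"
    by (intro Bochner_Integration.integral_cong refl) (subst isotropic_symmetric[OF C], rule inner_commute)
  also have "\<dots> = elastic_form P C b (at_X F\<phi>)"
    by (rule elastic_form_eq[OF bL F(1) F\<phi>D(3) \<phi>F(4), symmetric])
  also have "\<dots> = (\<integral>\<omega>. (l *\<^sub>R b \<omega> + \<xi>) \<bullet> F\<phi> (X \<omega>) \<partial>P)"
    using b \<phi>F(5) by (simp add: is_solution_def)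
  also have "\<dots> = (\<integral>\<omega>. l * (F\<phi> (X \<omega>) \<bullet> b \<omega>) + \<xi> \<bullet> F\<phi> (X \<omega>) \<partial>P)"
    by (simp add: inner_add_left inner_commute[of "b _"])
  also have "\<dots> = l * (\<integral>\<omega>. F\<phi> (X \<omega>) \<bullet> b \<omega> \<partial>P) + (\<integral>\<omega>. \<xi> \<bullet> F\<phi> (X \<omega>) \<partial>P)"
    using L2_integrable_inner[OF F\<phi>D(3) bL] L2_integrable_inner[OF L2_const[OF finite_measure_P, of \<xi>] F\<phi>D(3)] by simp
  also have "(\<integral>\<omega>. F\<phi> (X \<omega>) \<bullet> b \<omega> \<partial>P) = (\<integral>\<omega>. F\<phi> (X \<omega>) \<bullet> F (X \<omega>) \<partial>P)"
    by (rule FD(4)[OF F\<phi>D(1) F\<phi>D(3)])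
  also have "l * (\<integral>\<omega>. F\<phi> (X \<omega>) \<bullet> F (X \<omega>) \<partial>P) + (\<integral>\<omega>. \<xi> \<bullet> F\<phi> (X \<omega>) \<partial>P)
      = (\<integral>\<omega>. l * (F\<phi> (X \<omega>) \<bullet> F (X \<omega>)) + \<xi> \<bullet> F\<phi> (X \<omega>) \<partial>P)"
    using L2_integrable_inner[OF F\<phi>D(3) FD(3)] L2_integrable_inner[OF L2_const[OF finite_measure_P, of \<xi>] F\<phi>D(3)] by simp
  also have "\<dots> = (\<integral>\<omega>. (l *\<^sub>R F (X \<omega>) + \<xi>) \<bullet> F\<phi> (X \<omega>) \<partial>P)"
    by (simp add: inner_add_left inner_commute[of "F (X _)"])
  also have "\<dots> = (\<integral>\<omega>. (l *\<^sub>R F (X \<omega>) + \<xi>) \<bullet> \<phi> \<omega> \<partial>P)"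
    by (rule load_condexp_right[OF FD(1,3) \<phi>F(2), symmetric])
  finally show "elastic_form P C (at_X F) \<phi> = (\<integral>\<omega>. (l *\<^sub>R F (X \<omega>) + \<xi>) \<bullet> \<phi> \<omega> \<partial>P)" .
qed

text \<open>Testing the transformed solution with a field amounts to testing the original one with the field
transformed back; test fields may be averaged first, so that they too are functions of the inclusion
at the origin. The elastic energy is unchanged by isotropy and the mean by invariance of the law.\<close>

lemma transformed_solution:
  assumes sp: "signed_permutation \<epsilon> \<pi>" and C: "isotropic C"
    and inv: "law_invariant (signed_perm (\<lambda>i. \<epsilon> (inv \<pi> i)) (inv \<pi>))" "law_invariant (signed_perm \<epsilon> \<pi>)"
    and F: "F \<in> borel_measurable points_sigma" "F {} = 0" "(at_X F) \<in> L2 P"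
    and H: "H \<in> borel_measurable points_sigma" "H {} = 0"
    and FH: "stationary_gradient P (at_X F) (at_X H)"
    and sol: "is_solution C l \<xi> (at_X F)"
  shows "is_solution C l (signed_perm \<epsilon> \<pi> \<xi>)
    (\<lambda>\<omega>. signed_perm \<epsilon> \<pi> (F (signed_perm (\<lambda>i. \<epsilon> (inv \<pi> i)) (inv \<pi>) ` X \<omega>)))"
proof -
  interpret signed_permutation \<epsilon> \<pi> by (rule sp)
  define F' where "F' A = g (F (k ` A))" for A
  define H' where "H' A = cg (H (k ` A))" for A
  note tr = transformed_gradient[where F=F and H=H, OF sp inv(1) F H FH, folded F'_def H'_def]
  note [measurable] = F(1) H(1) tr(1) tr(4)
  have F'H: "(at_X F') \<in> H1_0 P"
    unfolding H1_0_iff using tr(2,3,6) supported_profile[where F=F'] by blast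
  have "elastic_form P C (at_X F') \<phi> = (\<integral>\<omega>. (l *\<^sub>R F' (X \<omega>) + g \<xi>) \<bullet> \<phi> \<omega> \<partial>P)"
    if \<phi>: "\<phi> \<in> H1_0 P" for \<phi>
  proof -
    have \<phi>L: "\<phi> \<in> L2 P" using \<phi> by (simp add: H1_0_iff)
    obtain G\<phi> F\<phi> H\<phi> where \<phi>F: "stationary_gradient P \<phi> G\<phi>" "is_condexp \<phi> F\<phi>" "is_condexp G\<phi> H\<phi>"
      "stationary_gradient P (at_X F\<phi>) (at_X H\<phi>)" "(at_X F\<phi>) \<in> H1_0 P"
      by (rule H1_0_condexp[OF \<phi>])
    note F\<phi>D = is_condexpD[OF \<phi>F(2)] and H\<phi>D = is_condexpD[OF \<phi>F(3)]
    note [measurable] = F\<phi>D(1) H\<phi>D(1)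
    define \<psi> where "\<psi> A = k (F\<phi> (g ` A))" for A
    define \<Psi> where "\<Psi> A = ck (H\<phi> (g ` A))" for A
    note tr' = transformed_gradient[where F=F\<phi> and H=H\<phi>, OF inverse_signed_permutation _ F\<phi>D(1-3) H\<phi>D(1,2) \<phi>F(4),
        unfolded inverse_inverse inv_perm, OF inv(2), folded \<psi>_def \<Psi>_def]
    have \<psi>H: "(at_X \<psi>) \<in> H1_0 P"
      unfolding H1_0_iff using tr'(2,3,6) supported_profile[where F=\<psi>] by blast
    have "elastic_form P C (at_X F') \<phi> = (\<integral>\<omega>. tensor_apply C (H' (X \<omega>)) \<bullet> H\<phi> (X \<omega>) \<partial>P)"
      by (rule elastic_form_condexp_right[OF tr(3,6,4) \<phi>L \<phi>F(1,3)])
    also have "\<dots> = (\<integral>\<omega>. tensor_apply C (H (k ` X \<omega>)) \<bullet> \<Psi> (k ` X \<omega>) \<partial>P)"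
      by (simp add: H'_def \<Psi>_def isotropic_cg[OF C] inner_cg)
    also have "\<dots> = (\<integral>\<omega>. tensor_apply C (H (X \<omega>)) \<bullet> \<Psi> (X \<omega>) \<partial>P)"
      using tr'(4) by (intro law_invariant_integral(1)[OF inv(1) image_k_measurable]) measurable
    also have "\<dots> = elastic_form P C (at_X F) (at_X \<psi>)"
      by (rule elastic_form_eq[OF F(3) FH tr'(3,6), symmetric])
    also have "\<dots> = (\<integral>\<omega>. (l *\<^sub>R F (X \<omega>) + \<xi>) \<bullet> \<psi> (X \<omega>) \<partial>P)"
      using sol \<psi>H by (simp add: is_solution_def)
    also have "\<dots> = (\<integral>\<omega>. (l *\<^sub>R F (k ` X \<omega>) + \<xi>) \<bullet> \<psi> (k ` X \<omega>) \<partial>P)"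
      using tr'(1) by (intro law_invariant_integral(1)[OF inv(1) image_k_measurable, symmetric]) measurable
    also have "\<dots> = (\<integral>\<omega>. (l *\<^sub>R F' (X \<omega>) + g \<xi>) \<bullet> F\<phi> (X \<omega>) \<partial>P)"
      by (simp add: F'_def \<psi>_def inner_g[symmetric] linear_add[OF linear_g] linear_scale[OF linear_g])
    also have "\<dots> = (\<integral>\<omega>. (l *\<^sub>R F' (X \<omega>) + g \<xi>) \<bullet> \<phi> \<omega> \<partial>P)"
      by (rule load_condexp_right[OF tr(1,3) \<phi>F(2), symmetric])
    finally show ?thesis .
  qed
  then show ?thesis using F'H unfolding is_solution_def F'_def by blast
qed

text \<open>By uniqueness, every solution is a function of the inclusion at the origin, and transforming it gives
the solution for the transformed load.\<close>

lemma mean_solution_symmetry: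
  assumes sp: "signed_permutation \<epsilon> \<pi>" and C: "isotropic C"
    and l: "l \<notin> op_spectrum P (A0 P C)" and inv: "origin_law_invariant P (signed_perm \<epsilon> \<pi>)"
    and u: "is_solution C l \<xi> u" and v: "is_solution C l (signed_perm \<epsilon> \<pi> \<xi>) v"
  shows "(\<integral>\<omega>. v \<omega> \<partial>P) = signed_perm \<epsilon> \<pi> (\<integral>\<omega>. u \<omega> \<partial>P)"
proof -
  interpret signed_permutation \<epsilon> \<pi> by (rule sp)
  note inv' = law_invariant_inverse[OF sp inv]
  have "u \<in> H1_0 P" using u by (simp add: is_solution_def)
  then obtain G F H where F: "stationary_gradient P u G" "is_condexp u F" "is_condexp G H"
    "stationary_gradient P (at_X F) (at_X H)" "(at_X F) \<in> H1_0 P"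
    by (rule H1_0_condexp)
  note FD = is_condexpD[OF F(2)] and HD = is_condexpD[OF F(3)]
  note [measurable] = FD(1)
  have uF: "is_solution C l \<xi> (at_X F)" by (rule condexp_solution[OF C u F])
  have vF: "is_solution C l (g \<xi>) (\<lambda>\<omega>. g (F (k ` X \<omega>)))"
    by (rule transformed_solution[where F=F and H=H, OF sp C inv' FD(1-3) HD(1,2) F(4) uF])
  have meas: "u \<in> borel_measurable P" "v \<in> borel_measurable P"
    using u v by (auto simp: is_solution_def H1_0_iff intro: L2_measurable)
  have bl: "bounded_linear g" using linear_g by (simp add: linear_conv_bounded_linear)
  have FkI: "integrable P (\<lambda>\<omega>. F (k ` X \<omega>))"
    using law_invariant_integral(2)[OF inv'(1) image_k_measurable FD(1)] L2_integrable[OF finite_measure_P FD(3)] by simp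
  have "(\<integral>\<omega>. v \<omega> \<partial>P) = (\<integral>\<omega>. g (F (k ` X \<omega>)) \<partial>P)"
    using is_solution_unique[OF l v vF] by (intro integral_cong_AE meas) measurable
  also have "\<dots> = g (\<integral>\<omega>. F (k ` X \<omega>) \<partial>P)"
    by (rule integral_bounded_linear[OF bl FkI])
  also have "(\<integral>\<omega>. F (k ` X \<omega>) \<partial>P) = (\<integral>\<omega>. F (X \<omega>) \<partial>P)"
    by (rule law_invariant_integral(1)[OF inv'(1) image_k_measurable FD(1)])
  also have "\<dots> = (\<integral>\<omega>. u \<omega> \<partial>P)"
    using is_solution_unique[OF l uF u] by (intro integral_cong_AE meas) measurable
  finally show ?thesis .
qed

definition mean_b :: "tensor4 \<Rightarrow> real \<Rightarrow> 3 \<Rightarrow> 3 \<Rightarrow> real" where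
  "mean_b C l r s = (\<integral>\<omega>. b_field P C l s \<omega> \<partial>P) $ r"

lemma b_field_solution:
  assumes "l \<notin> op_spectrum P (A0 P C)"
  shows "is_solution C l (axis i 1) (b_field P C l i)"
proof -
  have "b_solution P C l i = is_solution C l (axis i 1)"
    by (simp add: fun_eq_iff b_solution_def is_solution_def)
  then show ?thesis
    using is_solution_exists[OF assms, of "axis i 1"] unfolding b_field_def by (metis someI)
qed

lemma mean_b_symmetry:
  assumes sp: "signed_permutation \<epsilon> \<pi>" and C: "isotropic C"
    and l: "l \<notin> op_spectrum P (A0 P C)" and inv: "origin_law_invariant P (signed_perm \<epsilon> \<pi>)"
  shows "mean_b C l (\<pi> r) (\<pi> s) = \<epsilon> r * \<epsilon> s * mean_b C l r s"
proof -
  interpret signed_permutation \<epsilon> \<pi> by (rule sp)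
  let ?b = "b_field P C l"
  have v: "is_solution C l (\<epsilon> s *\<^sub>R axis s 1 + 0 *\<^sub>R axis s 1) (\<lambda>\<omega>. \<epsilon> s *\<^sub>R ?b s \<omega> + 0 *\<^sub>R ?b s \<omega>)"
    by (rule is_solution_lincomb[OF b_field_solution[OF l] b_field_solution[OF l]])
  then have v: "is_solution C l (g (axis (\<pi> s) 1)) (\<lambda>\<omega>. \<epsilon> s *\<^sub>R ?b s \<omega>)" by (simp add: g_axis)
  have "\<epsilon> s *\<^sub>R (\<integral>\<omega>. ?b s \<omega> \<partial>P) = g (\<integral>\<omega>. ?b (\<pi> s) \<omega> \<partial>P)"
    using mean_solution_symmetry[OF sp C l inv b_field_solution[OF l] v] by simp
  then have "(\<epsilon> s *\<^sub>R (\<integral>\<omega>. ?b s \<omega> \<partial>P)) $ r = g (\<integral>\<omega>. ?b (\<pi> s) \<omega> \<partial>P) $ r" by simp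
  then have "\<epsilon> s * mean_b C l r s = \<epsilon> r * mean_b C l (\<pi> r) (\<pi> s)"
    by (simp add: mean_b_def signed_perm_def)
  then have "\<epsilon> r * (\<epsilon> s * mean_b C l r s) = (\<epsilon> r * \<epsilon> r) * mean_b C l (\<pi> r) (\<pi> s)" by simp
  then show ?thesis by (simp add: sign mult.assoc)
qed

lemma beta_entry:
  assumes l: "l \<notin> op_spectrum P (A0 P C)"
  shows "beta P C l $ r $ s = (if r = s then l else 0) + l\<^sup>2 * mean_b C l r s"
proof -
  interpret prob_space P by (rule prob_space_P)
  let ?b = "b_field P C l"
  have bI: "integrable P (?b i)" for i
    using b_field_solution[OF l, of i] by (auto simp: is_solution_def H1_0_iff intro: L2_integrable finite_measure_P)
  define E :: "3 \<Rightarrow> vec3 \<Rightarrow> mat3" where "E i x = (\<chi> r j. if j = i then x $ r else 0)" for i x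
  have E: "bounded_linear (E i)" for i
    unfolding linear_conv_bounded_linear[symmetric]
    by (rule linearI) (auto simp: E_def vec_eq_iff)
  have bm: "b_matrix P C l \<omega> = (\<Sum>i\<in>UNIV. E i (?b i \<omega>))" for \<omega>
    by (simp add: b_matrix_def E_def vec_eq_iff)
  have "integrable P (b_matrix P C l)"
    unfolding bm[abs_def] by (intro Bochner_Integration.integrable_sum integrable_bounded_linear[OF E bI])
  then have I: "integrable P (\<lambda>\<omega>. l *\<^sub>R mat 1 + l\<^sup>2 *\<^sub>R b_matrix P C l \<omega>)" by simp
  have entry: "bounded_linear (\<lambda>M :: mat3. M $ r $ s)"
    by (rule bounded_linear_compose[OF bounded_linear_vec_nth bounded_linear_vec_nth])
  have comp: "bounded_linear (\<lambda>x :: vec3. x $ r)" by (rule bounded_linear_vec_nth)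
  have bIr: "integrable P (\<lambda>\<omega>. ?b s \<omega> $ r)" by (rule integrable_bounded_linear[OF comp bI])
  have "beta P C l $ r $ s = (\<integral>\<omega>. (l *\<^sub>R mat 1 + l\<^sup>2 *\<^sub>R b_matrix P C l \<omega>) $ r $ s \<partial>P)"
    unfolding beta_def by (rule integral_bounded_linear[OF entry I, symmetric])
  also have "\<dots> = (\<integral>\<omega>. (if r = s then l else 0) + l\<^sup>2 * (?b s \<omega> $ r) \<partial>P)"
    by (intro Bochner_Integration.integral_cong refl) (simp add: mat_def b_matrix_def)
  also have "\<dots> = (if r = s then l else 0) + l\<^sup>2 * (\<integral>\<omega>. ?b s \<omega> $ r \<partial>P)"
    using bIr by (simp add: prob_space)
  also have "(\<integral>\<omega>. ?b s \<omega> $ r \<partial>P) = mean_b C l r s"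
    unfolding mean_b_def by (rule integral_bounded_linear[OF comp bI])
  finally show ?thesis .
qed

end

lemma reflection_signed_perm: "reflection j = signed_perm (\<lambda>i. if i = j then -1 else 1) (\<lambda>i. i)"
  by (auto simp: fun_eq_iff reflection_def signed_perm_def vec_eq_iff)

lemma reflection_signed_permutation: "signed_permutation (\<lambda>i. if i = j then -1 else 1) (\<lambda>i. i)"
  by unfold_locales (auto simp: bij_id[unfolded id_def])

definition turn_sign :: "3 \<Rightarrow> 3 \<Rightarrow> real" where
  "turn_sign j i = (if i = j + 1 then -1 else 1)"

definition turn_perm :: "3 \<Rightarrow> 3 \<Rightarrow> 3" where
  "turn_perm j i = (if i = j then j else if i = j + 1 then j + 2 else j + 1)"

text \<open>Arithmetic on the index type is modulo three, so that \<open>j\<close>, \<open>j + 1\<close>, \<open>j + 2\<close> are the three indices in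
cyclic order.\<close>

lemma quarter_turn_signed_perm: "quarter_turn j = signed_perm (turn_sign j) (turn_perm j)"
proof -
  have n: "(3::3) = 0" "(4::3) = 1" "(5::3) = 2" by simp_all
  have "quarter_turn j x $ i = signed_perm (turn_sign j) (turn_perm j) x $ i" for x i
    using exhaust_3[of j] exhaust_3[of i]
    by (elim disjE) (simp_all add: quarter_turn_def cross3_simps signed_perm_def turn_sign_def turn_perm_def
        axis_def inner_vec_def sum_3 n)
  then show ?thesis by (simp add: fun_eq_iff vec_eq_iff)
qed

lemma turn_signed_permutation: "signed_permutation (turn_sign j) (turn_perm j)"
proof
  have "turn_perm j (turn_perm j i) = i" for i
    using exhaust_3[of j] exhaust_3[of i] by (elim disjE) (simp_all add: turn_perm_def)
  then show "bij (turn_perm j)" by (rule involuntory_imp_bij)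
qed (simp add: turn_sign_def)

theorem proposition6p1:
  fixes \<Omega> :: "(real^3) set set"
    and incl :: "(real^3) set \<Rightarrow> nat \<Rightarrow> (real^3) set"
    and P :: "(real^3) set measure"
    and C0 :: "real^3^3^3^3"
    and l :: real
  assumes "admissible_geometry \<Omega> incl"
    and "stationary_ergodic_law \<Omega> P"
    and "origin_inclusion \<in> P \<rightarrow>\<^sub>M hausdorff_borel"
    and "finitely_many_shapes incl P"
    and "elasticity_tensor C0"
    and "isotropic C0"
    and "l \<ge> 0"
    and "l \<notin> op_spectrum P (A0 P C0)"
  shows "((\<forall>j. origin_law_invariant P (reflection j)) \<longrightarrow>
            (\<forall>r s. r \<noteq> s \<longrightarrow> beta P C0 l $ r $ s = 0))
       \<and> ((\<forall>j. origin_law_invariant P (quarter_turn j)) \<longrightarrow>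
            (\<exists>s. beta P C0 l = s *\<^sub>R mat 1))"
proof -
  interpret measurable_origin_inclusion \<Omega> incl P
    using assms(1-3) by unfold_locales
  let ?M = "mean_b C0 l"
  note entry = beta_entry[OF assms(8)]
  show ?thesis
  proof (intro conjI impI allI)
    fix r s :: 3 assume inv: "\<forall>j. origin_law_invariant P (reflection j)" and "r \<noteq> s"
    from inv have "origin_law_invariant P (signed_perm (\<lambda>i. if i = r then -1 else 1) (\<lambda>i. i))"
      by (simp only: reflection_signed_perm[symmetric])
    from mean_b_symmetry[OF reflection_signed_permutation assms(6,8) this, of r s]
    have "?M r s = 0" using \<open>r \<noteq> s\<close> by simp
    then show "beta P C0 l $ r $ s = 0" using \<open>r \<noteq> s\<close> by (simp add: entry)
  next
    assume inv: "\<forall>j. origin_law_invariant P (quarter_turn j)"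
    have sym: "?M (turn_perm j r) (turn_perm j s) = turn_sign j r * turn_sign j s * ?M r s" for j r s
      by (rule mean_b_symmetry[OF turn_signed_permutation assms(6,8)])
        (use inv in \<open>simp only: quarter_turn_signed_perm[symmetric]\<close>)
    have ne: "r + 1 \<noteq> r" "r + 2 \<noteq> r" "r + 1 \<noteq> r + 2" for r :: 3
      using exhaust_3[of r] by auto
    have off: "?M r (r + 1) = 0" "?M r (r + 2) = 0" for r
      using sym[of r r "r + 1"] sym[of r r "r + 2"] ne[of r] by (simp_all add: turn_perm_def turn_sign_def)
    have diag: "?M (r + 1) (r + 1) = ?M (r + 2) (r + 2)" for r
      using sym[of r "r + 1" "r + 1"] ne[of r] by (simp add: turn_perm_def turn_sign_def)
    have "beta P C0 l = (l + l\<^sup>2 * ?M 1 1) *\<^sub>R mat 1"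
    proof -
      have "beta P C0 l $ r $ s = ((l + l\<^sup>2 * ?M 1 1) *\<^sub>R mat 1) $ r $ s" for r s
      proof (cases "r = s")
        case True
        have "?M r r = ?M 1 1"
        proof -
          have "1 + 1 = (2::3)" "1 + 2 = (3::3)" "2 + 1 = (3::3)" "2 + 2 = (1::3)" by simp_all
          then have "?M 2 2 = ?M 3 3" "?M 3 3 = ?M 1 1" using diag[of 1] diag[of 2] by (simp_all only:)
          then show ?thesis using exhaust_3[of r] by auto
        qed
        then show ?thesis using True by (simp add: entry mat_def)
      next
        case False
        then have "s = r + 1 \<or> s = r + 2" using exhaust_3[of r] exhaust_3[of s] by auto
        then have "?M r s = 0" using off[of r] by auto
        then show ?thesis using False by (simp add: entry mat_def)
      qed
      then show ?thesis by (simp add: vec_eq_iff)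
    qed
    then show "\<exists>s. beta P C0 l = s *\<^sub>R mat 1" by blast
  qed
qed

end
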